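(* Let $X=\Gamma\backslash\mathfrak{H}$ be a Shimura curve of signature $(0;e_1,e_2,e_3)$, i.e. of genus zero with exactly three elliptic points, of orders $e_1,e_2,e_3$. Let $t(\tau)$ be the Hauptmodul of $X$ taking the values $0,1,\infty$ at the elliptic points of orders $e_1,e_2,e_3$ respectively, and let $\tau_1\in\mathfrak{H}$ be a representative of the elliptic point of order $e_1$. Put $$a=\tfrac12\Bigl(1-\tfrac1{e_1}-\tfrac1{e_2}-\tfrac1{e_3}\Bigr),\ b=a+\tfrac1{e_3},\ c=1-\tfrac1{e_1},\quad a'=a+\tfrac1{e_1},\ b'=b+\tfrac1{e_1},\ c'=c+\tfrac2{e_1}.$$ Let $k\ge4$ be an even integer. Then there is a constant $C\in\mathbb{C}$ such that the automorphic forms of weight $k$ on $\Gamma$ which, for $\tau$ in a neighborhood of $\tau_1$ (with a suitable holomorphic branch of $t(\tau)^{1/e_1}$ near $\tau_1$ used for all fractional powers of $t$, and principal branches of powers of $1-t$), are given by $$t^{\{k(1-1/e_1)/2\}}(1-t)^{\{k(1-1/e_2)/2\}}\,t^j\Bigl({}_2F_1(a,b;c;t)+C\,t^{1/e_1}\,{}_2F_1(a',b';c';t)\Bigr)^k,\qquad t=t(\tau),$$ for $j=0,\dots,\lfloor k(1-1/e_1)/2\rfloor+\lfloor k(1-1/e_2)/2\rfloor+\lfloor k(1-1/e_3)/2\rfloor-k$, form a basis of the space of automorphic forms of weight $k$ on $X$.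
   Context: A Shimura curve is $\Gamma\backslash\mathfrak{H}$ with $\Gamma\subset\mathrm{SL}(2,\mathbb{R})$ commensurable with the image of the norm-one units of an order in a quaternion algebra $B\ne M(2,\mathbb{Q})$ over a totally real field split at exactly one infinite place (compact). A Hauptmodul is a $\Gamma$-invariant meromorphic function on $\mathfrak{H}$ generating the function field of the genus-zero curve. The space of automorphic forms of weight $k$ consists of holomorphic $f$ on $\mathfrak{H}$ with $f(\gamma\tau)=(c\tau+d)^kf(\tau)$ for $\gamma=\begin{pmatrix}a&b\\c&d\end{pmatrix}\in\Gamma$. For $x\in\mathbb{Q}$, $\{x\}=x-\lfloor x\rfloor$. ${}_2F_1(a,b;c;t)=\sum_{n\ge0}\frac{(a)_n(b)_n}{(c)_n n!}t^n$ is the Gauss hypergeometric function. *)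

theory Defs
  imports
    "HOL-Complex_Analysis.Complex_Analysis"
    "HOL-Algebra.Coset"
    "HOL-Library.Function_Algebras"
begin

no_notation fps_nth (infixl "$" 75)

section \<open>The action of SL(2,R) on the upper half plane\<close>

definition SL2R :: "(real^2^2) monoid" where
  "SL2R = \<lparr>carrier = {A. det A = 1}, monoid.mult = (**), one = mat 1\<rparr>"

definition upper_half_plane :: "complex set" where
  "upper_half_plane = {z. Im z > 0}"

definition autom_factor :: "real^2^2 \<Rightarrow> complex \<Rightarrow> complex" where
  "autom_factor A z = of_real (A$2$1) * z + of_real (A$2$2)"

definition mobius :: "real^2^2 \<Rightarrow> complex \<Rightarrow> complex" where
  "mobius A z = (of_real (A$1$1) * z + of_real (A$1$2)) / autom_factor A z"

definition same_orbit :: "(real^2^2) set \<Rightarrow> complex \<Rightarrow> complex \<Rightarrow> bool" where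
  "same_orbit \<Gamma> z w \<longleftrightarrow> (\<exists>A\<in>\<Gamma>. w = mobius A z)"

definition commensurable_SL2R :: "(real^2^2) set \<Rightarrow> (real^2^2) set \<Rightarrow> bool" where
  "commensurable_SL2R G H \<longleftrightarrow>
     finite (rcosets\<^bsub>SL2R\<lparr>carrier := G\<rparr>\<^esub> (G \<inter> H)) \<and>
     finite (rcosets\<^bsub>SL2R\<lparr>carrier := H\<rparr>\<^esub> (G \<inter> H))"


section \<open>Totally real fields, quaternion algebras and orders\<close>

definition lincombs :: "real set \<Rightarrow> 'v::real_vector set \<Rightarrow> 'v set" where
  "lincombs R S = {\<Sum>s\<in>S. c s *\<^sub>R s | c. \<forall>s\<in>S. c s \<in> R}"

definition number_field :: "real set \<Rightarrow> bool" where
  "number_field F \<longleftrightarrow>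
     1 \<in> F \<and> (\<forall>x\<in>F. \<forall>y\<in>F. x - y \<in> F \<and> x * y \<in> F) \<and> (\<forall>x\<in>F. inverse x \<in> F) \<and>
     (\<exists>S. finite S \<and> F = lincombs \<rat> S)"

text \<open>Only the values of an embedding on the field \<open>F\<close> itself matter.\<close>

definition field_embedding :: "real set \<Rightarrow> (real \<Rightarrow> 'b::field) \<Rightarrow> bool" where
  "field_embedding F \<sigma> \<longleftrightarrow>
     \<sigma> 1 = 1 \<and> (\<forall>x\<in>F. \<forall>y\<in>F. \<sigma> (x + y) = \<sigma> x + \<sigma> y \<and> \<sigma> (x * y) = \<sigma> x * \<sigma> y)"

definition totally_real_field :: "real set \<Rightarrow> bool" where
  "totally_real_field F \<longleftrightarrow>
     number_field F \<and> (\<forall>\<sigma>::real \<Rightarrow> complex. field_embedding F \<sigma> \<longrightarrow> \<sigma> ` F \<subseteq> \<real>)"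

definition ring_of_integers :: "real set \<Rightarrow> real set" where
  "ring_of_integers F = {x\<in>F. algebraic_int x}"

text \<open>
  The vector \<open>x\<close> stands for \<open>x\<^sub>1 + x\<^sub>2 i + x\<^sub>3 j + x\<^sub>4 ij\<close>, where \<open>i\<^sup>2 = a\<close>, \<open>j\<^sup>2 = b\<close>,
  \<open>ji = - ij\<close>. The quaternion algebra with structure constants \<open>a\<close>, \<open>b\<close> over a subfield \<open>F\<close>
  of the reals consists of the vectors with coordinates in \<open>F\<close>; in characteristic 0 every
  quaternion algebra has this form.
\<close>

definition quat_mult :: "real \<Rightarrow> real \<Rightarrow> real^4 \<Rightarrow> real^4 \<Rightarrow> real^4" where
  "quat_mult a b x y = vector
     [x$1 * y$1 + a * x$2 * y$2 + b * x$3 * y$3 - a * b * x$4 * y$4,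
      x$1 * y$2 + x$2 * y$1 - b * x$3 * y$4 + b * x$4 * y$3,
      x$1 * y$3 + x$3 * y$1 + a * x$2 * y$4 - a * x$4 * y$2,
      x$1 * y$4 + x$4 * y$1 + x$2 * y$3 - x$3 * y$2]"

definition quat_one :: "real^4" where
  "quat_one = vector [1, 0, 0, 0]"

definition quat_norm :: "real \<Rightarrow> real \<Rightarrow> real^4 \<Rightarrow> real" where
  "quat_norm a b x = (x$1)\<^sup>2 - a * (x$2)\<^sup>2 - b * (x$3)\<^sup>2 + a * b * (x$4)\<^sup>2"

definition quat_alg :: "real set \<Rightarrow> (real^4) set" where
  "quat_alg F = {x. \<forall>i. x$i \<in> F}"

lemma vector_4_nth:
  "(vector [p, q, r, s] :: ('a::zero)^4) $ 1 = p"
  "(vector [p, q, r, s] :: ('a::zero)^4) $ 2 = q"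
  "(vector [p, q, r, s] :: ('a::zero)^4) $ 3 = r"
  "(vector [p, q, r, s] :: ('a::zero)^4) $ 4 = s"
  unfolding vector_def by simp_all

lemma quat_mult_assoc:
  "quat_mult a b (quat_mult a b x y) z = quat_mult a b x (quat_mult a b y z)"
  by (simp add: vec_eq_iff forall_4 quat_mult_def vector_4_nth algebra_simps)

lemma quat_norm_mult: "quat_norm a b (quat_mult a b x y) = quat_norm a b x * quat_norm a b y"
  by (simp add: quat_norm_def quat_mult_def vector_4_nth power2_eq_square algebra_simps)

lemma quat_mult_one: "quat_mult a b quat_one x = x" "quat_mult a b x quat_one = x"
  by (simp_all add: vec_eq_iff forall_4 quat_mult_def quat_one_def vector_4_nth)

definition real_splitting :: "real \<Rightarrow> real \<Rightarrow> (real^4 \<Rightarrow> real^2^2) \<Rightarrow> bool" where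
  "real_splitting a b \<phi> \<longleftrightarrow>
     linear \<phi> \<and> bij \<phi> \<and> (\<forall>x y. \<phi> (quat_mult a b x y) = \<phi> x ** \<phi> y)"

definition iso_M2Q :: "real set \<Rightarrow> real \<Rightarrow> real \<Rightarrow> bool" where
  "iso_M2Q F a b \<longleftrightarrow>
     (\<exists>\<psi>::real^4 \<Rightarrow> rat^2^2. bij_betw \<psi> (quat_alg F) UNIV \<and>
        (\<forall>x\<in>quat_alg F. \<forall>y\<in>quat_alg F.
           \<psi> (x + y) = \<psi> x + \<psi> y \<and> \<psi> (quat_mult a b x y) = \<psi> x ** \<psi> y))"

definition quat_order :: "real set \<Rightarrow> real \<Rightarrow> real \<Rightarrow> (real^4) set \<Rightarrow> bool" where
  "quat_order F a b R \<longleftrightarrow>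
     quat_one \<in> R \<and> (\<forall>x\<in>R. \<forall>y\<in>R. x - y \<in> R \<and> quat_mult a b x y \<in> R) \<and>
     (\<exists>S. finite S \<and> R = lincombs (ring_of_integers F) S \<and> quat_alg F = lincombs F S)"

text \<open>
  A totally real field together with the infinite place at which the quaternion algebra
  splits is the same thing as a totally real subfield of the reals, the place being the
  inclusion.  The map \<open>\<phi>\<close> is the identification of the completion at that place with the
  algebra of real matrices of size two; it sends the reduced norm to the determinant.
\<close>

definition shimura_group :: "(real^2^2) set \<Rightarrow> bool" where
  "shimura_group \<Gamma> \<longleftrightarrow> subgroup \<Gamma> SL2R \<and>
     (\<exists>F a b R \<phi>. totally_real_field F \<and> a \<in> F - {0} \<and> b \<in> F - {0} \<and>
        (\<forall>\<sigma>::real \<Rightarrow> real. field_embedding F \<sigma> \<longrightarrow>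
           ((\<exists>\<phi>'. real_splitting (\<sigma> a) (\<sigma> b) \<phi>') \<longleftrightarrow> (\<forall>x\<in>F. \<sigma> x = x))) \<and>
        \<not> iso_M2Q F a b \<and>
        quat_order F a b R \<and>
        real_splitting a b \<phi> \<and>
        commensurable_SL2R \<Gamma> (\<phi> ` {x\<in>R. quat_norm a b x = 1}))"


section \<open>Genus, elliptic points, Hauptmoduln\<close>

text \<open>
  Topological genus: the map \<open>q\<close> identifies the orbit space of \<open>\<Gamma>\<close>, with the quotient
  topology, with the 2-sphere.
\<close>

definition genus_zero :: "(real^2^2) set \<Rightarrow> bool" where
  "genus_zero \<Gamma> \<longleftrightarrow>
     (\<exists>q. quotient_map (top_of_set upper_half_plane) (top_of_set (sphere (0::real^3) 1)) q \<and>
          (\<forall>z\<in>upper_half_plane. \<forall>w\<in>upper_half_plane. q z = q w \<longleftrightarrow> same_orbit \<Gamma> z w))"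

text \<open>The order is that of the image of the stabiliser in PSL(2,R).\<close>

definition elliptic_point :: "(real^2^2) set \<Rightarrow> complex \<Rightarrow> nat \<Rightarrow> bool" where
  "elliptic_point \<Gamma> z e \<longleftrightarrow> z \<in> upper_half_plane \<and> e \<ge> 2 \<and>
     card ((\<lambda>A. {A, - A}) ` {A\<in>\<Gamma>. mobius A z = z}) = e"

definition signature_0_3 ::
  "(real^2^2) set \<Rightarrow> complex \<Rightarrow> complex \<Rightarrow> complex \<Rightarrow> nat \<Rightarrow> nat \<Rightarrow> nat \<Rightarrow> bool" where
  "signature_0_3 \<Gamma> z1 z2 z3 e1 e2 e3 \<longleftrightarrow> genus_zero \<Gamma> \<and>
     elliptic_point \<Gamma> z1 e1 \<and> elliptic_point \<Gamma> z2 e2 \<and> elliptic_point \<Gamma> z3 e3 \<and>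
     \<not> same_orbit \<Gamma> z1 z2 \<and> \<not> same_orbit \<Gamma> z1 z3 \<and> \<not> same_orbit \<Gamma> z2 z3 \<and>
     (\<forall>z\<in>upper_half_plane. (\<exists>A\<in>\<Gamma>. A \<noteq> mat 1 \<and> A \<noteq> - mat 1 \<and> mobius A z = z) \<longrightarrow>
        same_orbit \<Gamma> z1 z \<or> same_orbit \<Gamma> z2 z \<or> same_orbit \<Gamma> z3 z)"

definition automorphic_function :: "(real^2^2) set \<Rightarrow> (complex \<Rightarrow> complex) \<Rightarrow> bool" where
  "automorphic_function \<Gamma> f \<longleftrightarrow> f nicely_meromorphic_on upper_half_plane \<and>
     (\<forall>A\<in>\<Gamma>. \<forall>z\<in>upper_half_plane. f (mobius A z) = f z)"

definition hauptmodul :: "(real^2^2) set \<Rightarrow> (complex \<Rightarrow> complex) \<Rightarrow> bool" where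
  "hauptmodul \<Gamma> t \<longleftrightarrow> automorphic_function \<Gamma> t \<and>
     (\<forall>f. automorphic_function \<Gamma> f \<longrightarrow>
        (\<exists>p q :: complex poly. q \<noteq> 0 \<and>
           (\<forall>\<^sub>\<approx>z\<in>upper_half_plane. f z = poly p (t z) / poly q (t z))))"


section \<open>Automorphic forms\<close>

text \<open>
  Forms are functions on the upper half plane; they are extended by zero so that equality of
  forms is equality of functions.
\<close>

definition automorphic_forms :: "(real^2^2) set \<Rightarrow> nat \<Rightarrow> (complex \<Rightarrow> complex) set" where
  "automorphic_forms \<Gamma> k = {f. f holomorphic_on upper_half_plane \<and>
     (\<forall>A\<in>\<Gamma>. \<forall>z\<in>upper_half_plane. f (mobius A z) = autom_factor A z ^ k * f z) \<and>
     (\<forall>z. z \<notin> upper_half_plane \<longrightarrow> f z = 0)}"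

definition cscale :: "complex \<Rightarrow> (complex \<Rightarrow> complex) \<Rightarrow> complex \<Rightarrow> complex" where
  "cscale c f = (\<lambda>z. c * f z)"

global_interpretation cfun: vector_space cscale
  by unfold_locales (auto simp: cscale_def fun_eq_iff algebra_simps)

definition basis_family ::
  "'i set \<Rightarrow> ('i \<Rightarrow> complex \<Rightarrow> complex) \<Rightarrow> (complex \<Rightarrow> complex) set \<Rightarrow> bool" where
  "basis_family J g V \<longleftrightarrow> inj_on g J \<and> cfun.independent (g ` J) \<and> cfun.span (g ` J) = V"


section \<open>Hypergeometric series and fractional powers\<close>

definition hyp2F1 :: "real \<Rightarrow> real \<Rightarrow> real \<Rightarrow> complex \<Rightarrow> complex" where
  "hyp2F1 a b c x =
     (\<Sum>n. of_real (pochhammer a n * pochhammer b n / (pochhammer c n * fact n)) * x ^ n)"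

text \<open>
  If \<open>s\<close> is the value of a branch of the \<open>e\<close>-th root of \<open>x\<close>, this is the corresponding value of
  \<open>x\<close> to the power \<open>r\<close>.  It is only meant for \<open>r \<ge> 0\<close> with \<open>e * r\<close> an integer, so that the floor
  does nothing: for instance \<open>r = frac (k * (1 - 1 / e) / 2)\<close> with \<open>k\<close> even.
\<close>

definition branch_power :: "nat \<Rightarrow> complex \<Rightarrow> real \<Rightarrow> complex" where
  "branch_power e s r = s ^ nat \<lfloor>real e * r\<rfloor>"

lemma branch_power_exponent_integral:
  assumes "e > 0" "even k"
  shows "real e * frac (real k * (1 - 1 / real e) / 2) \<in> \<int>"
proof -
  obtain m where k: "k = 2 * m" using assms(2) by blast
  have "real e * frac (real k * (1 - 1 / real e) / 2)
      = real e * real m - real m - real e * of_int \<lfloor>real k * (1 - 1 / real e) / 2\<rfloor>"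
    using assms(1) by (simp add: k frac_def field_simps)
  also have "\<dots> \<in> \<int>" by (intro Ints_diff Ints_mult) auto
  finally show ?thesis .
qed

end

theory Submission
  imports Defs "HOL-Computational_Algebra.Fundamental_Theorem_Algebra"
begin

text \<open>
  The Hauptmodul \<open>t\<close> generates the field of automorphic functions. That it is injective on the
  orbit space follows from the existence of one more function, a weight 4 Poincare series with a
  single simple pole, divided by \<open>t'\<^sup>2\<close>; compactness makes \<open>t\<close> surjective, and its ramification
  orders are then the orders of the stabilisers. Hence an automorphic function is a polynomial
  in \<open>t\<close> as soon as its orders at the three elliptic points are controlled.

  Put \<open>Y = t' t\<^bsup>-(1 - 1/e1)\<^esup> (1 - t)\<^bsup>-(1 - 1/e2)\<^esup>\<close> and \<open>L = Y' / (2 Y)\<close>. Since \<open>Y\<close> has weight 2,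
  \<open>L\<^sup>2 - L'\<close> has weight 4 and \<open>(L\<^sup>2 - L') t (1 - t) / t'\<^sup>2\<close> is automorphic; by its orders it is a constant,
  and the expansion at the third elliptic point gives the value \<open>- a b\<close>. This says that \<open>Y\<^bsup>1/2\<^esup>\<close> solves
  the hypergeometric equation in \<open>t\<close>. The forms of weight \<open>k = 2 m\<close> are the products of
  \<open>t'\<^bsup>m\<^esup> t\<^bsup>-p\<^esup> (1 - t)\<^bsup>-q\<^esup>\<close>, with \<open>p\<close> and \<open>q\<close> as large as holomorphy at the first two elliptic points
  permits, and the polynomials in \<open>t\<close> of the degree allowed at the third one; near the first point
  this factor is \<open>Y\<^bsup>m\<^esup>\<close> times fractional powers of \<open>t\<close> and \<open>1 - t\<close>.
\<close>

section \<open>The modular action\<close>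

text \<open>\<open>hauptmodul\<close> is an algebraic condition and \<open>genus_zero\<close> a
  topological one; neither says that \<open>t\<close> separates orbits or takes every value. Every
  automorphic function is rational in \<open>t\<close>, so one such function known to separate two
  orbits forces \<open>t\<close> to separate them; it has to be constructed analytically. Its
  convergence rests on the discreteness of \<Gamma>, which is read off from \<open>t\<close>: the
  orbit of \<tau>1 consists of zeros of \<open>t\<close>, and these are isolated. The expression L^2
  - L' is the quotient of (Y^(-1/2))'' by Y^(-1/2). By Bol's identity the second derivative of a
  form of weight -1 has weight 3, which is why the quotient has weight 4 although L is only
  quasi-modular. Fractional powers of \<open>t\<close> near \<tau>1 are avoided by the coordinate s
  with s^e1 = t: the exponents 0 and 1/e1 become 0 and 1, both local solutions become holomorphic,
  and C is the ratio of the first two Taylor coefficients of Y^(1/2) in s.\<close>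

lemma mat2_mult_nth:
  fixes A B :: "real^2^2"
  shows "(A ** B) $ i $ j = A$i$1 * B$1$j + A$i$2 * B$2$j"
  by (simp add: matrix_matrix_mult_def sum_2)

lemma mat2_eq_iff:
  fixes A B :: "real^2^2"
  shows "A = B \<longleftrightarrow> A$1$1 = B$1$1 \<and> A$1$2 = B$1$2 \<and> A$2$1 = B$2$1 \<and> A$2$2 = B$2$2"
  by (auto simp: vec_eq_iff forall_2)

lemma mat2_one_nth: "(mat 1 :: real^2^2)$1$1 = 1" "(mat 1 :: real^2^2)$1$2 = 0"
   "(mat 1 :: real^2^2)$2$1 = 0" "(mat 1 :: real^2^2)$2$2 = 1"
  by (simp_all add: mat_def)

abbreviation UHP ("\<H>") where "\<H> \<equiv> upper_half_plane"

lemma upper_half_planeD: "z \<in> \<H> \<Longrightarrow> Im z > 0"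
  by (simp add: upper_half_plane_def)

lemma open_upper_half_plane: "open \<H>"
  unfolding upper_half_plane_def by (simp add: open_halfspace_Im_gt)

lemma convex_upper_half_plane: "convex \<H>"
  unfolding upper_half_plane_def by (rule convex_halfspace_Im_gt)

lemma connected_upper_half_plane: "connected \<H>"
  by (rule convex_connected[OF convex_upper_half_plane])

lemma autom_factor_nonzero:
  assumes "det A = 1" "z \<in> \<H>"
  shows "autom_factor A z \<noteq> 0"
proof
  assume "autom_factor A z = 0"
  then have "Im (autom_factor A z) = 0" "Re (autom_factor A z) = 0" by simp_all
  then have "A$2$1 = 0" "A$2$2 = 0"
    using assms(2) by (auto simp: autom_factor_def upper_half_plane_def)
  then show False using assms(1) by (simp add: det_2)
qed

lemma Im_mobius:
  assumes "det A = 1"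
  shows "Im (mobius A z) = Im z / (norm (autom_factor A z))\<^sup>2"
proof -
  have "Im ((of_real (A$1$1) * z + of_real (A$1$2)) * cnj (autom_factor A z))
      = (A$1$1 * A$2$2 - A$1$2 * A$2$1) * Im z"
    by (simp add: autom_factor_def algebra_simps)
  also have "\<dots> = Im z" using assms by (simp add: det_2)
  finally show ?thesis
    unfolding mobius_def by (subst complex_div_cnj) simp
qed

lemma mobius_in_upper_half_plane:
  assumes "det A = 1" "z \<in> \<H>"
  shows "mobius A z \<in> \<H>"
  using assms autom_factor_nonzero[OF assms] by (simp add: upper_half_plane_def Im_mobius)

lemma autom_factor_mult:
  assumes "det B = 1" "z \<in> \<H>"
  shows "autom_factor (A ** B) z = autom_factor A (mobius B z) * autom_factor B z"
  using autom_factor_nonzero[OF assms]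
  unfolding mobius_def by (simp add: autom_factor_def mat2_mult_nth field_simps)

lemma mobius_mult:
  assumes "det A = 1" "det B = 1" "z \<in> \<H>"
  shows "mobius (A ** B) z = mobius A (mobius B z)"
proof -
  have nz: "autom_factor B z \<noteq> 0" "autom_factor A (mobius B z) \<noteq> 0"
    using assms mobius_in_upper_half_plane autom_factor_nonzero by blast+
  have *: "mobius B z * autom_factor B z = of_real (B$1$1) * z + of_real (B$1$2)"
    using nz(1) by (simp add: mobius_def)
  have "of_real ((A ** B)$1$1) * z + of_real ((A ** B)$1$2)
      = of_real (A$1$1) * (of_real (B$1$1) * z + of_real (B$1$2)) + of_real (A$1$2) * autom_factor B z"
    by (simp add: mat2_mult_nth autom_factor_def algebra_simps)
  also have "\<dots> = (of_real (A$1$1) * mobius B z + of_real (A$1$2)) * autom_factor B z"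
    unfolding *[symmetric] by (simp add: algebra_simps)
  finally show ?thesis
    unfolding mobius_def[of "A ** B"] autom_factor_mult[OF assms(2,3)]
    using nz by (simp add: mobius_def[of A])
qed

lemma mobius_one: "mobius (mat 1) z = z"
  by (simp add: mobius_def autom_factor_def mat2_one_nth)

lemma mobius_uminus: "mobius (- A) z = mobius A z"
proof -
  have "autom_factor (- A) z = - autom_factor A z" by (simp add: autom_factor_def)
  moreover have "of_real ((- A)$1$1) * z + of_real ((- A)$1$2) = - (of_real (A$1$1) * z + of_real (A$1$2))"
    by simp
  ultimately show ?thesis unfolding mobius_def by (simp only: minus_divide_divide)
qed

lemma has_field_derivative_mobius:
  assumes "det A = 1" "z \<in> \<H>"
  shows "(mobius A has_field_derivative 1 / (autom_factor A z)\<^sup>2) (at z)"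
proof -
  have nz: "of_real (A$2$1) * z + of_real (A$2$2) \<noteq> (0::complex)"
    using autom_factor_nonzero[OF assms] by (simp add: autom_factor_def)
  have d: "of_real (A$1$1) * of_real (A$2$2) - of_real (A$1$2) * of_real (A$2$1) = (1::complex)"
  proof -
    have "complex_of_real (A$1$1 * A$2$2 - A$1$2 * A$2$1) = 1" using assms(1) by (simp add: det_2)
    then show ?thesis by simp
  qed
  let ?f = "\<lambda>p q z. of_real p * z + of_real q :: complex"
  have "(?f p q has_field_derivative of_real p) (at z)" for p q
    by (auto intro!: derivative_eq_intros)
  from DERIV_divide[OF this this nz]
  have "((\<lambda>z. ?f (A$1$1) (A$1$2) z / ?f (A$2$1) (A$2$2) z) has_field_derivative
      (of_real (A$1$1) * ?f (A$2$1) (A$2$2) z - ?f (A$1$1) (A$1$2) z * of_real (A$2$1))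
        / (?f (A$2$1) (A$2$2) z * ?f (A$2$1) (A$2$2) z)) (at z)" .
  moreover have "of_real (A$1$1) * ?f (A$2$1) (A$2$2) z - ?f (A$1$1) (A$1$2) z * of_real (A$2$1)
      = of_real (A$1$1) * of_real (A$2$2) - of_real (A$1$2) * of_real (A$2$1)"
    by (simp add: algebra_simps)
  ultimately show ?thesis
    unfolding d mobius_def[abs_def] autom_factor_def[abs_def] by (simp add: power2_eq_square d)
qed

lemma mobius_holomorphic: "det A = 1 \<Longrightarrow> mobius A holomorphic_on \<H>"
  by (meson field_differentiable_at_within field_differentiable_def has_field_derivative_mobius
      holomorphic_on_def)

lemma has_field_derivative_autom_factor:
  "(autom_factor A has_field_derivative of_real (A$2$1)) (at z)"
  unfolding autom_factor_def[abs_def] by (auto intro!: derivative_eq_intros)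

text \<open>A fixed point is a root of the real quadratic c z^2 + (d - a) z - b. Its nonreal roots
  are conjugate, so two distinct roots in the upper half plane make all coefficients vanish.\<close>

lemma mobius_fixes_two_points:
  assumes "det A = 1" "z \<in> \<H>" "w \<in> \<H>" "z \<noteq> w"
    and "mobius A z = z" "mobius A w = w"
  shows "A = mat 1 \<or> A = - mat 1"
proof -
  define a b c d where "a = A$1$1" "b = A$1$2" "c = A$2$1" "d = A$2$2"
  note abcd = this
  have fix_eq: "of_real c * z^2 + of_real (d - a) * z - of_real b = (0::complex)"
    if "mobius A z = z" "z \<in> \<H>" for z
    using that autom_factor_nonzero[OF assms(1) that(2)]
    unfolding mobius_def autom_factor_def abcd by (simp add: field_simps power2_eq_square)
  have z: "of_real c * z^2 + of_real (d - a) * z - of_real b = (0::complex)"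
   and w: "of_real c * w^2 + of_real (d - a) * w - of_real b = (0::complex)"
    using fix_eq assms by blast+
  have "(z - w) * (of_real c * (z + w) + of_real (d - a)) = 0"
    using z w by (simp add: algebra_simps power2_eq_square)
  then have s: "of_real c * (z + w) + of_real (d - a) = (0::complex)" using assms(4) by simp
  then have "Im (of_real c * (z + w) + of_real (d - a)) = 0" by simp
  then have "c * (Im z + Im w) = 0" by (simp add: algebra_simps)
  then have c: "c = 0" using assms(2,3) by (auto simp: upper_half_plane_def)
  then have da: "d = a" using s by simp
  then have b: "b = 0" using z c by simp
  have "a * a = 1" using assms(1) b c da unfolding det_2 abcd by simp
  then have "a = 1 \<or> a = -1" by algebra
  then show ?thesis using b c da unfolding mat2_eq_iff abcd by (auto simp: mat2_one_nth)
qed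

lemma group_SL2R: "group SL2R"
proof (rule groupI)
  fix x y z assume "x \<in> carrier SL2R" "y \<in> carrier SL2R" "z \<in> carrier SL2R"
  then show "x \<otimes>\<^bsub>SL2R\<^esub> y \<in> carrier SL2R"
    "x \<otimes>\<^bsub>SL2R\<^esub> y \<otimes>\<^bsub>SL2R\<^esub> z = x \<otimes>\<^bsub>SL2R\<^esub> (y \<otimes>\<^bsub>SL2R\<^esub> z)"
    by (simp_all add: SL2R_def det_mul matrix_mul_assoc)
next
  fix x assume x: "x \<in> carrier SL2R"
  then have "invertible x" by (simp add: SL2R_def invertible_det_nz)
  then obtain y where y: "x ** y = mat 1" "y ** x = mat 1" unfolding invertible_def by blast
  have "det (y ** x) = 1" using y by simp
  then have "det y = 1" using x by (simp add: det_mul SL2R_def)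
  then show "\<exists>y\<in>carrier SL2R. y \<otimes>\<^bsub>SL2R\<^esub> x = \<one>\<^bsub>SL2R\<^esub>"
    using y by (auto simp: SL2R_def)
qed (simp_all add: SL2R_def)

section \<open>Subgroups of SL(2,R) acting on the upper half plane\<close>

locale SL2R_subgroup =
  fixes \<Gamma> :: "(real^2^2) set"
  assumes subgroup: "subgroup \<Gamma> SL2R"
begin

lemma det_eq_1: "A \<in> \<Gamma> \<Longrightarrow> det A = 1"
  using subgroup.subset[OF subgroup] by (auto simp: SL2R_def)

lemma mult_closed: "A \<in> \<Gamma> \<Longrightarrow> B \<in> \<Gamma> \<Longrightarrow> A ** B \<in> \<Gamma>"
  using subgroup.m_closed[OF subgroup] by (simp add: SL2R_def)

lemma one_closed: "mat 1 \<in> \<Gamma>"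
  using subgroup.one_closed[OF subgroup] by (simp add: SL2R_def)

lemma inverse_exists:
  assumes "A \<in> \<Gamma>"
  obtains B where "B \<in> \<Gamma>" "A ** B = mat 1" "B ** A = mat 1"
proof -
  have A: "A \<in> carrier SL2R" using subgroup.subset[OF subgroup] assms by blast
  show thesis
    by (rule that[of "inv\<^bsub>SL2R\<^esub> A"])
      (use subgroup.m_inv_closed[OF subgroup assms] group.r_inv[OF group_SL2R A]
        group.l_inv[OF group_SL2R A] in \<open>simp_all add: SL2R_def\<close>)
qed

lemma mobius_closed: "A \<in> \<Gamma> \<Longrightarrow> z \<in> \<H> \<Longrightarrow> mobius A z \<in> \<H>"
  by (simp add: det_eq_1 mobius_in_upper_half_plane)

lemma mobius_comp:
  "A \<in> \<Gamma> \<Longrightarrow> B \<in> \<Gamma> \<Longrightarrow> z \<in> \<H> \<Longrightarrow> mobius (A ** B) z = mobius A (mobius B z)"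
  by (simp add: det_eq_1 mobius_mult)

lemma autom_factor_comp:
  "A \<in> \<Gamma> \<Longrightarrow> B \<in> \<Gamma> \<Longrightarrow> z \<in> \<H> \<Longrightarrow>
    autom_factor (A ** B) z = autom_factor A (mobius B z) * autom_factor B z"
  by (simp add: det_eq_1 autom_factor_mult)

lemma autom_factor_neq_0: "A \<in> \<Gamma> \<Longrightarrow> z \<in> \<H> \<Longrightarrow> autom_factor A z \<noteq> 0"
  by (simp add: det_eq_1 autom_factor_nonzero)

lemma mobius_inverse_eq:
  "A \<in> \<Gamma> \<Longrightarrow> B \<in> \<Gamma> \<Longrightarrow> A ** B = mat 1 \<Longrightarrow> z \<in> \<H> \<Longrightarrow>
    mobius A (mobius B z) = z"
  by (metis mobius_comp mobius_one)

lemma same_orbit_sym: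
  "z \<in> \<H> \<Longrightarrow> same_orbit \<Gamma> z w \<Longrightarrow> same_orbit \<Gamma> w z"
  unfolding same_orbit_def by (metis inverse_exists mobius_inverse_eq)

lemma isCont_mobius: "A \<in> \<Gamma> \<Longrightarrow> z \<in> \<H> \<Longrightarrow> isCont (mobius A) z"
  using has_field_derivative_mobius[OF det_eq_1] DERIV_isCont by blast

lemma analytic_mobius: "A \<in> \<Gamma> \<Longrightarrow> mobius A analytic_on \<H>"
  by (simp add: analytic_on_open det_eq_1 mobius_holomorphic open_upper_half_plane)

text \<open>Carries limits, poles and removable singularities from z to the other points of its
  orbit. One inequality of filters is continuity together with injectivity; the other is the same
  statement for the inverse matrix.\<close>

lemma filtermap_mobius:
  assumes "A \<in> \<Gamma>" "z \<in> \<H>"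
  shows "filtermap (mobius A) (at z) = at (mobius A z)"
proof -
  obtain B where B: "B \<in> \<Gamma>" "A ** B = mat 1" "B ** A = mat 1" by (rule inverse_exists[OF assms(1)])
  have lim: "filterlim (mobius C) (at (mobius C w)) (at w)"
    if C: "C \<in> \<Gamma>" and w: "w \<in> \<H>" for C w
  proof -
    obtain D where D: "D \<in> \<Gamma>" "C ** D = mat 1" "D ** C = mat 1" by (rule inverse_exists[OF C])
    have "\<forall>\<^sub>F x in at w. x \<in> \<H> - {w}"
      using open_upper_half_plane w by (rule eventually_at_in_open)
    then have "\<forall>\<^sub>F x in at w. mobius C x \<noteq> mobius C w"
      by eventually_elim (metis C D(1,3) Diff_iff insertCI mobius_inverse_eq w)
    with isCont_mobius[OF C w] show ?thesis
      by (auto simp: filterlim_at isCont_def)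
  qed
  have w: "mobius A z \<in> \<H>" using assms by (rule mobius_closed)
  have eq: "mobius B (mobius A z) = z" using B assms mobius_inverse_eq by blast
  have "filtermap (mobius A) (at z) \<le> at (mobius A z)"
    using lim[OF assms] by (simp add: filterlim_def)
  moreover have "at (mobius A z) \<le> filtermap (mobius A) (at z)"
  proof -
    have "at (mobius A z) = filtermap (\<lambda>x. mobius A (mobius B x)) (at (mobius A z))"
    proof -
      have "\<forall>\<^sub>F x in at (mobius A z). mobius A (mobius B x) = x"
        using eventually_at_in_open'[OF open_upper_half_plane w]
        by eventually_elim (use B assms mobius_inverse_eq in blast)
      then have "\<forall>\<^sub>F x in at (mobius A z). P (mobius A (mobius B x)) = P x" for P
        by eventually_elim simp
      then have "eventually (\<lambda>x. P (mobius A (mobius B x))) (at (mobius A z))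
          \<longleftrightarrow> eventually P (at (mobius A z))" for P
        by (rule eventually_subst)
      then show ?thesis by (simp add: filter_eq_iff eventually_filtermap)
    qed
    also have "\<dots> = filtermap (mobius A) (filtermap (mobius B) (at (mobius A z)))"
      by (simp add: filtermap_filtermap)
    also have "\<dots> \<le> filtermap (mobius A) (at z)"
      using lim[OF B(1) w] by (intro filtermap_mono) (simp add: filterlim_def eq)
    finally show ?thesis .
  qed
  ultimately show ?thesis by (rule antisym)
qed

end

section \<open>Auxiliary complex analysis\<close>

text \<open>The open mapping theorem on punctured neighbourhoods: values near f z are already taken
  at points satisfying P. This is what allows exceptional points to be avoided when two values are
  compared.\<close>

lemma eventually_at_image_analytic:
  fixes f :: "complex \<Rightarrow> complex"
  assumes "f analytic_on {z}" "\<not> (\<forall>\<^sub>F w in at z. f w = f z)" "eventually P (at z)"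
  shows "\<forall>\<^sub>F x in at (f z). \<exists>w. P w \<and> f w = x"
proof -
  obtain r1 where r1: "r1 > 0" "f holomorphic_on ball z r1"
    using assms(1) analytic_on_def by blast
  obtain r2 where r2: "r2 > 0" "\<And>x. x \<noteq> z \<Longrightarrow> dist x z < r2 \<Longrightarrow> P x"
    using assms(3) unfolding eventually_at by auto
  define r where "r = min r1 r2"
  have r: "r > 0" "f holomorphic_on ball z r" "\<And>x. x \<in> ball z r \<Longrightarrow> x \<noteq> z \<Longrightarrow> P x"
    using r1 r2 by (auto simp: r_def dist_commute intro: holomorphic_on_subset)
  have "\<not> f constant_on ball z r"
  proof
    assume "f constant_on ball z r"
    then obtain c where "\<And>w. w \<in> ball z r \<Longrightarrow> f w = c" unfolding constant_on_def by blast
    then have fw: "f w = f z" if "w \<in> ball z r" for w using r(1) that by simp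
    have "\<forall>\<^sub>F w in at z. w \<in> ball z r"
      by (rule eventually_at_in_open') (use r(1) in auto)
    then have "\<forall>\<^sub>F w in at z. f w = f z" by eventually_elim (rule fw)
    then show False using assms(2) by blast
  qed
  then have "open (f ` ball z r)"
    using open_mapping_thm[OF r(2) open_ball connected_ball open_ball order_refl] by blast
  then have "\<forall>\<^sub>F x in at (f z). x \<in> f ` ball z r - {f z}"
    by (rule eventually_at_in_open) (use r(1) in auto)
  then show ?thesis by eventually_elim (use r(3) in blast)
qed

lemma not_pole_if_tendsto: "(f \<longlongrightarrow> c) (at z) \<Longrightarrow> \<not> is_pole f z"
  for f :: "complex \<Rightarrow> complex"
  unfolding is_pole_def using not_tendsto_and_filterlim_at_infinity[OF at_neq_bot] by blast

text \<open>The function (x - v) f x extends analytically to v with value 0, and f is the difference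
  quotient of the extension, which converges to its derivative.\<close>

lemma no_pole_if_tendsto_mult:
  fixes f :: "complex \<Rightarrow> complex"
  assumes "isolated_singularity_at f v" "((\<lambda>x. (x - v) * f x) \<longlongrightarrow> 0) (at v)"
  shows "\<not> is_pole f v"
proof -
  define g where "g = (\<lambda>x. (x - v) * f x)"
  have iso: "isolated_singularity_at g v"
    unfolding g_def using assms(1)
    by (intro isolated_singularity_at_times singularity_intros)
       (auto intro: analytic_intros isolated_singularity_at_analytic)
  have lim: "g \<midarrow>v\<rightarrow> 0" using assms(2) by (simp add: g_def)
  have ana: "remove_sings g analytic_on {v}" using iso lim by (rule remove_sings_analytic_at)
  have g0: "remove_sings g v = 0" using lim by (rule remove_sings_eqI)
  obtain D where "(remove_sings g has_field_derivative D) (at v)"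
    using ana by (meson analytic_on_imp_differentiable_at field_differentiable_def singletonI)
  then have "((\<lambda>x. (remove_sings g x - remove_sings g v) / (x - v)) \<longlongrightarrow> D) (at v)"
    by (simp add: has_field_derivative_iff)
  moreover have "\<forall>\<^sub>F x in at v. (remove_sings g x - remove_sings g v) / (x - v) = f x"
    using eventually_remove_sings_eq_at[OF iso] eventually_neq_at_within[of v]
    by eventually_elim (simp add: g0, simp add: g_def)
  ultimately have "(f \<longlongrightarrow> D) (at v)" by (rule Lim_transform_eventually)
  then show ?thesis by (rule not_pole_if_tendsto)
qed

section \<open>Rational functions, local roots and an area estimate\<close>

lemma analytic_on_poly: "poly p analytic_on A"
proof -
  have "poly p holomorphic_on UNIV" by (intro holomorphic_intros)
  then show ?thesis unfolding analytic_on_holomorphic by blast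
qed

lemma meromorphic_poly_fraction:
  "(\<lambda>x. poly p x / poly q x) meromorphic_on A"
  by (intro meromorphic_intros analytic_on_imp_meromorphic_on analytic_on_poly)

text \<open>A root of q that is not a root of p would be a pole. Hence a common linear factor can be
  cancelled, which lowers the degree of q.\<close>

lemma poly_fraction_without_poles:
  fixes p q :: "complex poly"
  assumes "q \<noteq> 0" "\<And>v. \<not> is_pole (\<lambda>x. poly p x / poly q x) v"
  shows "q dvd p"
  using assms
proof (induction "degree q" arbitrary: p q rule: less_induct)
  case less
  show ?case
  proof (cases "degree q = 0")
    case True
    then show ?thesis using less.prems(1) by (simp add: is_unit_iff_degree unit_imp_dvd)
  next
    case False
    then have "\<not> constant (poly q)" by (simp only: constant_degree not_False_eq_True)
    from Fundamental_Theorem_Algebra.fundamental_theorem_of_algebra[OF this] obtain v where v: "poly q v = 0" by (rule exE)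
    then obtain q' where q: "q = [:-v, 1:] * q'" using poly_eq_0_iff_dvd by (metis dvdE)
    have "q' \<noteq> 0" using q less.prems(1) by auto
    have "poly p v = 0"
    proof (rule ccontr)
      assume nz: "poly p v \<noteq> 0"
      have "(poly p \<longlongrightarrow> poly p v) (at v)" "(poly q \<longlongrightarrow> 0) (at v)"
        using poly_isCont[of v p] poly_isCont[of v q] v by (simp_all add: isCont_def)
      moreover have "\<forall>\<^sub>F x in at v. poly q x \<noteq> 0"
      proof -
        have "finite {x. poly q x = 0}" using less.prems(1) by (rule poly_roots_finite)
        then have "\<not> v islimpt {x. poly q x = 0}" by (rule islimpt_finite)
        then show ?thesis by (simp add: islimpt_iff_eventually)
      qed
      ultimately have "is_pole (\<lambda>x. poly p x / poly q x) v"
        unfolding is_pole_def using nz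
        by (intro filterlim_divide_at_infinity) (auto simp: filterlim_at)
      then show False using less.prems(2) by blast
    qed
    then obtain p' where p: "p = [:-v, 1:] * p'" using poly_eq_0_iff_dvd by (metis dvdE)
    have "\<not> is_pole (\<lambda>x. poly p' x / poly q' x) w" for w
    proof -
      have "\<not> w islimpt {v}" by (simp add: islimpt_finite)
      then have "\<forall>\<^sub>F x in at w. x \<noteq> v" by (simp add: islimpt_iff_eventually)
      then have "\<forall>\<^sub>F x in at w. poly p x / poly q x = poly p' x / poly q' x"
        by eventually_elim (simp only: p q poly_mult, simp)
      then have "is_pole (\<lambda>x. poly p x / poly q x) w \<longleftrightarrow> is_pole (\<lambda>x. poly p' x / poly q' x) w"
        by (intro is_pole_cong) auto
      then show ?thesis using less.prems(2) by blast
    qed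
    moreover have "degree q' < degree q" unfolding q using \<open>q' \<noteq> 0\<close> by (subst degree_mult_eq) auto
    ultimately have "q' dvd p'" using less.hyps \<open>q' \<noteq> 0\<close> by blast
    then show ?thesis unfolding p q by (intro mult_dvd_mono) auto
  qed
qed

text \<open>If the degree were at least m, division by x^degree would be no larger than division by
  x^m for |x| \<ge> 1, and the leading coefficient would be a limit equal to 0. The exponent is an
  integer because the bound may be 0 or negative, in which case p must vanish.\<close>

lemma degree_bound_at_infinity:
  fixes p :: "complex poly"
  assumes "((\<lambda>x. poly p x * x powi (- m)) \<longlongrightarrow> 0) at_infinity"
  shows "p = 0 \<or> int (degree p) < m"
proof (rule ccontr)
  assume "\<not> ?thesis"
  then have p: "p \<noteq> 0" "m \<le> int (degree p)" by auto
  define n where "n = nat (int (degree p) - m)"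
  have n: "int (degree p) = m + int n" using p by (simp add: n_def)
  have "((\<lambda>x. poly p x / x ^ degree p) \<longlongrightarrow> 0) at_infinity"
  proof (rule tendsto_0_le[OF assms, where K = 1])
    show "\<forall>\<^sub>F x in at_infinity. norm (poly p x / x ^ degree p) \<le> norm (poly p x * x powi (- m)) * 1"
      unfolding eventually_at_infinity
    proof (intro exI allI impI)
      fix x :: complex assume x: "1 \<le> norm x"
      have "x powi (- m) = x ^ n / x ^ degree p"
      proof -
        have "x powi (- m) = x powi (int n) * x powi (- int (degree p))"
          using x by (subst power_int_add[symmetric]) (auto simp: n)
        then show ?thesis by (simp add: power_int_minus divide_inverse)
      qed
      moreover have "1 * norm (poly p x / x ^ degree p) \<le> norm (x ^ n) * norm (poly p x / x ^ degree p)"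
        using x by (intro mult_right_mono) (auto simp: norm_power)
      ultimately show "norm (poly p x / x ^ degree p) \<le> norm (poly p x * x powi (- m)) * 1"
        by (simp add: norm_mult norm_divide mult_ac)
    qed
  qed
  with poly_divide_tendsto_aux[of p] have "lead_coeff p = 0"
    using tendsto_unique trivial_limit_at_infinity by blast
  with p show False by simp
qed

text \<open>Write f w = (w - z)^n g w with g zero-free near z. A logarithm h of g gives the root s w
  = (w - z) exp (h w / n), a local coordinate in which f is a pure power.\<close>

lemma analytic_local_root:
  fixes f :: "complex \<Rightarrow> complex"
  assumes "f analytic_on {z}" "f z = 0" "\<not> (\<forall>\<^sub>F w in at z. f w = 0)" "open S" "z \<in> S"
  obtains n s r where "n > 0" "r > 0" "ball z r \<subseteq> S" "s holomorphic_on ball z r"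
    "inj_on s (ball z r)" "s z = 0" "deriv s z \<noteq> 0" "\<And>w. w \<in> ball z r \<Longrightarrow> f w = s w ^ n"
proof -
  obtain r0 where r0: "r0 > 0" "f holomorphic_on ball z r0"
    using assms(1) analytic_on_def by blast
  obtain r0' where r0': "r0' > 0" "ball z r0' \<subseteq> S" using assms(4,5) openE by blast
  define B where "B = ball z (min r0 r0')"
  have B: "f holomorphic_on B" "open B" "connected B" "z \<in> B" "B \<subseteq> S"
    using r0 r0' by (auto simp: B_def intro: holomorphic_on_subset)
  have "\<exists>w\<in>B. f w \<noteq> 0"
  proof (rule ccontr)
    assume "\<not> ?thesis"
    then have "\<forall>\<^sub>F w in at z. f w = 0"
      using eventually_at_in_open'[OF B(2,4)] by (auto elim!: eventually_mono)
    with assms(3) show False by blast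
  qed
  note ex = zorder_exist_zero[OF B(1-4) this]
  define n where "n = nat (zorder f z)"
  define g where "g = zor_poly f z"
  have n: "n > 0" using ex assms(2) by (simp add: n_def)
  obtain r1 where r1: "r1 > 0" "cball z r1 \<subseteq> B" "g holomorphic_on cball z r1"
    "\<And>w. w \<in> cball z r1 \<Longrightarrow> f w = g w * (w - z) ^ n \<and> g w \<noteq> 0"
    using ex unfolding n_def g_def by blast
  have "\<exists>h. h holomorphic_on ball z r1 \<and> (\<forall>x\<in>ball z r1. exp (h x) = g x)"
  proof -
    have "g holomorphic_on ball z r1" using r1(3) by (rule holomorphic_on_subset) auto
    then show ?thesis
      using holomorphic_logarithm_exists[of "ball z r1" g z] r1 by (metis ball_subset_cball
          centre_in_ball convex_ball open_ball subset_iff)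
  qed
  then obtain h where h: "h holomorphic_on ball z r1" "\<And>x. x \<in> ball z r1 \<Longrightarrow> exp (h x) = g x" by blast
  define s where "s = (\<lambda>x. (x - z) * exp (h x / of_nat n))"
  have s: "s holomorphic_on ball z r1"
    unfolding s_def by (intro holomorphic_intros h(1)) (use n in auto)
  have "((\<lambda>x. (x - z) * exp (h x / of_nat n)) has_field_derivative exp (h z / of_nat n)) (at z)"
  proof -
    have "(\<lambda>x. exp (h x / of_nat n)) holomorphic_on ball z r1"
      by (intro holomorphic_intros h(1)) (use n in auto)
    then obtain D where D: "((\<lambda>x. exp (h x / of_nat n)) has_field_derivative D) (at z)"
      using r1(1) by (meson centre_in_ball holomorphic_derivI open_ball)
    show ?thesis by (rule derivative_eq_intros D refl | simp)+
  qed
  then have ds: "deriv s z \<noteq> 0" unfolding s_def by (simp add: DERIV_imp_deriv)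
  obtain r where r: "r > 0" "ball z r \<subseteq> ball z r1" "inj_on s (ball z r)"
    using has_complex_derivative_locally_injective[OF s _ open_ball ds] r1(1)
    by (metis centre_in_ball)
  show thesis
  proof (rule that[of n r s])
    show "ball z r \<subseteq> S" using r r1 B ball_subset_cball[of z r1] by blast
    show "s holomorphic_on ball z r" using s r(2) by (rule holomorphic_on_subset)
    show "f w = s w ^ n" if "w \<in> ball z r" for w
    proof -
      have w: "w \<in> ball z r1" "w \<in> cball z r1" using that r(2) by auto
      have "exp (h w / of_nat n) ^ n = exp (h w)"
        using n by (simp flip: exp_of_nat_mult)
      then show ?thesis using r1(4)[OF w(2)] h(2)[OF w(1)] by (simp add: s_def power_mult_distrib)
    qed
  qed (use r n ds in \<open>auto simp: s_def\<close>)
qed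

text \<open>Comparison of areas. Applied to images of one disc under the group, it yields the
  convergence of the Poincare series.\<close>

lemma sum_squares_disjoint_balls:
  fixes m :: "'a \<Rightarrow> complex"
  assumes "finite F" "\<And>i. i \<in> F \<Longrightarrow> \<rho> i \<ge> 0" "\<And>i. i \<in> F \<Longrightarrow> ball (m i) (\<rho> i) \<subseteq> ball 0 1"
    and "\<And>i j. i \<in> F \<Longrightarrow> j \<in> F \<Longrightarrow> i \<noteq> j \<Longrightarrow> ball (m i) (\<rho> i) \<inter> ball (m j) (\<rho> j) = {}"
  shows "(\<Sum>i\<in>F. (\<rho> i)\<^sup>2) \<le> 1"
proof -
  have "(\<Sum>i\<in>F. measure lborel (ball (m i) (\<rho> i))) = measure lborel (\<Union>i\<in>F. ball (m i) (\<rho> i))"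
    using assms(1,4) by (intro measure_finite_Union[symmetric])
      (auto simp: disjoint_family_on_def emeasure_lborel_ball_finite[unfolded infinity_ennreal_def] less_top)
  also have "\<dots> \<le> measure lborel (ball (0::complex) 1)"
    using assms(1,3) by (intro measure_mono_fmeasurable)
      (auto simp: fmeasurable_def emeasure_lborel_ball_finite[unfolded infinity_ennreal_def])
  finally have "(\<Sum>i\<in>F. unit_ball_vol 2 * (\<rho> i)\<^sup>2) \<le> unit_ball_vol 2 * 1"
    using assms(2) by (simp add: content_ball DIM_complex)
  then show ?thesis by (simp add: sum_distrib_left[symmetric] unit_ball_vol_2)
qed

lemma isCont_if_holomorphic: "f holomorphic_on S \<Longrightarrow> open S \<Longrightarrow> z \<in> S \<Longrightarrow> isCont f z"
  for f :: "complex \<Rightarrow> complex"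
  by (meson continuous_on_eq_continuous_at holomorphic_on_imp_continuous_on)

lemma tendsto_if_holomorphic: "f holomorphic_on ball z r \<Longrightarrow> r > 0 \<Longrightarrow> (f \<longlongrightarrow> f z) (at z)"
  for f :: "complex \<Rightarrow> complex"
  by (rule isContD, rule isCont_if_holomorphic[OF _ open_ball]) auto

lemma eventually_punctured_ball:
  "r > 0 \<Longrightarrow> (\<And>x. x \<in> ball z r - {z} \<Longrightarrow> P x) \<Longrightarrow> eventually P (at z)"
  for z :: complex
  using eventually_at_in_open[OF open_ball, of z z r] by (auto elim: eventually_mono)

section \<open>Hypergeometric power series\<close>

lemma hypergeometric_coeff_step:
  fixes a b c :: real
  assumes "c > 0"
  shows "pochhammer a (Suc j) * pochhammer b (Suc j) / (pochhammer c (Suc j) * fact (Suc j)) *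
     ((c + real j) * real (Suc j)) =
     (a + real j) * (b + real j) * (pochhammer a j * pochhammer b j / (pochhammer c j * fact j))"
proof -
  have "pochhammer c j \<noteq> 0" "c + real j \<noteq> 0"
    using pochhammer_pos[OF assms, of j] assms by linarith+
  then show ?thesis unfolding pochhammer_Suc fact_Suc
    by (simp add: divide_simps)
qed

lemma infsum_cmult_hyp2F1:
  fixes y C :: complex
  assumes "(\<lambda>j. C * (of_real (pochhammer a j * pochhammer b j / (pochhammer c j * fact j)) * y ^ j))
     summable_on UNIV"
  shows "(\<Sum>\<^sub>\<infinity>j. C * (of_real (pochhammer a j * pochhammer b j / (pochhammer c j * fact j)) * y ^ j))
     = C * hyp2F1 a b c y"
\<comment> \<open>For C = 0 the hypothesis gives no convergence of the hypergeometric series, but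
  both sides vanish.\<close>
proof (cases "C = 0")
  case False
  then have "(\<lambda>j. of_real (pochhammer a j * pochhammer b j / (pochhammer c j * fact j)) * y ^ j)
      summable_on UNIV"
    using assms by (simp only: summable_on_cmult_right'[OF False])
  from sums_unique[OF has_sum_imp_sums[OF has_sum_infsum[OF this]]] show ?thesis
    unfolding hyp2F1_def by (simp only: infsum_cmult_right')
qed simp

text \<open>
  In the coordinate \<open>x\<close> with \<open>t = x\<^sup>e\<close> the hypergeometric equation has the exponents 0 and 1 at
  the origin, and its recurrence links the coefficients of \<open>x\<^sup>n\<close> and \<open>x\<^bsup>n + e\<^esup>\<close>.
\<close>

lemma hypergeometric_ode_solution:
  fixes a b R :: real and e :: nat and \<psi> :: "complex \<Rightarrow> complex"
  assumes e: "e \<ge> 2" and hol: "\<psi> holomorphic_on ball 0 R" and x: "x \<in> ball 0 R"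
    and ode: "\<And>x. x \<in> ball 0 R \<Longrightarrow> x\<^sup>2 * deriv (deriv \<psi>) x =
      x ^ e * (x\<^sup>2 * deriv (deriv \<psi>) x + of_real (1 + (a + b) * real e) * (x * deriv \<psi> x)
         + of_real (a * b * (real e)\<^sup>2) * \<psi> x)"
  shows "\<psi> x = \<psi> 0 * hyp2F1 a b (1 - 1 / real e) (x ^ e)
      + deriv \<psi> 0 * x * hyp2F1 (a + 1 / real e) (b + 1 / real e) (1 + 1 / real e) (x ^ e)"
proof -
  have R: "R > 0" using x by (metis ball_empty empty_iff not_le)
  define \<Psi> where "\<Psi> = fps_expansion \<psi> 0"
  define c where "c = fps_nth \<Psi>"
  have \<Psi>: "\<psi> has_fps_expansion \<Psi>"
    unfolding \<Psi>_def using R hol by (intro has_fps_expansion_fps_expansion[of "ball 0 R"]) auto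
  have X2: "fps_nth (fps_X ^ 2 * fps_deriv (fps_deriv \<Psi>)) n = of_nat n * (of_nat n - 1) * c n" for n
    unfolding fps_X_power_mult_nth by (cases n; cases "n - 1") (auto simp: c_def algebra_simps)
  have X1: "fps_nth (fps_X * fps_deriv \<Psi>) n = of_nat n * c n" for n
    by (cases n) (auto simp: c_def algebra_simps)
  \<comment> \<open>Comparison of the coefficients of x^n on both sides of the equation. With m = n
    - e, the factor on the right comes from m (m - 1) + (1 + (a + b) e) m + a b e^2 = (m + a e) (m +
    b e).\<close>
  have recurrence: "of_nat n * (of_nat n - 1) * c n = (if n < e then 0 else
     of_real ((real (n - e) + a * real e) * (real (n - e) + b * real e)) * c (n - e))" for n
  proof -
    let ?L = "fps_X ^ 2 * fps_deriv (fps_deriv \<Psi>)"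
    let ?M = "?L + fps_const (of_real (1 + (a + b) * real e)) * (fps_X * fps_deriv \<Psi>)
       + fps_const (of_real (a * b * (real e)\<^sup>2)) * \<Psi>"
    have L: "(\<lambda>x. x\<^sup>2 * deriv (deriv \<psi>) x) has_fps_expansion ?L"
      by (intro fps_expansion_intros \<Psi>)
    have R: "(\<lambda>x. x ^ e * (x\<^sup>2 * deriv (deriv \<psi>) x
         + of_real (1 + (a + b) * real e) * (x * deriv \<psi> x)
         + of_real (a * b * (real e)\<^sup>2) * \<psi> x)) has_fps_expansion fps_X ^ e * ?M"
      by (intro fps_expansion_intros \<Psi>)
    have ev: "\<forall>\<^sub>F x in nhds 0. x\<^sup>2 * deriv (deriv \<psi>) x = x ^ e * (x\<^sup>2 * deriv (deriv \<psi>) x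
         + of_real (1 + (a + b) * real e) * (x * deriv \<psi> x) + of_real (a * b * (real e)\<^sup>2) * \<psi> x)"
    proof -
      have "\<forall>\<^sub>F x in nhds 0. x \<in> ball (0::complex) R"
        by (rule eventually_nhds_in_open) (use \<open>R > 0\<close> in auto)
      then show ?thesis by eventually_elim (rule ode)
    qed
    from R have "(\<lambda>x. x\<^sup>2 * deriv (deriv \<psi>) x) has_fps_expansion fps_X ^ e * ?M"
      by (simp only: has_fps_expansion_cong[OF ev refl])
    with L have "?L = fps_X ^ e * ?M" by (rule fps_expansion_unique_complex)
    then have "fps_nth ?L n = fps_nth (fps_X ^ e * ?M) n" by (rule arg_cong)
    also have "\<dots> = (if n < e then 0 else fps_nth ?M (n - e))" by (rule fps_X_power_mult_nth)
    also have "fps_nth ?M (n - e) =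
       of_real ((real (n - e) + a * real e) * (real (n - e) + b * real e)) * c (n - e)"
      unfolding fps_add_nth X2 X1 fps_mult_left_const_nth c_def[symmetric]
      by (simp add: algebra_simps power2_eq_square)
    finally show ?thesis unfolding X2 .
  qed

  define h1 where "h1 = (\<lambda>j. pochhammer a j * pochhammer b j / (pochhammer (1 - 1 / real e) j * fact j))"
  define h2 where "h2 = (\<lambda>j. pochhammer (a + 1 / real e) j * pochhammer (b + 1 / real e) j
     / (pochhammer (1 + 1 / real e) j * fact j))"
  have e0: "real e \<noteq> 0" "real e > 0" "1 - 1 / real e > 0" "1 + 1 / real e > 0"
    using e by (auto simp: field_simps)
  \<comment> \<open>For n = e (j + 1) the factor n (n - 1) equals e^2 (j + 1) (j + 1 - 1/e), which
    produces the lower parameter 1 - 1/e. For n = e (j + 1) + 1 it produces 1 + 1/e in the same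
    way.\<close>
  have c0: "c (e * j) = c 0 * of_real (h1 j)" for j
  proof (induction j)
    case 0 show ?case by (simp add: h1_def)
  next
    case (Suc j)
    define n where "n = e * Suc j"
    have n: "\<not> n < e" "n - e = e * j" by (auto simp: n_def)
    have "complex_of_real (real n * (real n - 1)) * c n =
      of_real ((real (e * j) + a * real e) * (real (e * j) + b * real e)) * (c 0 * of_real (h1 j))"
      using recurrence[of n] n Suc by simp
    also have "real n * (real n - 1) = (real e)\<^sup>2 * ((1 - 1 / real e + real j) * real (Suc j))"
      using e0(1) by (simp add: n_def field_simps power2_eq_square)
    also have "(real (e * j) + a * real e) * (real (e * j) + b * real e)
        = (real e)\<^sup>2 * ((a + real j) * (b + real j))"
      by (simp add: algebra_simps power2_eq_square)
    also have "complex_of_real ((real e)\<^sup>2 * ((a + real j) * (b + real j))) * (c 0 * of_real (h1 j))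
       = c 0 * of_real ((real e)\<^sup>2 * ((a + real j) * (b + real j) * h1 j))" by simp
    also have "(a + real j) * (b + real j) * h1 j
       = h1 (Suc j) * ((1 - 1 / real e + real j) * real (Suc j))"
      unfolding h1_def by (rule hypergeometric_coeff_step[OF e0(3), symmetric])
    finally have eq: "complex_of_real ((real e)\<^sup>2 * ((1 - 1 / real e + real j) * real (Suc j))) * c n
       = complex_of_real ((real e)\<^sup>2 * ((1 - 1 / real e + real j) * real (Suc j))) * (c 0 * of_real (h1 (Suc j)))"
      by (simp only: of_real_mult mult_ac)
    have "(real e)\<^sup>2 * ((1 - 1 / real e + real j) * real (Suc j)) \<noteq> 0"
      using e0 by (auto simp: add_nonneg_eq_0_iff)
    then show ?case using eq unfolding n_def[symmetric] mult_left_cancel by (simp only: mult_left_cancel of_real_eq_0_iff not_False_eq_True)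
  qed
  have c1: "c (e * j + 1) = c 1 * of_real (h2 j)" for j
  proof (induction j)
    case 0 show ?case by (simp add: h2_def)
  next
    case (Suc j)
    define n where "n = e * Suc j + 1"
    have n: "\<not> n < e" "n - e = e * j + 1" by (auto simp: n_def)
    have "complex_of_real (real n * (real n - 1)) * c n =
      of_real ((real (e * j + 1) + a * real e) * (real (e * j + 1) + b * real e)) * (c 1 * of_real (h2 j))"
      using recurrence[of n] n Suc by simp
    also have "real n * (real n - 1) = (real e)\<^sup>2 * ((1 + 1 / real e + real j) * real (Suc j))"
      using e0(1) by (simp add: n_def field_simps power2_eq_square)
    also have "(real (e * j + 1) + a * real e) * (real (e * j + 1) + b * real e)
        = (real e)\<^sup>2 * ((a + 1 / real e + real j) * (b + 1 / real e + real j))"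
      using e0(1) by (simp add: field_simps power2_eq_square)
    also have "complex_of_real ((real e)\<^sup>2 * ((a + 1 / real e + real j) * (b + 1 / real e + real j)))
          * (c 1 * of_real (h2 j))
       = c 1 * of_real ((real e)\<^sup>2 * ((a + 1 / real e + real j) * (b + 1 / real e + real j) * h2 j))"
      by simp
    also have "(a + 1 / real e + real j) * (b + 1 / real e + real j) * h2 j
       = h2 (Suc j) * ((1 + 1 / real e + real j) * real (Suc j))"
      unfolding h2_def by (rule hypergeometric_coeff_step[OF e0(4), symmetric])
    finally have eq: "complex_of_real ((real e)\<^sup>2 * ((1 + 1 / real e + real j) * real (Suc j))) * c n
       = complex_of_real ((real e)\<^sup>2 * ((1 + 1 / real e + real j) * real (Suc j))) * (c 1 * of_real (h2 (Suc j)))"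
      by (simp only: of_real_mult mult_ac)
    have "(real e)\<^sup>2 * ((1 + 1 / real e + real j) * real (Suc j)) \<noteq> 0"
      using e0 by (auto simp: add_nonneg_eq_0_iff)
    then show ?case using eq unfolding n_def[symmetric] by (simp only: mult_left_cancel of_real_eq_0_iff not_False_eq_True)
  qed
  \<comment> \<open>In the other residue classes modulo e the recurrence starts at some n with 2
    \<le> n < e, where n (n - 1) is not 0 and the right-hand side is.\<close>
  have cz: "c n = 0" if "n \<notin> range (\<lambda>j. e * j)" "n \<notin> range (\<lambda>j. e * j + 1)" for n
    using that
  proof (induction n rule: less_induct)
    case (less n)
    have n2: "n \<noteq> 0" "n \<noteq> 1" using less.prems by (auto simp: image_iff dest: spec[of _ 0])
    have "(if n < e then 0 else
      of_real ((real (n - e) + a * real e) * (real (n - e) + b * real e)) * c (n - e)) = 0"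
    proof (cases "n < e")
      case False
      have "n - e \<notin> range (\<lambda>j. e * j)" "n - e \<notin> range (\<lambda>j. e * j + 1)"
      proof -
        show "n - e \<notin> range (\<lambda>j. e * j)"
        proof
          assume "n - e \<in> range (\<lambda>j. e * j)"
          then obtain j where "n - e = e * j" by blast
          then have "n = e * Suc j" using False by simp
          then show False using less.prems(1) by blast
        qed
        show "n - e \<notin> range (\<lambda>j. e * j + 1)"
        proof
          assume "n - e \<in> range (\<lambda>j. e * j + 1)"
          then obtain j where "n - e = e * j + 1" by blast
          then have "n = e * Suc j + 1" using False by simp
          then show False using less.prems(2) by blast
        qed
      qed
      moreover have "n - e < n" using n2 e by simp
      ultimately have "c (n - e) = 0" using less.IH by blast
      then show ?thesis by simp
    qed simp
    with recurrence[of n] have "of_nat n * (of_nat n - 1) * c n = 0" by (simp only:)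
    then show ?case using n2 by (auto simp: of_nat_eq_1_iff)
  qed

  define f where "f = (\<lambda>n. c n * x ^ n)"
  have series: "(\<lambda>n. c n * w ^ n) sums \<psi> w" if "w \<in> ball 0 R" for w
    using holomorphic_power_series[OF hol that] by (simp add: c_def \<Psi>_def fps_expansion_def)
  have "summable (\<lambda>n. norm (f n))"
  proof -
    \<comment> \<open>A point of the disc farther from 0 than x: convergence there gives absolute
      convergence at x, so that the series may be split into residue classes.\<close>
    define w where "w = complex_of_real ((norm x + R) / 2)"
    have w: "norm w = (norm x + R) / 2" unfolding w_def norm_of_real using R by simp
    have "w \<in> ball 0 R" "norm x < norm w" using x by (auto simp: w)
    then show ?thesis unfolding f_def
      using powser_insidea[OF sums_summable[OF series[of w]], of x] by simp
  qed
  then have hs: "(f has_sum \<psi> x) UNIV"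
    unfolding f_def by (rule norm_summable_imp_has_sum[OF _ series[OF x]])
  have summ: "f summable_on A" for A
    by (rule summable_on_subset_banach[OF has_sum_imp_summable[OF hs] subset_UNIV])
  let ?S0 = "range (\<lambda>j. e * j)" and ?S1 = "range (\<lambda>j. e * j + 1)"
  have disj: "?S0 \<inter> ?S1 = {}"
  proof -
    have "e * i \<noteq> e * j + 1" for i j
    proof
      assume "e * i = e * j + 1"
      then have "(e * i) mod e = (e * j + 1) mod e" by simp
      then show False using e by (simp add: mod_Suc)
    qed
    then show ?thesis by blast
  qed
  have "\<psi> x = infsum f UNIV" using hs by (simp add: infsumI)
  also have "\<dots> = infsum f (?S0 \<union> ?S1)"
    by (rule infsum_cong_neutral) (auto simp: f_def cz)
  also have "\<dots> = infsum f ?S0 + infsum f ?S1"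
    by (intro infsum_Un_disjoint summ disj)
  also have "infsum f ?S0 = c 0 * hyp2F1 a b (1 - 1 / real e) (x ^ e)"
  proof -
    have inj: "inj (\<lambda>j. e * j)" using e by (auto simp: inj_def)
    have eq: "(f \<circ> (\<lambda>j. e * j)) = (\<lambda>j. c 0 * (of_real (h1 j) * (x ^ e) ^ j))"
      by (simp add: fun_eq_iff f_def c0 power_mult)
    have "(f \<circ> (\<lambda>j. e * j)) summable_on UNIV"
      using summable_on_reindex[OF inj, of f] summ by blast
    then show ?thesis unfolding infsum_reindex[OF inj] eq h1_def
      by (rule infsum_cmult_hyp2F1)
  qed
  also have "infsum f ?S1 = c 1 * x * hyp2F1 (a + 1 / real e) (b + 1 / real e) (1 + 1 / real e) (x ^ e)"
  proof -
    have inj: "inj (\<lambda>j. e * j + 1)" using e by (auto simp: inj_def)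
    have eq: "(f \<circ> (\<lambda>j. e * j + 1)) = (\<lambda>j. c 1 * x * (of_real (h2 j) * (x ^ e) ^ j))"
      unfolding fun_eq_iff o_def f_def c1 by (simp add: power_mult power_add)
    have "(f \<circ> (\<lambda>j. e * j + 1)) summable_on UNIV"
      using summable_on_reindex[OF inj, of f] summ by blast
    then show ?thesis unfolding infsum_reindex[OF inj] eq h2_def
      by (rule infsum_cmult_hyp2F1)
  qed
  also have "c 0 = \<psi> 0" by (simp add: c_def \<Psi>_def fps_expansion_def)
  also have "c 1 = deriv \<psi> 0" by (simp add: c_def \<Psi>_def fps_expansion_def)
  finally show ?thesis .
qed

section \<open>Discontinuity of the action\<close>

lemma norm_mat2_le:
  fixes A :: "real^2^2"
  shows "norm A \<le> \<bar>A$1$1\<bar> + \<bar>A$1$2\<bar> + \<bar>A$2$1\<bar> + \<bar>A$2$2\<bar>"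
proof -
  have "norm A \<le> (\<Sum>i\<in>UNIV. norm (A$i))" by (simp add: norm_vec_def L2_set_le_sum)
  also have "\<dots> \<le> (\<Sum>i\<in>UNIV. \<Sum>j\<in>UNIV. \<bar>A$i$j\<bar>)" by (intro sum_mono norm_le_l1_cart)
  finally show ?thesis by (simp add: sum_2)
qed

lemma compact_SL2R_bounded: "compact {A::real^2^2. det A = 1 \<and> norm A \<le> T}"
proof -
  have "closed {A::real^2^2. det A = 1}"
    unfolding det_2 by (intro closed_Collect_eq continuous_intros)
  then have "compact (cball 0 T \<inter> {A::real^2^2. det A = 1})" by (intro compact_Int_closed compact_cball)
  also have "cball 0 T \<inter> {A::real^2^2. det A = 1} = {A. det A = 1 \<and> norm A \<le> T}" by auto
  finally show ?thesis .
qed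

text \<open>Both rows of A are controlled by a complex number \<alpha> z + \<beta> with real
  \<alpha>, \<beta>: its imaginary part bounds \<alpha>, and then \<beta> is bounded as well. For
  the lower row this number is the automorphy factor, whose squared norm is Im z / Im (A z); for the
  upper row it is A z times that factor.\<close>

lemma mobius_norm_bound:
  assumes "det A = 1" "z \<in> \<H>"
    and "\<delta> > 0" "\<delta> \<le> Im z" "norm z \<le> M" "\<delta> \<le> Im (mobius A z)" "norm (mobius A z) \<le> M"
  shows "norm A \<le> (1 + M / \<delta>) * (1 + M) * (1 + M / \<delta> + 1 / \<delta>) * 2"
proof -
  define q where "q = 1 + M / \<delta>"
  define w where "w = mobius A z"
  define j where "j = autom_factor A z"
  have M: "M \<ge> 0" "M \<ge> \<delta>" using assms(3-5) abs_Im_le_cmod[of z] by linarith+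
  have jz: "j \<noteq> 0" unfolding j_def using assms(1,2) by (rule autom_factor_nonzero)
  have lin: "\<bar>a\<bar> \<le> B / \<delta> \<and> \<bar>b\<bar> \<le> B + B / \<delta> * M"
    if "norm (of_real a * z + of_real b) \<le> B" for a b B
  proof -
    have "\<bar>a\<bar> * \<delta> \<le> \<bar>a\<bar> * Im z" using assms(4) by (intro mult_left_mono) auto
    also have "\<dots> = \<bar>Im (of_real a * z + of_real b)\<bar>" using assms(3,4) by (simp add: abs_mult)
    also have "\<dots> \<le> B" using abs_Im_le_cmod that by (rule order_trans)
    finally have a: "\<bar>a\<bar> \<le> B / \<delta>" using assms(3) by (simp add: field_simps)
    have "\<bar>b\<bar> = norm ((of_real a * z + of_real b) - of_real a * z)" by simp
    also have "\<dots> \<le> norm (of_real a * z + of_real b) + norm (of_real a * z)" by (rule norm_triangle_ineq4)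
    also have "\<dots> \<le> B + B / \<delta> * M"
      unfolding norm_mult norm_of_real using a assms(3,5) that
      by (intro add_mono mult_mono) (auto intro: order_trans[OF abs_ge_zero])
    finally show ?thesis using a by blast
  qed
  have "(norm j)\<^sup>2 = Im z / Im w"
    using Im_mobius[OF assms(1), of z] jz assms(3,4,6) unfolding w_def j_def
    by (simp add: field_simps)
  also have "\<dots> \<le> M / \<delta>"
    using assms(3-7) abs_Im_le_cmod[of z] unfolding w_def by (intro frac_le) linarith+
  also have "\<dots> \<le> q" by (simp add: q_def)
  \<comment> \<open>As q \<ge> 1, passing to the square of q avoids a square root in the
    bound.\<close>
  also have "q \<le> q\<^sup>2" using M assms(3) by (intro self_le_power) (auto simp: q_def)
  finally have j: "norm j \<le> q" using M assms(3) by (simp add: q_def power2_le_iff_abs_le)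
  have "norm (of_real (A$1$1) * z + of_real (A$1$2)) = norm w * norm j"
    using jz by (simp add: w_def j_def mobius_def norm_divide)
  also have "\<dots> \<le> M * q" using j assms(7) M unfolding w_def by (intro mult_mono) auto
  finally have 1: "norm (of_real (A$1$1) * z + of_real (A$1$2)) \<le> M * q" .
  have 2: "norm (of_real (A$2$1) * z + of_real (A$2$2)) \<le> q"
    using j by (simp add: j_def autom_factor_def)
  note l1 = lin[OF 1] and l2 = lin[OF 2]
  have "norm A \<le> \<bar>A$1$1\<bar> + \<bar>A$1$2\<bar> + \<bar>A$2$1\<bar> + \<bar>A$2$2\<bar>" by (rule norm_mat2_le)
  also have "\<dots> \<le> M * q / \<delta> + (M * q + M * q / \<delta> * M) + q / \<delta> + (q + q / \<delta> * M)"
    using l1 l2 by linarith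
  also have "\<dots> = q * (1 + M) * (1 + M / \<delta> + 1 / \<delta>)" using assms(3) by (simp add: field_simps)
  also have "\<dots> \<le> q * (1 + M) * (1 + M / \<delta> + 1 / \<delta>) * 2"
    using M assms(3) by (simp add: q_def)
  finally show ?thesis by (simp add: q_def)
qed

section \<open>Discreteness of the group, obtained from the zeros of the Hauptmodul\<close>

locale triangle_setting = SL2R_subgroup +
  fixes t :: "complex \<Rightarrow> complex" and \<tau>1 \<tau>2 \<tau>3 :: complex and e1 e2 e3 :: nat
  assumes signature: "signature_0_3 \<Gamma> \<tau>1 \<tau>2 \<tau>3 e1 e2 e3"
    and hauptmodul: "hauptmodul \<Gamma> t"
    and t_lim1: "t \<midarrow>\<tau>1\<rightarrow> 0" and t_lim2: "t \<midarrow>\<tau>2\<rightarrow> 1" and t_pole3: "is_pole t \<tau>3"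
begin

lemma tau_in: "\<tau>1 \<in> \<H>" "\<tau>2 \<in> \<H>" "\<tau>3 \<in> \<H>"
  using signature by (auto simp: signature_0_3_def elliptic_point_def)

lemma order_ge_2: "e1 \<ge> 2" "e2 \<ge> 2" "e3 \<ge> 2"
  using signature by (auto simp: signature_0_3_def elliptic_point_def)

lemma t_nicely: "t nicely_meromorphic_on \<H>"
  using hauptmodul by (auto simp: hauptmodul_def automorphic_function_def)

lemma t_meromorphic: "t meromorphic_on \<H>"
  using t_nicely by (simp add: nicely_meromorphic_on_def)

lemma t_invariant: "A \<in> \<Gamma> \<Longrightarrow> z \<in> \<H> \<Longrightarrow> t (mobius A z) = t z"
  using hauptmodul by (auto simp: hauptmodul_def automorphic_function_def)

lemma t_same_orbit: "z \<in> \<H> \<Longrightarrow> same_orbit \<Gamma> z w \<Longrightarrow> t w = t z"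
  by (auto simp: same_orbit_def t_invariant)

lemma t_not_pole: "\<not> is_pole t \<tau>1" "\<not> is_pole t \<tau>2"
  using t_lim1 t_lim2 not_pole_if_tendsto by blast+

lemma t_analytic: "z \<in> \<H> \<Longrightarrow> \<not> is_pole t z \<Longrightarrow> t analytic_on {z}"
  using t_nicely nicely_meromorphic_on_imp_analytic_at by blast

lemma t_tendsto: "z \<in> \<H> \<Longrightarrow> \<not> is_pole t z \<Longrightarrow> (t \<longlongrightarrow> t z) (at z)"
  using t_nicely by (auto simp: nicely_meromorphic_on_def)

text \<open>The value 0 at \<tau>3 is the default value of a nicely meromorphic function at a pole.
  Since it coincides with the value at \<tau>1, statements about values of \<open>t\<close> also say
  whether the point is a pole.\<close>

lemma t_tau: "t \<tau>1 = 0" "t \<tau>2 = 1" "t \<tau>3 = 0"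
  using t_tendsto[OF tau_in(1) t_not_pole(1)] t_tendsto[OF tau_in(2) t_not_pole(2)]
    t_lim1 t_lim2 LIM_unique t_nicely tau_in(3) t_pole3 not_pole_if_tendsto
  by (auto simp: nicely_meromorphic_on_def)

lemma t_nonconstant: "\<forall>\<^sub>\<approx>z\<in>\<H>. t z \<noteq> v"
proof -
  have "\<not> (\<forall>\<^sub>\<approx>z\<in>\<H>. t z = v)"
  proof
    assume "\<forall>\<^sub>\<approx>z\<in>\<H>. t z = v"
    then have "\<forall>\<^sub>F z in at \<tau>3. t z = v" using tau_in(3) by (rule eventually_cosparse_imp_eventually_at)
    then have "\<exists>\<^sub>F z in at \<tau>3. t z = v" by (rule eventually_frequently[OF at_neq_bot])
    then show False using t_pole3 frequently_const_imp_not_is_pole by blast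
  qed
  then show ?thesis
    using meromorphic_imp_constant_or_avoid[OF t_meromorphic open_upper_half_plane connected_upper_half_plane]
    by blast
qed

lemma is_pole_mobius:
  assumes "A \<in> \<Gamma>" "z \<in> \<H>"
  shows "is_pole t (mobius A z) \<longleftrightarrow> is_pole t z"
proof -
  have "is_pole t (mobius A z) \<longleftrightarrow> filterlim t at_infinity (filtermap (mobius A) (at z))"
    by (simp add: is_pole_def filtermap_mobius assms)
  also have "\<dots> \<longleftrightarrow> filterlim (\<lambda>x. t (mobius A x)) at_infinity (at z)"
    by (simp add: filterlim_def filtermap_filtermap)
  also have "\<dots> \<longleftrightarrow> is_pole t z"
    unfolding is_pole_def
  proof (rule filterlim_cong)
    show "\<forall>\<^sub>F x in at z. t (mobius A x) = t x"
      using eventually_at_in_open'[OF open_upper_half_plane assms(2)]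
      by eventually_elim (rule t_invariant[OF assms(1)])
  qed auto
  finally show ?thesis .
qed

text \<open>In the end this is the complement of the three elliptic orbits
  (\<open>regular_or_elliptic\<close>). It is defined through \<open>t\<close> because that fact
  depends on the injectivity of \<open>t\<close> on orbits.\<close>

definition regular :: "complex set" where
  "regular = {z \<in> \<H>. \<not> is_pole t z \<and> t z \<noteq> 0 \<and> t z \<noteq> 1}"

lemma regularD:
  assumes "z \<in> regular"
  shows "z \<in> \<H>" "\<not> is_pole t z" "t z \<noteq> 0" "t z \<noteq> 1"
  using assms by (auto simp: regular_def)

lemma regular_cosparse: "\<forall>\<^sub>\<approx>z\<in>\<H>. z \<in> regular"
  using meromorphic_on_imp_not_pole_cosparse[OF t_meromorphic] t_nonconstant[of 0] t_nonconstant[of 1]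
    eventually_in_cosparse[OF order_refl open_upper_half_plane]
  by eventually_elim (simp add: regular_def)

lemma regular_eventually: "z \<in> \<H> \<Longrightarrow> \<forall>\<^sub>F w in at z. w \<in> regular"
  using regular_cosparse by (rule eventually_cosparse_imp_eventually_at)

lemma open_regular: "open regular"
proof -
  have "{z. z \<notin> regular} sparse_in \<H>"
    using regular_cosparse by (simp add: eventually_cosparse)
  then have "open (\<H> - {z. z \<notin> regular})"
    by (rule open_diff_sparse_pts[OF open_upper_half_plane])
  moreover have "\<H> - {z. z \<notin> regular} = regular" by (auto simp: regular_def)
  ultimately show ?thesis by simp
qed

lemma t_holomorphic_regular: "t holomorphic_on regular"
proof -
  have "t analytic_on regular" using t_analytic by (subst analytic_on_analytic_at) (auto simp: regular_def)
  then show ?thesis by (rule analytic_imp_holomorphic)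
qed

lemma regular_mobius: "A \<in> \<Gamma> \<Longrightarrow> z \<in> regular \<Longrightarrow> mobius A z \<in> regular"
  by (auto simp: regular_def is_pole_mobius t_invariant mobius_closed)

lemma regular_stabilizer_trivial:
  assumes "z \<in> regular" "A \<in> \<Gamma>" "mobius A z = z"
  shows "A = mat 1 \<or> A = - mat 1"
proof (rule ccontr)
  assume "\<not> ?thesis"
  with assms have "same_orbit \<Gamma> \<tau>1 z \<or> same_orbit \<Gamma> \<tau>2 z \<or> same_orbit \<Gamma> \<tau>3 z"
    using signature by (auto simp: signature_0_3_def regular_def)
  moreover have "\<not> same_orbit \<Gamma> \<tau>3 z"
    using is_pole_mobius tau_in(3) t_pole3 assms(1) by (auto simp: same_orbit_def regular_def)
  ultimately have "t z = 0 \<or> t z = 1" using t_same_orbit tau_in t_tau by metis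
  then show False using assms(1) by (auto simp: regular_def)
qed

lemma finite_stabilizer:
  assumes "elliptic_point \<Gamma> z e"
  shows "finite {A \<in> \<Gamma>. mobius A z = z}"
proof -
  let ?S = "{A \<in> \<Gamma>. mobius A z = z}" and ?f = "\<lambda>A::real^2^2. {A, - A}"
  have "card (?f ` ?S) > 0" using assms by (auto simp: elliptic_point_def)
  then have "finite (?f ` ?S)" by (rule card_ge_0_finite)
  then have "finite (\<Union> (?f ` ?S))" by (rule finite_Union) auto
  then show ?thesis by (rule finite_subset[rotated]) blast
qed

text \<open>Discreteness. The matrices of bounded norm and determinant 1 move \<tau>1 within a
  compact subset of the upper half plane. Elements of \<Gamma> move it to zeros of \<open>t\<close>,
  of which the compact set has only finitely many, and the elements with a given image of \<tau>1
  form a coset of its finite stabiliser.\<close>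

lemma finite_bounded: "finite {A \<in> \<Gamma>. norm A \<le> T}"
proof -
  define K where "K = (\<lambda>A. mobius A \<tau>1) ` {A::real^2^2. det A = 1 \<and> norm A \<le> T}"
  have "compact K"
    unfolding K_def
  proof (rule compact_continuous_image[OF _ compact_SL2R_bounded])
    show "continuous_on {A::real^2^2. det A = 1 \<and> norm A \<le> T} (\<lambda>A. mobius A \<tau>1)"
      unfolding mobius_def autom_factor_def
      by (intro continuous_intros)
        (use autom_factor_nonzero tau_in(1) in \<open>auto simp: autom_factor_def\<close>)
  qed
  have K: "K \<subseteq> \<H>" using mobius_in_upper_half_plane tau_in(1) by (auto simp: K_def)
  have "{z. \<not> t z \<noteq> 0} sparse_in \<H>"
    using t_nonconstant[of 0] unfolding eventually_cosparse .
  then have "{z. \<not> t z \<noteq> 0} sparse_in K" using K by (rule sparse_in_subset)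
  then have fin: "finite (K \<inter> {z. \<not> t z \<noteq> 0})" using \<open>compact K\<close> by (rule sparse_in_compact_finite)
  have fibre: "finite {A \<in> \<Gamma>. mobius A \<tau>1 = w}" for w
  proof (cases "{A \<in> \<Gamma>. mobius A \<tau>1 = w} = {}")
    case False
    then obtain A where A: "A \<in> \<Gamma>" "mobius A \<tau>1 = w" by blast
    obtain B where B: "B \<in> \<Gamma>" "A ** B = mat 1" "B ** A = mat 1" by (rule inverse_exists[OF A(1)])
    have "{A \<in> \<Gamma>. mobius A \<tau>1 = w} \<subseteq> (\<lambda>C. A ** C) ` {C \<in> \<Gamma>. mobius C \<tau>1 = \<tau>1}"
    proof
      fix D assume D: "D \<in> {A \<in> \<Gamma>. mobius A \<tau>1 = w}"
      have "mobius (B ** D) \<tau>1 = mobius B (mobius D \<tau>1)" using mobius_comp B D tau_in by blast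
      also have "\<dots> = mobius B (mobius A \<tau>1)" using D A by simp
      also have "\<dots> = \<tau>1" using mobius_inverse_eq[OF B(1) A(1) B(3) tau_in(1)] .
      finally have "B ** D \<in> {C \<in> \<Gamma>. mobius C \<tau>1 = \<tau>1}" using B D mult_closed by blast
      moreover have "D = A ** (B ** D)" by (simp add: matrix_mul_assoc B)
      ultimately show "D \<in> (\<lambda>C. A ** C) ` {C \<in> \<Gamma>. mobius C \<tau>1 = \<tau>1}" by blast
    qed
    moreover have "elliptic_point \<Gamma> \<tau>1 e1" using signature by (simp add: signature_0_3_def)
    ultimately show ?thesis using finite_stabilizer finite_surj by blast
  qed (metis finite.emptyI)
  have "{A \<in> \<Gamma>. norm A \<le> T} \<subseteq> (\<Union>w\<in>K \<inter> {z. \<not> t z \<noteq> 0}. {A \<in> \<Gamma>. mobius A \<tau>1 = w})"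
    using det_eq_1 t_invariant tau_in(1) t_tau(1) by (auto simp: K_def)
  then show ?thesis using fin fibre finite_subset finite_UN_I by (metis (no_types, lifting))
qed

lemma compact_upper_half_plane_bounds:
  assumes "compact K" "K \<subseteq> \<H>"
  obtains \<delta> M where "\<delta> > 0" "\<And>z. z \<in> K \<Longrightarrow> \<delta> \<le> Im z" "\<And>z. z \<in> K \<Longrightarrow> norm z \<le> M"
proof (cases "K = {}")
  case False
  obtain z0 where "z0 \<in> K" "\<And>z. z \<in> K \<Longrightarrow> Im z0 \<le> Im z"
    using continuous_attains_inf[OF assms(1) False continuous_on_Im[OF continuous_on_id]] by auto
  moreover obtain M where "\<And>z. z \<in> K \<Longrightarrow> norm z \<le> M"
    using compact_imp_bounded[OF assms(1)] by (auto simp: bounded_iff)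
  ultimately show thesis using assms(2) by (intro that[of "Im z0" M]) (auto simp: upper_half_plane_def)
qed (use that[of 1 0] in auto)

lemma finite_proper:
  assumes "compact K" "K \<subseteq> \<H>" "compact L" "L \<subseteq> \<H>"
  shows "finite {A \<in> \<Gamma>. \<exists>x\<in>K. mobius A x \<in> L}"
proof -
  obtain \<delta> M where b: "\<delta> > 0" "\<And>z. z \<in> K \<union> L \<Longrightarrow> \<delta> \<le> Im z" "\<And>z. z \<in> K \<union> L \<Longrightarrow> norm z \<le> M"
    using compact_upper_half_plane_bounds[of "K \<union> L"] assms by (metis Un_least compact_Un)
  let ?T = "(1 + M / \<delta>) * (1 + M) * (1 + M / \<delta> + 1 / \<delta>) * 2"
  have "{A \<in> \<Gamma>. \<exists>x\<in>K. mobius A x \<in> L} \<subseteq> {A \<in> \<Gamma>. norm A \<le> ?T}"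
  proof safe
    fix A x assume A: "A \<in> \<Gamma>" "x \<in> K" "mobius A x \<in> L"
    show "norm A \<le> ?T"
      by (rule mobius_norm_bound[of A x]) (use A assms b det_eq_1 in auto)
  qed
  then show ?thesis using finite_bounded finite_subset by blast
qed

text \<open>By \<open>finite_proper\<close> only finitely many elements link small balls around z
  and w. Each one that does not send z to w is excluded by shrinking the radius.\<close>

lemma proper_separation:
  assumes z: "z \<in> \<H>" and w: "w \<in> \<H>"
  obtains r where "r > 0" "cball z r \<subseteq> \<H>" "cball w r \<subseteq> \<H>"
    "\<And>A x. A \<in> \<Gamma> \<Longrightarrow> x \<in> ball z r \<Longrightarrow> mobius A x \<in> ball w r \<Longrightarrow> mobius A z = w"
proof -
  obtain r1 where r1: "r1 > 0" "cball z r1 \<subseteq> \<H>"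
    using open_contains_cball_eq[OF open_upper_half_plane] z by blast
  obtain r2 where r2: "r2 > 0" "cball w r2 \<subseteq> \<H>"
    using open_contains_cball_eq[OF open_upper_half_plane] w by blast
  define r0 where "r0 = min r1 r2"
  have r0: "r0 > 0" "cball z r0 \<subseteq> \<H>" "cball w r0 \<subseteq> \<H>"
    using r1 r2 unfolding r0_def by auto
  define F where "F = {A \<in> {A \<in> \<Gamma>. \<exists>x\<in>cball z r0. mobius A x \<in> cball w r0}. mobius A z \<noteq> w}"
  have "finite F" unfolding F_def
    by (rule finite_subset[OF _ finite_proper[OF compact_cball r0(2) compact_cball r0(3)]]) blast
  have "\<exists>\<rho>>0. \<forall>x\<in>ball z \<rho>. mobius A x \<notin> ball w \<rho>" if "A \<in> F" for A
  proof -
    have A: "A \<in> \<Gamma>" "mobius A z \<noteq> w" using that by (auto simp: F_def)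
    define d where "d = dist (mobius A z) w / 2"
    have d: "d > 0" using A by (simp add: d_def)
    obtain \<rho> where \<rho>: "\<rho> > 0" "\<And>x. dist x z < \<rho> \<Longrightarrow> dist (mobius A x) (mobius A z) < d"
      using isCont_mobius[OF A(1) z] d unfolding continuous_at_eps_delta by blast
    have "mobius A x \<notin> ball w (min \<rho> d)" if "x \<in> ball z (min \<rho> d)" for x
    proof
      assume "mobius A x \<in> ball w (min \<rho> d)"
      then have "dist (mobius A x) w < d" by (simp add: dist_commute)
      moreover have "dist (mobius A x) (mobius A z) < d" using \<rho>(2)[of x] that by (simp add: dist_commute)
      ultimately have "dist (mobius A z) w < d + d"
        using dist_triangle_less_add by (metis dist_commute)
      then show False by (simp add: d_def)
    qed
    then show ?thesis using \<rho>(1) d by (intro exI[of _ "min \<rho> d"]) auto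
  qed
  then obtain \<rho> where \<rho>: "\<And>A. A \<in> F \<Longrightarrow> \<rho> A > 0 \<and> (\<forall>x\<in>ball z (\<rho> A). mobius A x \<notin> ball w (\<rho> A))"
    by metis
  define r where "r = Min (insert r0 (\<rho> ` F))"
  have r: "r > 0" "r \<le> r0" "\<And>A. A \<in> F \<Longrightarrow> r \<le> \<rho> A"
    using \<open>finite F\<close> r0(1) \<rho> by (auto simp: r_def)
  show thesis
  proof (rule that[OF r(1)])
    show "cball z r \<subseteq> \<H>" "cball w r \<subseteq> \<H>" using r0 r(2) by auto
    show "mobius A z = w" if A: "A \<in> \<Gamma>" "x \<in> ball z r" "mobius A x \<in> ball w r" for A x
    proof (rule ccontr)
      assume "mobius A z \<noteq> w"
      then have "A \<in> F" using A r(2) by (auto simp: F_def intro!: bexI[of _ x])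
      moreover have "x \<in> ball z (\<rho> A)" "mobius A x \<in> ball w (\<rho> A)"
        using r(3)[OF \<open>A \<in> F\<close>] A by auto
      ultimately show False using \<rho> by blast
    qed
  qed
qed

end

section \<open>A Poincare series\<close>

text \<open>This is (A z + i) times the automorphy factor, written as a linear polynomial in z. The
  derivative of the map \<open>cayley\<close> after \<open>mobius A\<close> is 2 i divided by its
  square.\<close>

definition cayley_factor :: "real^2^2 \<Rightarrow> complex \<Rightarrow> complex" where
  "cayley_factor A z = Complex (A$1$1) (A$2$1) * z + Complex (A$1$2) (A$2$2)"

lemma cayley_factor_eq:
  assumes "det A = 1" "z \<in> \<H>"
  shows "cayley_factor A z = (mobius A z + \<i>) * autom_factor A z"
proof -
  have "mobius A z * autom_factor A z = of_real (A$1$1) * z + of_real (A$1$2)"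
    using autom_factor_nonzero[OF assms] by (simp add: mobius_def)
  then show ?thesis
    unfolding distrib_right by (simp add: cayley_factor_def autom_factor_def Complex_eq algebra_simps)
qed

text \<open>The zero of the linear polynomial is the preimage of -i under A and lies in the lower
  half plane, so its distance from z is at least Im z. In the proof this is the identity Im (E cnj
  p) = |p|^2 Im z + det A, with p the leading coefficient and E the value at z.\<close>

lemma cayley_factor_leading_coeff_le:
  assumes "det A = 1"
  shows "norm (Complex (A$1$1) (A$2$1)) * Im z \<le> norm (cayley_factor A z)"
proof -
  define p where "p = Complex (A$1$1) (A$2$1)"
  have "(norm p)\<^sup>2 = A$1$1 * A$1$1 + A$2$1 * A$2$1"
    unfolding p_def cmod_power2 by (simp add: power2_eq_square)
  moreover have "Im (cayley_factor A z * cnj p) = (A$1$1 * A$1$1 + A$2$1 * A$2$1) * Im z + det A"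
    by (simp add: cayley_factor_def p_def det_2 algebra_simps)
  ultimately have "(norm p)\<^sup>2 * Im z \<le> Im (cayley_factor A z * cnj p)" using assms by simp
  also have "\<dots> \<le> norm (cayley_factor A z) * norm p"
  proof -
    have "Im x \<le> norm x" for x using abs_Im_le_cmod[of x] by linarith
    from this[of "cayley_factor A z * cnj p"] show ?thesis
      by (simp only: norm_mult complex_mod_cnj)
  qed
  finally have "norm p * (norm p * Im z) \<le> norm p * norm (cayley_factor A z)"
    by (simp add: power2_eq_square mult_ac)
  then have "norm p * Im z \<le> norm (cayley_factor A z)" if "norm p > 0"
    using that by (simp only: mult_le_cancel_left_pos)
  then show ?thesis unfolding p_def[symmetric] by (cases "p = 0") auto
qed

lemma cayley_factor_nonzero:
  assumes "det A = 1" "z \<in> \<H>"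
  shows "cayley_factor A z \<noteq> 0"
proof -
  have "mobius A z \<in> \<H>" using assms by (rule mobius_in_upper_half_plane)
  then have "mobius A z + \<i> \<noteq> 0" by (auto simp: upper_half_plane_def complex_eq_iff)
  then show ?thesis using autom_factor_nonzero[OF assms] cayley_factor_eq[OF assms] by simp
qed

text \<open>The constant does not depend on A. Hence a convergent majorant at a single point serves
  uniformly on compact sets.\<close>

lemma cayley_factor_ratio:
  assumes "det A = 1" "z \<in> \<H>"
  shows "norm (cayley_factor A w) \<le> (1 + norm (w - z) / Im z) * norm (cayley_factor A z)"
proof -
  have Im: "Im z > 0" using assms(2) by (rule upper_half_planeD)
  have "cayley_factor A w = cayley_factor A z + Complex (A$1$1) (A$2$1) * (w - z)"
    by (simp add: cayley_factor_def algebra_simps)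
  then have "norm (cayley_factor A w) \<le> norm (cayley_factor A z) + norm (Complex (A$1$1) (A$2$1)) * norm (w - z)"
    by (metis norm_mult norm_triangle_ineq)
  also have "norm (Complex (A$1$1) (A$2$1)) \<le> norm (cayley_factor A z) / Im z"
    using cayley_factor_leading_coeff_le[OF assms(1), of z] Im by (simp add: field_simps)
  finally show ?thesis by (simp add: algebra_simps mult_right_mono)
qed

definition cayley :: "complex \<Rightarrow> complex" where
  "cayley z = (z - \<i>) / (z + \<i>)"

lemma cayley_in_disc: "z \<in> \<H> \<Longrightarrow> norm (cayley z) < 1"
proof -
  assume z: "z \<in> \<H>"
  have "(Re z)\<^sup>2 + (Im z - 1)\<^sup>2 < (Re z)\<^sup>2 + (Im z + 1)\<^sup>2"
    using upper_half_planeD[OF z] by (simp add: power2_eq_square algebra_simps)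
  then have "(norm (z - \<i>))\<^sup>2 < (norm (z + \<i>))\<^sup>2" by (simp add: cmod_power2)
  then have "norm (z - \<i>) < norm (z + \<i>)" by (rule power2_less_imp_less) simp
  then show ?thesis by (simp add: cayley_def norm_divide divide_less_eq)
qed

lemma cayley_inj:
  assumes "z \<in> \<H>" "w \<in> \<H>" "cayley z = cayley w"
  shows "z = w"
proof -
  have "z + \<i> \<noteq> 0" "w + \<i> \<noteq> 0" using assms(1,2) by (auto simp: upper_half_plane_def complex_eq_iff)
  then have "(z - \<i>) * (w + \<i>) = (w - \<i>) * (z + \<i>)"
    using assms(3) by (simp add: cayley_def frac_eq_eq)
  then have "2 * \<i> * z = 2 * \<i> * w" by (simp add: algebra_simps)
  then show ?thesis by simp
qed

text \<open>A covering theorem with an explicit radius, proportional to the derivative at z. The map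
  is fractional linear, so a preimage z + h can be computed; the minimum with r keeps it in the
  ball, and the minimum with Im z keeps the denominator of h away from 0.\<close>

lemma cayley_mobius_covers_ball:
  assumes A: "det A = 1" and z: "z \<in> \<H>" and r: "ball z r \<subseteq> \<H>"
    and u: "u \<in> ball (cayley (mobius A z)) (min r (Im z) / (norm (cayley_factor A z))\<^sup>2)"
  obtains x where "x \<in> ball z r" "cayley (mobius A x) = u"
proof -
  define E where "E = cayley_factor A z"
  define p where "p = Complex (A$1$1) (A$2$1)"
  define \<kappa> where "\<kappa> = min r (Im z)"
  define v where "v = u - cayley (mobius A z)"
  have E: "E \<noteq> 0" using cayley_factor_nonzero[OF A z] by (simp add: E_def)
  have "norm v < \<kappa> / (norm E)\<^sup>2"
    using u by (simp add: v_def \<kappa>_def E_def dist_norm norm_minus_commute)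
  then have v: "norm v * (norm E)\<^sup>2 < \<kappa>" using E by (simp add: field_simps)
  have Im: "Im z > 0" using z by (rule upper_half_planeD)
  have "norm (v * p * E) * Im z = norm v * norm E * (norm p * Im z)" by (simp add: norm_mult)
  also have "\<dots> \<le> norm v * norm E * norm E"
    using cayley_factor_leading_coeff_le[OF A, of z] by (intro mult_left_mono) (auto simp: p_def E_def)
  also have "\<dots> < Im z" using v by (simp add: power2_eq_square \<kappa>_def mult_ac)
  finally have "norm (v * p * E) < 1" using Im by simp
  then have den: "1 < norm (2 * \<i> - v * p * E)"
    using norm_triangle_ineq2[of "2 * \<i>" "v * p * E"] by (simp add: norm_mult)
  then have den0: "2 * \<i> - v * p * E \<noteq> 0" by auto
  \<comment> \<open>The solution of 2 i h = v E (E + p h), which says that the values at z + h and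
    at z differ by v.\<close>
  define h where "h = v * E\<^sup>2 / (2 * \<i> - v * p * E)"
  have "norm h = norm v * (norm E)\<^sup>2 / norm (2 * \<i> - v * p * E)"
    unfolding h_def norm_divide norm_mult norm_power ..
  also have "\<dots> \<le> norm v * (norm E)\<^sup>2 / 1" using den by (intro divide_left_mono) auto
  finally have "norm h \<le> norm v * (norm E)\<^sup>2" by simp
  then have h: "norm h < r" using v by (simp add: \<kappa>_def)
  define x where "x = z + h"
  have x: "x \<in> ball z r" using h by (simp add: x_def dist_norm)
  then have xH: "x \<in> \<H>" using r by blast
  have cay: "cayley (mobius A y) = (Complex (A$1$1) (- A$2$1) * y + Complex (A$1$2) (- A$2$2)) / cayley_factor A y"
    if y: "y \<in> \<H>" for y
  proof -
    have "mobius A y - \<i> = (Complex (A$1$1) (- A$2$1) * y + Complex (A$1$2) (- A$2$2)) / autom_factor A y"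
    proof -
      have "mobius A y * autom_factor A y = of_real (A$1$1) * y + of_real (A$1$2)"
        using autom_factor_nonzero[OF A y] by (simp add: mobius_def)
      then have "(mobius A y - \<i>) * autom_factor A y
          = Complex (A$1$1) (- A$2$1) * y + Complex (A$1$2) (- A$2$2)"
        unfolding left_diff_distrib by (simp add: autom_factor_def Complex_eq algebra_simps)
      then show ?thesis using autom_factor_nonzero[OF A y] by (simp add: eq_divide_eq)
    qed
    then show ?thesis unfolding cayley_def cayley_factor_eq[OF A y] by (simp add: mult.commute)
  qed
  have Ex: "cayley_factor A x = E + p * h" by (simp add: cayley_factor_def E_def p_def x_def algebra_simps)
  then have Ex0: "E + p * h \<noteq> 0" using cayley_factor_nonzero[OF A xH] by simp
  let ?p' = "Complex (A$1$1) (- A$2$1)" and ?q' = "Complex (A$1$2) (- A$2$2)"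
  have det: "?p' * Complex (A$1$2) (A$2$2) - ?q' * p = 2 * \<i>"
    using A by (simp add: p_def complex_eq_iff det_2 algebra_simps)
  have "(?p' * x + ?q') * E - (?p' * z + ?q') * (E + p * h)
      = h * (?p' * Complex (A$1$2) (A$2$2) - ?q' * p)"
    by (simp add: x_def E_def cayley_factor_def p_def algebra_simps)
  also have "\<dots> = v * (E + p * h) * E"
    unfolding det using den0 by (simp add: h_def field_simps power2_eq_square)
  finally have eq: "(?p' * x + ?q') * E - (?p' * z + ?q') * (E + p * h) = v * (E + p * h) * E" .
  have "(?p' * x + ?q') / (E + p * h) - (?p' * z + ?q') / E = v * (E + p * h) * E / ((E + p * h) * E)"
    by (simp only: diff_frac_eq[OF Ex0 E] eq)
  also have "\<dots> = v" using E Ex0 by simp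
  finally have "(?p' * x + ?q') / (E + p * h) - (?p' * z + ?q') / E = v" .
  then have "cayley (mobius A x) - cayley (mobius A z) = v"
    unfolding cay[OF xH] cay[OF z] Ex E_def[symmetric] .
  then show thesis using that[OF x] by (simp add: v_def)
qed

section \<open>Convergence, weight and poles of the series\<close>

context triangle_setting
begin

text \<open>Translates of a small disc around z are disjoint because z has trivial stabiliser up to
  sign. Their Cayley images lie in the unit disc and contain discs of radius \<kappa> /
  |cayley_factor|^2, so the squares of these radii have sum at most 1. As A and -A give the same
  translate, at most one of them may occur.\<close>

lemma summable_cayley_factor_aux:
  assumes S: "S \<subseteq> \<Gamma>" "\<And>A. A \<in> S \<Longrightarrow> - A \<notin> S" and z: "z \<in> regular"
  shows "(\<lambda>A. 1 / norm (cayley_factor A z) ^ 4) summable_on S"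
proof -
  have zH: "z \<in> \<H>" using z by (rule regularD)
  obtain r where r: "r > 0" "cball z r \<subseteq> \<H>"
    "\<And>A x. A \<in> \<Gamma> \<Longrightarrow> x \<in> ball z r \<Longrightarrow> mobius A x \<in> ball z r \<Longrightarrow> mobius A z = z"
    using proper_separation[OF zH zH] by metis
  define \<kappa> where "\<kappa> = min r (Im z)"
  have \<kappa>: "\<kappa> > 0" using r(1) upper_half_planeD[OF zH] by (simp add: \<kappa>_def)
  define \<rho> where "\<rho> = (\<lambda>A. \<kappa> / (norm (cayley_factor A z))\<^sup>2)"
  define m where "m = (\<lambda>A. cayley (mobius A z))"
  have rH: "ball z r \<subseteq> \<H>" using r(2) ball_subset_cball by blast
  have cover: "\<exists>x\<in>ball z r. cayley (mobius A x) = u" if "A \<in> \<Gamma>" "u \<in> ball (m A) (\<rho> A)" for A u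
    using cayley_mobius_covers_ball[OF det_eq_1[OF that(1)] zH rH] that(2)
    unfolding m_def \<rho>_def \<kappa>_def by metis
  have bound: "(\<Sum>A\<in>F. 1 / norm (cayley_factor A z) ^ 4) \<le> 1 / \<kappa>\<^sup>2" if F: "finite F" "F \<subseteq> S" for F
  proof -
    have "(\<Sum>A\<in>F. (\<rho> A)\<^sup>2) \<le> 1"
    proof (rule sum_squares_disjoint_balls[where m = m, OF F(1)])
      show "\<rho> A \<ge> 0" for A using \<kappa> by (simp add: \<rho>_def)
      show "ball (m A) (\<rho> A) \<subseteq> ball 0 1" if "A \<in> F" for A
      proof
        fix u assume u: "u \<in> ball (m A) (\<rho> A)"
        have A: "A \<in> \<Gamma>" using that F S by blast
        from cover[OF A u] obtain x where x: "x \<in> ball z r" "cayley (mobius A x) = u" by blast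
        then have "mobius A x \<in> \<H>" using mobius_closed[OF A] rH by blast
        from cayley_in_disc[OF this] show "u \<in> ball 0 1" using x by simp
      qed
      show "ball (m A) (\<rho> A) \<inter> ball (m B) (\<rho> B) = {}" if AB: "A \<in> F" "B \<in> F" "A \<noteq> B" for A B
      proof (rule ccontr)
        assume "\<not> ?thesis"
        then obtain u where u: "u \<in> ball (m A) (\<rho> A)" "u \<in> ball (m B) (\<rho> B)" by blast
        have A: "A \<in> \<Gamma>" and B: "B \<in> \<Gamma>" using AB F S by blast+
        obtain x y where x: "x \<in> ball z r" "cayley (mobius A x) = u"
          and y: "y \<in> ball z r" "cayley (mobius B y) = u" using cover[OF A u(1)] cover[OF B u(2)] by blast
        have xH: "x \<in> \<H>" and yH: "y \<in> \<H>" using x y rH by blast+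
        have eq: "mobius A x = mobius B y"
          by (rule cayley_inj) (use x y mobius_closed A B xH yH in auto)
        obtain C where C: "C \<in> \<Gamma>" "B ** C = mat 1" "C ** B = mat 1" by (rule inverse_exists[OF B])
        have CA: "C ** A \<in> \<Gamma>" using C A mult_closed by blast
        have "mobius (C ** A) x = mobius C (mobius B y)" using mobius_comp[OF C(1) A xH] eq by simp
        also have "\<dots> = y" by (rule mobius_inverse_eq[OF C(1) B C(3) yH])
        finally have "mobius (C ** A) z = z" using r(3)[OF CA x(1)] y(1) by simp
        then have "C ** A = mat 1 \<or> C ** A = - mat 1"
          using regular_stabilizer_trivial[OF z CA] by blast
        then have "B ** (C ** A) = B \<or> B ** (C ** A) = - B"
          by (auto simp: mat2_eq_iff mat2_mult_nth mat2_one_nth)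
        then have "A = B \<or> A = - B" by (simp add: matrix_mul_assoc C)
        then show False using AB F S by auto
      qed
    qed
    then have "\<kappa>\<^sup>2 * (\<Sum>A\<in>F. 1 / norm (cayley_factor A z) ^ 4) \<le> 1"
      by (simp add: \<rho>_def power_divide sum_distrib_left flip: power_mult)
    then show ?thesis using \<kappa> by (simp add: field_simps)
  qed
  have "\<forall>\<^sub>F F in finite_subsets_at_top S. (\<Sum>A\<in>F. 1 / norm (cayley_factor A z) ^ 4) \<le> 1 / \<kappa>\<^sup>2"
    using bound by (intro eventually_finite_subsets_at_top_weakI) auto
  then show ?thesis by (rule nonneg_bounded_partial_sums_imp_summable_on[rotated]) auto
qed

lemma summable_cayley_factor:
  assumes z: "z \<in> regular"
  shows "(\<lambda>A. 1 / norm (cayley_factor A z) ^ 4) summable_on \<Gamma>"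
proof -
  \<comment> \<open>At most one matrix of each pair A, -A is chosen, by the sign of the first
    nonzero entry of the lower row; that row is not zero because det A = 1.\<close>
  define S where "S = {A \<in> \<Gamma>. A$2$1 > 0 \<or> (A$2$1 = 0 \<and> A$2$2 > 0)}"
  have "(\<lambda>A. 1 / norm (cayley_factor A z) ^ 4) summable_on S"
    by (rule summable_cayley_factor_aux[OF _ _ z]) (auto simp: S_def)
  moreover have "(\<lambda>A. 1 / norm (cayley_factor A z) ^ 4) summable_on (\<Gamma> - S)"
  proof (rule summable_cayley_factor_aux[OF _ _ z])
    fix A assume A: "A \<in> \<Gamma> - S"
    show "- A \<notin> \<Gamma> - S"
    proof
      assume mA: "- A \<in> \<Gamma> - S"
      then have "A$2$1 = 0 \<and> A$2$2 = 0" using A by (auto simp: S_def)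
      then show False using det_eq_1[of A] A by (simp add: det_2)
    qed
  qed auto
  ultimately have "(\<lambda>A. 1 / norm (cayley_factor A z) ^ 4) summable_on (S \<union> (\<Gamma> - S))"
    by (rule summable_on_Un_disjoint) auto
  moreover have "S \<union> (\<Gamma> - S) = \<Gamma>" by (auto simp: S_def)
  ultimately show ?thesis by simp
qed

text \<open>
  The weight 4 Poincare series of \<open>1 / ((z - p) (z + \<i>)\<^sup>4)\<close>. Since its only poles are the points of
  the orbit of \<open>p\<close>, it separates this orbit from all others.
\<close>

definition poincare_term :: "complex \<Rightarrow> real^2^2 \<Rightarrow> complex \<Rightarrow> complex" where
  "poincare_term p A z = 1 / ((mobius A z - p) * cayley_factor A z ^ 4)"

definition poincare :: "complex \<Rightarrow> complex \<Rightarrow> complex" where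
  "poincare p z = (\<Sum>\<^sub>\<infinity>A\<in>\<Gamma>. poincare_term p A z)"

definition polar_part :: "complex \<Rightarrow> complex \<Rightarrow> complex \<Rightarrow> complex" where
  "polar_part p z x = (\<Sum>A | A \<in> \<Gamma> \<and> mobius A z = p. poincare_term p A x)"

text \<open>Right multiplication by B permutes \<Gamma>, and the cocycle relation of the automorphy
  factor supplies the weight. The two rules for infinite sums used here hold without regard to
  convergence, so the identity also covers the poles.\<close>

lemma poincare_mobius:
  assumes B: "B \<in> \<Gamma>" and z: "z \<in> \<H>"
  shows "poincare p (mobius B z) = autom_factor B z ^ 4 * poincare p z"
proof -
  have jB: "autom_factor B z \<noteq> 0" using B z by (rule autom_factor_neq_0)
  have term_eq: "poincare_term p A (mobius B z) = autom_factor B z ^ 4 * poincare_term p (A ** B) z"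
    if A: "A \<in> \<Gamma>" for A
  proof -
    have "cayley_factor (A ** B) z = (mobius A (mobius B z) + \<i>) * (autom_factor A (mobius B z) * autom_factor B z)"
      by (simp add: cayley_factor_eq det_eq_1 mult_closed A B z mobius_comp autom_factor_comp)
    also have "\<dots> = cayley_factor A (mobius B z) * autom_factor B z"
      by (simp add: cayley_factor_eq det_eq_1 mobius_closed A B z)
    finally have "cayley_factor (A ** B) z = cayley_factor A (mobius B z) * autom_factor B z" .
    then show ?thesis using jB by (simp add: poincare_term_def mobius_comp A B z power_mult_distrib)
  qed
  obtain C where C: "C \<in> \<Gamma>" "B ** C = mat 1" "C ** B = mat 1" by (rule inverse_exists[OF B])
  have bij: "bij_betw (\<lambda>A. A ** B) \<Gamma> \<Gamma>"
    by (rule bij_betw_byWitness[where f' = "\<lambda>A. A ** C"])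
      (use B C mult_closed in \<open>auto simp flip: matrix_mul_assoc\<close>)
  have "poincare p (mobius B z) = (\<Sum>\<^sub>\<infinity>A\<in>\<Gamma>. autom_factor B z ^ 4 * poincare_term p (A ** B) z)"
    unfolding poincare_def by (rule infsum_cong) (rule term_eq)
  also have "\<dots> = autom_factor B z ^ 4 * (\<Sum>\<^sub>\<infinity>A\<in>\<Gamma>. poincare_term p (A ** B) z)"
    by (rule infsum_cmult_right')
  also have "(\<Sum>\<^sub>\<infinity>A\<in>\<Gamma>. poincare_term p (A ** B) z) = poincare p z"
    unfolding poincare_def by (rule infsum_reindex_bij_betw[OF bij])
  finally show ?thesis .
qed

lemma poincare_term_meromorphic:
  assumes "A \<in> \<Gamma>"
  shows "poincare_term p A meromorphic_on \<H>"
proof -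
  have "cayley_factor A analytic_on \<H>"
    unfolding cayley_factor_def[abs_def] by (intro analytic_intros)
  then show ?thesis unfolding poincare_term_def[abs_def]
    by (intro meromorphic_intros analytic_on_imp_meromorphic_on analytic_mobius assms)
qed

text \<open>Only finitely many elements send z to p. All others map a neighbourhood of z into the
  complement of a fixed ball around p, so their terms are bounded by multiples of 1 /
  |cayley_factor|^4 and the Weierstrass test applies to them.\<close>

lemma poincare_local:
  assumes p: "p \<in> \<H>" and z: "z \<in> \<H>"
  obtains r h where "r > 0" "h holomorphic_on ball z r" "finite {A \<in> \<Gamma>. mobius A z = p}"
    "\<forall>x\<in>ball z r. poincare p x = polar_part p z x + h x"
proof -
  \<comment> \<open>The area argument works at regular points only;
    \<open>cayley_factor_ratio\<close> transfers its majorant from w0 to the points near z.\<close>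
  obtain w0 where w0: "w0 \<in> regular"
    using regular_eventually[OF p] by (metis at_neq_bot eventually_happens')
  define F where "F = {A \<in> \<Gamma>. mobius A z = p}"
  have F: "finite F" unfolding F_def
    by (rule finite_subset[OF _ finite_proper[of "{z}" "{p}"]]) (use p z in auto)
  obtain r0 where r0: "r0 > 0" "cball z r0 \<subseteq> \<H>"
    "\<And>A x. A \<in> \<Gamma> \<Longrightarrow> x \<in> ball z r0 \<Longrightarrow> mobius A x \<in> ball p r0 \<Longrightarrow> mobius A z = p"
    using proper_separation[OF z p] by metis
  define r where "r = r0 / 2"
  have r: "r > 0" "cball z r \<subseteq> ball z r0" using r0(1) by (auto simp: r_def)
  have rH: "cball z r \<subseteq> \<H>" using r(2) r0(2) ball_subset_cball by blast
  obtain \<delta> M where b: "\<delta> > 0" "\<And>x. x \<in> cball z r \<Longrightarrow> \<delta> \<le> Im x" "\<And>x. x \<in> cball z r \<Longrightarrow> norm x \<le> M"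
    using compact_upper_half_plane_bounds[OF compact_cball rH] by metis
  define K where "K = 1 + (norm w0 + M) / \<delta>"
  have M0: "M \<ge> 0" using b(3)[of z] r(1) norm_ge_zero order_trans by (metis centre_in_cball less_imp_le)
  have K: "K > 0" using M0 b(1) by (simp add: K_def add_pos_nonneg)
  have est: "norm (poincare_term p A x) \<le> K ^ 4 / r0 * (1 / norm (cayley_factor A w0) ^ 4)"
    if A: "A \<in> \<Gamma> - F" and x: "x \<in> cball z r" for A x
  proof -
    have xH: "x \<in> \<H>" using x rH by blast
    have "mobius A x \<notin> ball p r0" using r0(3)[of A x] A x r(2) by (auto simp: F_def)
    then have d: "r0 \<le> norm (mobius A x - p)" by (simp add: dist_norm norm_minus_commute)
    have "norm (w0 - x) / Im x \<le> (norm w0 + M) / \<delta>"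
      using b x M0 by (intro frac_le order_trans[OF norm_triangle_ineq4] add_left_mono) auto
    then have "1 + norm (w0 - x) / Im x \<le> K" by (simp add: K_def)
    then have "(1 + norm (w0 - x) / Im x) * norm (cayley_factor A x) \<le> K * norm (cayley_factor A x)"
      by (rule mult_right_mono) simp
    moreover have dA: "det A = 1" using A det_eq_1 by blast
    ultimately have ratio: "norm (cayley_factor A w0) \<le> K * norm (cayley_factor A x)"
      using cayley_factor_ratio[OF _ xH, of A w0] by linarith
    have nz: "norm (cayley_factor A w0) > 0" "norm (cayley_factor A x) > 0"
      using cayley_factor_nonzero[OF dA] xH regularD(1)[OF w0] by auto
    have le: "r0 * norm (cayley_factor A w0) ^ 4 \<le> norm (mobius A x - p) * (K * norm (cayley_factor A x)) ^ 4"
      using d ratio r0(1) by (intro mult_mono power_mono) auto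
    have "norm (poincare_term p A x) = 1 / (norm (mobius A x - p) * norm (cayley_factor A x) ^ 4)"
      by (simp add: poincare_term_def norm_divide norm_mult norm_power)
    also have "\<dots> = K ^ 4 / (norm (mobius A x - p) * (K * norm (cayley_factor A x)) ^ 4)"
      using K by (simp add: power_mult_distrib)
    also have "\<dots> \<le> K ^ 4 / (r0 * norm (cayley_factor A w0) ^ 4)"
      using le nz K r0(1) d by (intro divide_left_mono mult_pos_pos zero_less_power) auto
    finally show ?thesis by simp
  qed
  define h where "h = (\<lambda>x. \<Sum>\<^sub>\<infinity>A\<in>\<Gamma> - F. poincare_term p A x)"
  have "(\<lambda>A. 1 / norm (cayley_factor A w0) ^ 4) summable_on (\<Gamma> - F)"
    by (rule summable_on_subset_banach[OF summable_cayley_factor[OF w0]]) auto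
  then have summ: "(\<lambda>A. K ^ 4 / r0 * (1 / norm (cayley_factor A w0) ^ 4)) summable_on (\<Gamma> - F)"
    by (rule summable_on_cmult_right)
  have unif: "uniform_limit (cball z r) (\<lambda>X x. \<Sum>A\<in>X. poincare_term p A x) h (finite_subsets_at_top (\<Gamma> - F))"
    unfolding h_def by (rule Weierstrass_m_test_general[OF est summ])
  have hol: "poincare_term p A holomorphic_on cball z r" if A: "A \<in> \<Gamma> - F" for A
    unfolding poincare_term_def[abs_def]
  proof (intro holomorphic_intros holomorphic_on_subset[OF mobius_holomorphic rH])
    show "cayley_factor A holomorphic_on cball z r"
      unfolding cayley_factor_def[abs_def] by (intro holomorphic_intros)
    show "det A = 1" using A det_eq_1 by blast
    fix x assume x: "x \<in> cball z r"
    have "mobius A x \<notin> ball p r0" using r0(3)[of A x] A x r(2) by (auto simp: F_def)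
    then have "mobius A x \<noteq> p" using r0(1) by auto
    moreover have "cayley_factor A x \<noteq> 0" using cayley_factor_nonzero[OF det_eq_1] A x rH by blast
    ultimately show "(mobius A x - p) * cayley_factor A x ^ 4 \<noteq> 0" by simp
  qed
  have h_hol: "h holomorphic_on ball z r"
  proof (rule holomorphic_uniform_limit[OF _ unif])
    show "\<forall>\<^sub>F X in finite_subsets_at_top (\<Gamma> - F). continuous_on (cball z r) (\<lambda>x. \<Sum>A\<in>X. poincare_term p A x)
        \<and> (\<lambda>x. \<Sum>A\<in>X. poincare_term p A x) holomorphic_on ball z r"
    proof (rule eventually_finite_subsets_at_top_weakI)
      fix X assume "finite X" "X \<subseteq> \<Gamma> - F"
      then have "(\<lambda>x. \<Sum>A\<in>X. poincare_term p A x) holomorphic_on cball z r"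
        using hol by (intro holomorphic_intros) blast
      then show "continuous_on (cball z r) (\<lambda>x. \<Sum>A\<in>X. poincare_term p A x)
        \<and> (\<lambda>x. \<Sum>A\<in>X. poincare_term p A x) holomorphic_on ball z r"
        using holomorphic_on_imp_continuous_on holomorphic_on_subset ball_subset_cball by blast
    qed
  qed auto
  show thesis
  proof (rule that[OF r(1) h_hol])
    show "finite {A \<in> \<Gamma>. mobius A z = p}" using F by (simp add: F_def polar_part_def)
    show "\<forall>x\<in>ball z r. poincare p x = polar_part p z x + h x"
    proof
      fix x assume x: "x \<in> ball z r"
      have "(\<lambda>A. norm (poincare_term p A x)) summable_on (\<Gamma> - F)"
        using x by (intro Infinite_Sum.abs_summable_on_comparison_test'[OF summ] est) auto
      then have s: "(\<lambda>A. poincare_term p A x) summable_on (\<Gamma> - F)" by (rule abs_summable_summable)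
      have "poincare p x = (\<Sum>\<^sub>\<infinity>A\<in>F \<union> (\<Gamma> - F). poincare_term p A x)"
        unfolding poincare_def by (rule arg_cong[where f = "infsum _"]) (auto simp: F_def)
      also have "\<dots> = (\<Sum>\<^sub>\<infinity>A\<in>F. poincare_term p A x) + h x"
        unfolding h_def by (rule infsum_Un_disjoint[OF summable_on_finite[OF F] s]) auto
      finally show "poincare p x = polar_part p z x + h x"
        using F by (simp add: F_def polar_part_def)
    qed
  qed
qed

lemma poincare_meromorphic:
  assumes p: "p \<in> \<H>"
  shows "poincare p meromorphic_on \<H>"
proof (subst meromorphic_on_meromorphic_at, rule ballI)
  fix z assume z: "z \<in> \<H>"
  obtain r h where r: "r > 0" "h holomorphic_on ball z r" "finite {A \<in> \<Gamma>. mobius A z = p}"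
    "\<forall>x\<in>ball z r. poincare p x = polar_part p z x + h x"
    using poincare_local[OF p z] by blast
  have "h analytic_on {z}" using r(1,2) by (auto simp: analytic_on_def)
  moreover have "poincare_term p A meromorphic_on {z}" if "A \<in> \<Gamma>" for A
    using poincare_term_meromorphic[OF that] z meromorphic_on_subset by blast
  ultimately have "(\<lambda>x. polar_part p z x + h x) meromorphic_on {z}"
    unfolding polar_part_def by (intro meromorphic_intros) (auto intro: analytic_on_imp_meromorphic_on)
  moreover have "\<forall>\<^sub>F x in at z. polar_part p z x + h x = poincare p x"
    using eventually_at_in_open'[OF open_ball, of z z r] r(1) by (auto elim!: eventually_mono simp: r(4))
  ultimately show "poincare p meromorphic_on {z}"
    using meromorphic_on_cong[of "{z}" "\<lambda>x. polar_part p z x + h x"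
      "poincare p" "{z}"] by simp
qed

lemma poincare_analytic:
  assumes p: "p \<in> \<H>" and z: "z \<in> \<H>" and "\<not> same_orbit \<Gamma> z p"
  shows "poincare p analytic_on {z}"
proof -
  obtain r h where r: "r > 0" "h holomorphic_on ball z r" "finite {A \<in> \<Gamma>. mobius A z = p}"
    "\<forall>x\<in>ball z r. poincare p x = polar_part p z x + h x"
    using poincare_local[OF p z] by blast
  have "{A \<in> \<Gamma>. mobius A z = p} = {}" using assms(3) by (auto simp: same_orbit_def)
  then have "poincare p x = h x" if "x \<in> ball z r" for x
    using bspec[OF r(4) that] by (simp only: polar_part_def sum.empty add_0_left)
  then have "poincare p holomorphic_on ball z r"
    using holomorphic_cong[OF refl, of "ball z r" "poincare p" h] r(2) by blast
  then show ?thesis using r(1) by (auto simp: analytic_on_def)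
qed

text \<open>The stabiliser of a regular p contains at most the identity and its negative. Both have
  the same term because the weight is even, so the singular terms cannot cancel.\<close>

lemma poincare_pole:
  assumes p: "p \<in> regular"
  shows "is_pole (poincare p) p"
proof -
  have pH: "p \<in> \<H>" using p by (rule regularD)
  obtain r h where r: "r > 0" "h holomorphic_on ball p r" "finite {A \<in> \<Gamma>. mobius A p = p}"
    "\<forall>x\<in>ball p r. poincare p x = polar_part p p x + h x"
    using poincare_local[OF pH pH] by blast
  define F where "F = {A \<in> \<Gamma>. mobius A p = p}"
  have F: "finite F" "mat 1 \<in> F" "\<And>A. A \<in> F \<Longrightarrow> A = mat 1 \<or> A = - mat 1"
    using r(3) regular_stabilizer_trivial[OF p] one_closed by (auto simp: F_def mobius_one)
  have N: "card F \<noteq> 0" using F by auto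
  have cf1: "cayley_factor (mat 1) x = x + \<i>" for x
    by (simp add: cayley_factor_def mat2_one_nth complex_eq_iff)
  have cfm: "cayley_factor (- mat 1) x = - (x + \<i>)" for x
    by (simp add: cayley_factor_def mat2_one_nth complex_eq_iff)
  have term_eq: "poincare_term p A x = 1 / ((x - p) * (x + \<i>) ^ 4)" if "A \<in> F" for A x
    using F(3)[OF that]
  proof
    assume "A = - mat 1"
    then show ?thesis unfolding poincare_term_def by (simp only: cfm mobius_uminus mobius_one power_minus_even even_numeral)
  qed (simp only: poincare_term_def cf1 mobius_one)
  have "is_pole (\<lambda>x. (of_nat (card F) / (x + \<i>) ^ 4) / (x - p)) p"
    unfolding is_pole_def
  proof (rule filterlim_divide_at_infinity)
    have "p + \<i> \<noteq> 0" using pH by (auto simp: upper_half_plane_def complex_eq_iff)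
    then show "((\<lambda>x. of_nat (card F) / (x + \<i>) ^ 4) \<longlongrightarrow> of_nat (card F) / (p + \<i>) ^ 4) (at p)"
      by (intro tendsto_intros) auto
    show "of_nat (card F) / (p + \<i>) ^ 4 \<noteq> 0" using N \<open>p + \<i> \<noteq> 0\<close> by simp
    show "filterlim (\<lambda>x. x - p) (at 0) (at p)"
      by (auto simp: filterlim_at eventually_at_filter intro!: tendsto_eq_intros)
  qed
  moreover have "(h \<longlongrightarrow> h p) (at p)"
    using r(1,2) holomorphic_on_imp_continuous_on[OF r(2)]
    by (metis centre_in_ball continuous_on_eq_continuous_at isContD open_ball)
  ultimately have "filterlim (\<lambda>x. (of_nat (card F) / (x + \<i>) ^ 4) / (x - p) + h x) at_infinity (at p)"
    unfolding is_pole_def by (rule tendsto_add_filterlim_at_infinity')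
  then have "is_pole (\<lambda>x. (of_nat (card F) / (x + \<i>) ^ 4) / (x - p) + h x) p" by (simp add: is_pole_def)
  moreover have "\<forall>\<^sub>F x in at p. poincare p x = (of_nat (card F) / (x + \<i>) ^ 4) / (x - p) + h x"
  proof -
    have "\<forall>\<^sub>F x in at p. x \<in> ball p r" by (rule eventually_at_in_open') (use r(1) in auto)
    then show ?thesis
    proof eventually_elim
      case (elim x)
      have "(\<Sum>A\<in>F. poincare_term p A x) = of_nat (card F) / (x + \<i>) ^ 4 / (x - p)"
        using term_eq[of _ x] by (simp add: mult.commute)
      then show ?case using bspec[OF r(4) elim] by (simp add: F_def polar_part_def)
    qed
  qed
  ultimately show ?thesis using is_pole_cong by fastforce
qed

end

section \<open>Injectivity and surjectivity of the Hauptmodul\<close>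

text \<open>A meromorphic function has either a finite limit or a pole at v, and its values along
  any nontrivial approach to v decide which, and the limit.\<close>

lemma tendsto_if_tendsto_compose:
  fixes G :: "complex \<Rightarrow> complex"
  assumes "G meromorphic_on {v}" "filterlim g (at v) F" "F \<noteq> bot" "((\<lambda>x. G (g x)) \<longlongrightarrow> L) F"
  shows "(G \<longlongrightarrow> L) (at v)"
proof -
  have "not_essential G v" using assms(1) by (simp add: meromorphic_at_iff)
  then consider L' where "(G \<longlongrightarrow> L') (at v)" | "is_pole G v" unfolding not_essential_def by blast
  then show ?thesis
  proof cases
    case 1
    from filterlim_compose[OF this assms(2)] have "L' = L"
      using tendsto_unique[OF assms(3) _ assms(4)] by blast
    with 1 show ?thesis by simp
  next
    case 2
    from filterlim_compose[OF this[unfolded is_pole_def] assms(2)] show ?thesis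
      using not_tendsto_and_filterlim_at_infinity[OF assms(3,4)] by blast
  qed
qed

context triangle_setting
begin

section \<open>Automorphic functions as rational functions of the Hauptmodul\<close>

lemma eventually_t_neq: "z \<in> \<H> \<Longrightarrow> \<forall>\<^sub>F x in at z. t x \<noteq> v"
  using t_nonconstant by (rule eventually_cosparse_imp_eventually_at)

lemma t_filterlim_at: "z \<in> \<H> \<Longrightarrow> \<not> is_pole t z \<Longrightarrow> filterlim t (at (t z)) (at z)"
  using t_tendsto eventually_t_neq by (simp add: filterlim_at)

lemma remove_sings_mobius:
  assumes "\<And>A z. A \<in> \<Gamma> \<Longrightarrow> z \<in> regular \<Longrightarrow> f (mobius A z) = f z"
    and A: "A \<in> \<Gamma>" and z: "z \<in> \<H>"
  shows "remove_sings f (mobius A z) = remove_sings f z"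
proof -
  have "remove_sings f (mobius A z) = remove_sings (f \<circ> mobius A) z"
    by (rule remove_sings_compose[OF filtermap_mobius[OF A z], symmetric])
  also have "\<dots> = remove_sings f z"
  proof (rule remove_sings_cong)
    show "\<forall>\<^sub>F x in at z. (f \<circ> mobius A) x = f x"
      using regular_eventually[OF z] by eventually_elim (simp add: assms(1)[OF A])
  qed simp
  finally show ?thesis .
qed

text \<open>\<open>hauptmodul\<close> speaks of functions with normalised values at their
  singularities. \<open>remove_sings\<close> provides this normalisation, so that meromorphy and
  invariance at regular points are enough.\<close>

lemma automorphic_rational:
  assumes "f meromorphic_on \<H>"
    and inv: "\<And>A z. A \<in> \<Gamma> \<Longrightarrow> z \<in> regular \<Longrightarrow> f (mobius A z) = f z"
  obtains p q :: "complex poly" where "q \<noteq> 0"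
    "\<forall>\<^sub>\<approx>z\<in>\<H>. f z = poly p (t z) / poly q (t z)"
proof -
  have "automorphic_function \<Gamma> (remove_sings f)"
    unfolding automorphic_function_def
    using remove_sings_nicely_meromorphic[OF assms(1)] remove_sings_mobius[OF inv] by blast
  then obtain p q :: "complex poly" where pq: "q \<noteq> 0"
    "\<forall>\<^sub>\<approx>z\<in>\<H>. remove_sings f z = poly p (t z) / poly q (t z)"
    using hauptmodul unfolding hauptmodul_def by blast
  have "\<forall>\<^sub>\<approx>z\<in>\<H>. f z = poly p (t z) / poly q (t z)"
    using pq(2) eventually_remove_sings_eq[OF assms(1)] by eventually_elim simp
  with pq(1) show thesis by (rule that)
qed

lemma t_has_derivative: "z \<in> regular \<Longrightarrow> (t has_field_derivative deriv t z) (at z)"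
  using t_holomorphic_regular open_regular by (simp add: holomorphic_derivI)

lemma isCont_deriv_t:
  assumes "z \<in> regular"
  shows "isCont (deriv t) z"
  by (intro analytic_at_imp_isCont analytic_deriv t_analytic regularD[OF assms])

lemma deriv_t_mobius:
  assumes A: "A \<in> \<Gamma>" and z: "z \<in> regular"
  shows "deriv t (mobius A z) = (autom_factor A z)\<^sup>2 * deriv t z"
proof -
  have zH: "z \<in> \<H>" using z by (rule regularD)
  have "((\<lambda>x. t (mobius A x)) has_field_derivative deriv t (mobius A z) * (1 / (autom_factor A z)\<^sup>2)) (at z)"
    by (rule DERIV_chain2[OF t_has_derivative[OF regular_mobius[OF A z]]
        has_field_derivative_mobius[OF det_eq_1[OF A] zH]])
  moreover have "((\<lambda>x. t (mobius A x)) has_field_derivative deriv t z) (at z)"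
    by (rule has_field_derivative_transform_within_open[OF t_has_derivative[OF z] open_upper_half_plane zH])
      (simp add: t_invariant A)
  ultimately have "deriv t (mobius A z) * (1 / (autom_factor A z)\<^sup>2) = deriv t z" by (rule DERIV_unique)
  then show ?thesis using autom_factor_neq_0[OF A zH] by (simp add: field_simps)
qed

lemma deriv_t_nonzero_eventually:
  assumes "z \<in> \<H>"
  shows "\<forall>\<^sub>F x in at z. deriv t x \<noteq> 0"
proof -
  have "\<not> (\<forall>\<^sub>\<approx>z\<in>\<H>. deriv t z = 0)"
  proof
    assume 0: "\<forall>\<^sub>\<approx>z\<in>\<H>. deriv t z = 0"
    obtain w where w: "w \<in> regular"
      using regular_eventually[OF assms] by (metis at_neq_bot eventually_happens')
    obtain r where r: "r > 0" "ball w r \<subseteq> regular" using openE[OF open_regular w] by blast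
    have "deriv t x = 0" if x: "x \<in> regular" for x
    proof -
      have "(deriv t \<longlongrightarrow> deriv t x) (at x)" using isCont_deriv_t[OF x] by (simp add: isCont_def)
      moreover have "\<forall>\<^sub>F y in at x. deriv t y = 0"
        using 0 regularD(1)[OF x] by (rule eventually_cosparse_imp_eventually_at)
      then have "(deriv t \<longlongrightarrow> 0) (at x)" by (rule tendsto_eventually)
      ultimately show ?thesis using LIM_unique by blast
    qed
    then have "(t has_field_derivative 0) (at x within ball w r)" if "x \<in> ball w r" for x
      using t_has_derivative[of x] that r(2) by (metis subsetD has_field_derivative_at_within)
    then obtain c where c: "\<And>x. x \<in> ball w r \<Longrightarrow> t x = c"
      using has_field_derivative_zero_constant[OF convex_ball, of w r t] by blast
    have "\<forall>\<^sub>F x in at w. x \<in> ball w r" by (rule eventually_at_in_open') (use r in auto)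
    then have "\<forall>\<^sub>F x in at w. False"
      using eventually_t_neq[OF regularD(1)[OF w], of c] by eventually_elim (use c in blast)
    then show False by simp
  qed
  then have "\<forall>\<^sub>\<approx>z\<in>\<H>. deriv t z \<noteq> 0"
    using meromorphic_imp_constant_or_avoid[OF meromorphic_on_deriv[OF t_meromorphic]
        open_upper_half_plane connected_upper_half_plane] by blast
  then show ?thesis using assms by (rule eventually_cosparse_imp_eventually_at)
qed

text \<open>Eventually the same set as \<open>regular\<close>, by \<open>deriv_t_nonzero\<close>;
  that lemma rests on ramification, which in turn uses injectivity on this set.\<close>

definition generic :: "complex set" where
  "generic = {z \<in> regular. deriv t z \<noteq> 0}"

lemma generic_eventually: "z \<in> \<H> \<Longrightarrow> \<forall>\<^sub>F x in at z. x \<in> generic"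
  using eventually_conj[OF regular_eventually deriv_t_nonzero_eventually] by (simp add: generic_def)

text \<open>The Poincare series with poles on the orbit of z, divided by the square of t', is a
  rational function R of \<open>t\<close>. Approaching from w shows that R has a finite limit at t
  w; if t z = t w, approaching from z shows that R is unbounded there.\<close>

lemma generic_injective:
  assumes z: "z \<in> generic" and w: "w \<in> generic" and eq: "t z = t w"
  shows "same_orbit \<Gamma> z w"
proof (rule ccontr)
  assume ns: "\<not> same_orbit \<Gamma> z w"
  have zr: "z \<in> regular" "deriv t z \<noteq> 0" and wr: "w \<in> regular" "deriv t w \<noteq> 0"
    using z w by (auto simp: generic_def)
  note zH = regularD(1)[OF zr(1)] and wH = regularD(1)[OF wr(1)]
  have ns': "\<not> same_orbit \<Gamma> w z" using ns same_orbit_sym[OF wH] by blast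
  define F where "F = (\<lambda>x. inverse ((deriv t x)\<^sup>2) * poincare z x)"
  have F_mero: "F meromorphic_on \<H>"
    unfolding F_def by (intro meromorphic_intros t_meromorphic poincare_meromorphic zH)
  have F_inv: "F (mobius A x) = F x" if A: "A \<in> \<Gamma>" and x: "x \<in> regular" for A x
    using autom_factor_neq_0[OF A regularD(1)[OF x]]
    by (simp add: F_def deriv_t_mobius[OF A x] poincare_mobius[OF A regularD(1)[OF x]]
        power_mult_distrib field_simps)
  obtain p q :: "complex poly" where pq: "q \<noteq> 0"
    "\<forall>\<^sub>\<approx>x\<in>\<H>. F x = poly p (t x) / poly q (t x)"
    by (rule automorphic_rational[OF F_mero F_inv])
  define R where "R = (\<lambda>x. poly p x / poly q x)"
  have FR: "\<forall>\<^sub>F x in at y. F x = R (t x)" if "y \<in> \<H>" for y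
    using eventually_cosparse_imp_eventually_at[OF pq(2) that] by (simp add: R_def)
  have dt: "((\<lambda>x. inverse ((deriv t x)\<^sup>2)) \<longlongrightarrow> inverse ((deriv t y)\<^sup>2)) (at y)" if "y \<in> generic" for y
  proof -
    have y: "y \<in> regular" "deriv t y \<noteq> 0" using that by (auto simp: generic_def)
    have "(deriv t \<longlongrightarrow> deriv t y) (at y)" using isCont_deriv_t[OF y(1)] by (simp add: isCont_def)
    then show ?thesis using y by (intro tendsto_intros) auto
  qed
  have "filterlim F at_infinity (at z)"
    unfolding F_def using poincare_pole[OF zr(1)] zr(2)
    by (intro tendsto_mult_filterlim_at_infinity[OF dt[OF z]]) (auto simp: is_pole_def)
  then have pole: "filterlim (\<lambda>x. R (t x)) at_infinity (at z)"
    using filterlim_cong[OF refl refl FR[OF zH]] by blast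
  have "(poincare z \<longlongrightarrow> poincare z w) (at w)"
    using poincare_analytic[OF zH wH ns'] analytic_at_imp_isCont isContD by blast
  then have "(F \<longlongrightarrow> inverse ((deriv t w)\<^sup>2) * poincare z w) (at w)"
    unfolding F_def by (intro tendsto_mult dt w)
  then have lim: "((\<lambda>x. R (t x)) \<longlongrightarrow> inverse ((deriv t w)\<^sup>2) * poincare z w) (at w)"
    using filterlim_cong[OF refl refl FR[OF wH]] by blast
  have "(R \<longlongrightarrow> inverse ((deriv t w)\<^sup>2) * poincare z w) (at (t w))"
    by (rule tendsto_if_tendsto_compose[OF _ t_filterlim_at[OF wH regularD(2)[OF wr(1)]] at_neq_bot lim])
      (simp add: R_def meromorphic_poly_fraction)
  then have "((\<lambda>x. R (t x)) \<longlongrightarrow> inverse ((deriv t w)\<^sup>2) * poincare z w) (at z)"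
    using t_filterlim_at[OF zH regularD(2)[OF zr(1)]] unfolding eq by (rule filterlim_compose)
  then show False using pole not_tendsto_and_filterlim_at_infinity[OF at_neq_bot] by blast
qed

text \<open>
  A pair of inequivalent points with the same value would, by the open mapping theorem, come
  with inequivalent generic points having a common value.
\<close>

lemma injective_aux:
  assumes z: "z \<in> \<H>" and w: "w \<in> \<H>"
    and f: "f analytic_on {z}" "f analytic_on {w}" "f z = f w"
      "\<not> (\<forall>\<^sub>F x in at z. f x = f z)" "\<not> (\<forall>\<^sub>F x in at w. f x = f w)"
    and inj: "\<And>x y. x \<in> generic \<Longrightarrow> y \<in> generic \<Longrightarrow> f x = f y \<Longrightarrow> t x = t y"
  shows "same_orbit \<Gamma> z w"
proof (rule ccontr)
  assume ns: "\<not> same_orbit \<Gamma> z w"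
  \<comment> \<open>No element of \<Gamma> links these neighbourhoods of z and w, so equivalent
    generic points in them are impossible.\<close>
  obtain r where r: "r > 0"
    "\<And>A x. A \<in> \<Gamma> \<Longrightarrow> x \<in> ball z r \<Longrightarrow> mobius A x \<in> ball w r \<Longrightarrow> mobius A z = w"
    using proper_separation[OF z w] by metis
  have ev: "\<forall>\<^sub>F x in at y. x \<in> generic \<and> x \<in> ball y r" if "y \<in> \<H>" for y
    using generic_eventually[OF that] eventually_at_in_open'[OF open_ball, of y y r] r(1)
    by (auto elim: eventually_elim2)
  have "\<forall>\<^sub>F u in at (f w). \<exists>x. (x \<in> generic \<and> x \<in> ball z r) \<and> f x = u"
    using eventually_at_image_analytic[OF f(1,4) ev[OF z]] by (simp add: f(3))
  moreover have "\<forall>\<^sub>F u in at (f w). \<exists>x. (x \<in> generic \<and> x \<in> ball w r) \<and> f x = u"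
    by (rule eventually_at_image_analytic[OF f(2,5) ev[OF w]])
  ultimately have "\<forall>\<^sub>F u in at (f w). \<exists>x y. x \<in> generic \<and> x \<in> ball z r \<and> y \<in> generic \<and> y \<in> ball w r \<and> f x = f y"
    by eventually_elim metis
  then obtain x y where xy: "x \<in> generic" "x \<in> ball z r" "y \<in> generic" "y \<in> ball w r" "f x = f y"
    using eventually_happens' [OF at_neq_bot] by blast
  then have "same_orbit \<Gamma> x y" using inj generic_injective by blast
  then obtain A where "A \<in> \<Gamma>" "y = mobius A x" by (auto simp: same_orbit_def)
  then show False using r(2)[of A x] xy ns by (auto simp: same_orbit_def)
qed

lemma t_injective:
  assumes "z \<in> \<H>" "w \<in> \<H>" "\<not> is_pole t z" "\<not> is_pole t w" "t z = t w"
  shows "same_orbit \<Gamma> z w"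
proof -
  have nc: "\<not> (\<forall>\<^sub>F x in at y. t x = t y)" if y: "y \<in> \<H>" for y
  proof
    assume "\<forall>\<^sub>F x in at y. t x = t y"
    with eventually_t_neq[OF y, of "t y"] have "\<forall>\<^sub>F x in at y. False" by eventually_elim simp
    then show False by simp
  qed
  show ?thesis
    by (rule injective_aux[OF assms(1,2) t_analytic[OF assms(1,3)] t_analytic[OF assms(2,4)] assms(5)
        nc[OF assms(1)] nc[OF assms(2)]])
qed

text \<open>The default value of \<open>t\<close> at a pole is 0, and the inverse of 0 is 0; thus
  the reciprocal has the correct value 0 there and is analytic without further correction.\<close>

lemma inverse_t_at_pole:
  assumes "z \<in> \<H>" "is_pole t z"
  shows "(\<lambda>x. inverse (t x)) analytic_on {z}" "inverse (t z) = 0" "\<not> (\<forall>\<^sub>F x in at z. inverse (t x) = 0)"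
proof -
  show 0: "inverse (t z) = 0"
    using t_nicely assms not_pole_if_tendsto by (auto simp: nicely_meromorphic_on_def)
  have "((\<lambda>x. inverse (t x)) \<longlongrightarrow> 0) (at z)"
    using assms(2) unfolding is_pole_def by (rule filterlim_compose[OF tendsto_inverse_0])
  then have "\<not> is_pole (\<lambda>x. inverse (t x)) z" by (rule not_pole_if_tendsto)
  then show "(\<lambda>x. inverse (t x)) analytic_on {z}"
    using nicely_meromorphic_on_imp_analytic_at[OF nicely_meromorphic_on_inverse[OF t_nicely] assms(1)] by blast
  show "\<not> (\<forall>\<^sub>F x in at z. inverse (t x) = 0)"
  proof
    assume "\<forall>\<^sub>F x in at z. inverse (t x) = 0"
    with eventually_t_neq[OF assms(1), of 0] have "\<forall>\<^sub>F x in at z. False" by eventually_elim simp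
    then show False by simp
  qed
qed

lemma pole_same_orbit:
  assumes "z \<in> \<H>" "w \<in> \<H>" "is_pole t z" "is_pole t w"
  shows "same_orbit \<Gamma> z w"
  by (rule injective_aux[OF assms(1,2), where f = "\<lambda>x. inverse (t x)"])
    (use inverse_t_at_pole assms in auto)

lemma regular_or_elliptic:
  assumes "z \<in> \<H>"
  shows "z \<in> regular \<or> same_orbit \<Gamma> \<tau>1 z \<or> same_orbit \<Gamma> \<tau>2 z \<or> same_orbit \<Gamma> \<tau>3 z"
  using t_injective[OF tau_in(1) assms t_not_pole(1)] t_injective[OF tau_in(2) assms t_not_pole(2)]
    pole_same_orbit[OF tau_in(3) assms t_pole3] t_tau assms
  by (auto simp: regular_def)

text \<open>Compactness of the orbit space enters here: an invariant continuous function descends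
  along the quotient map to a continuous function on the sphere.\<close>

lemma invariant_attains_sup:
  fixes \<phi> :: "complex \<Rightarrow> real"
  assumes cont: "continuous_on \<H> \<phi>"
    and inv: "\<And>A z. A \<in> \<Gamma> \<Longrightarrow> z \<in> \<H> \<Longrightarrow> \<phi> (mobius A z) = \<phi> z"
  obtains z0 where "z0 \<in> \<H>" "\<And>z. z \<in> \<H> \<Longrightarrow> \<phi> z \<le> \<phi> z0"
proof -
  have "genus_zero \<Gamma>" using signature by (simp add: signature_0_3_def)
  then obtain q where
    q: "quotient_map (top_of_set \<H>) (top_of_set (sphere (0::real^3) 1)) q \<and>
        (\<forall>z\<in>\<H>. \<forall>w\<in>\<H>. q z = q w \<longleftrightarrow> same_orbit \<Gamma> z w)"
    unfolding genus_zero_def by (rule exE)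
  have img: "q ` \<H> = sphere 0 1" using q by (simp add: quotient_map_def)
  define g where "g = (\<lambda>y. \<phi> (SOME z. z \<in> \<H> \<and> q z = y))"
  have g: "g (q z) = \<phi> z" if z: "z \<in> \<H>" for z
  proof -
    let ?w = "SOME w. w \<in> \<H> \<and> q w = q z"
    have w: "?w \<in> \<H> \<and> q ?w = q z" by (rule someI[of _ z]) (use z in simp)
    then have "same_orbit \<Gamma> z ?w" using q z by metis
    then show ?thesis unfolding g_def using inv z by (auto simp: same_orbit_def)
  qed
  have "continuous_map (top_of_set \<H>) euclidean (g \<circ> q)"
    using cont g by (simp cong: continuous_on_cong)
  with q have "continuous_map (top_of_set (sphere (0::real^3) 1)) euclidean g"
    using continuous_compose_quotient_map by blast
  then have "continuous_on (sphere 0 1) g" by simp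
  moreover have "sphere (0::real^3) 1 \<noteq> {}" using img tau_in(1) by blast
  ultimately obtain y where y: "y \<in> sphere 0 1" "\<And>x. x \<in> sphere 0 1 \<Longrightarrow> g x \<le> g y"
    using continuous_attains_sup[OF compact_sphere] by metis
  obtain z0 where z0: "z0 \<in> \<H>" "y = q z0" using y(1) img by blast
  show thesis by (rule that[OF z0(1)]) (use y z0 g img in \<open>metis imageI\<close>)
qed

text \<open>If v were omitted, 1 / (t - v) would extend to an invariant holomorphic function, with
  zeros at the poles of \<open>t\<close>. Its modulus attains a maximum, so it is constant, although
  it vanishes at \<tau>3 and not at \<tau>1.\<close>

lemma t_surjective: "\<exists>z\<in>\<H>. \<not> is_pole t z \<and> t z = v"
proof (rule ccontr)
  assume contra: "\<not> ?thesis"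
  define g where "g = (\<lambda>z. inverse (t z - v))"
  define u where "u = remove_sings g"
  have g_mero: "g meromorphic_on \<H>" unfolding g_def by (intro meromorphic_intros t_meromorphic)
  have g_lim: "((\<lambda>z. inverse (t z - v)) \<longlongrightarrow> 0) (at z)" if "is_pole t z" for z
    using tendsto_add_filterlim_at_infinity'[OF that[unfolded is_pole_def] tendsto_const[of "- v"]]
    by (intro filterlim_compose[OF tendsto_inverse_0]) simp
  have u_ana: "u analytic_on {z}" if z: "z \<in> \<H>" for z
  proof -
    have iso: "isolated_singularity_at g z" using g_mero z by (simp add: meromorphic_on_altdef)
    show ?thesis
    proof (cases "is_pole t z")
      case True
      show ?thesis unfolding u_def
        by (rule remove_sings_analytic_at[OF iso, of 0]) (use g_lim[OF True] in \<open>simp add: g_def\<close>)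
    next
      case False
      then have "g analytic_on {z}" unfolding g_def using contra z
        by (intro analytic_intros t_analytic) auto
      then show ?thesis unfolding u_def by (rule remove_sings_analytic_on)
    qed
  qed
  then have "u analytic_on \<H>" by (subst analytic_on_analytic_at) blast
  then have u_hol: "u holomorphic_on \<H>" by (rule analytic_imp_holomorphic)
  have u_inv: "u (mobius A z) = u z" if "A \<in> \<Gamma>" "z \<in> \<H>" for A z
    unfolding u_def
    by (rule remove_sings_mobius[OF _ that]) (use t_invariant regularD(1) in \<open>simp add: g_def\<close>)
  obtain z0 where z0: "z0 \<in> \<H>" "\<And>z. z \<in> \<H> \<Longrightarrow> norm (u z) \<le> norm (u z0)"
  proof (rule invariant_attains_sup)
    show "continuous_on \<H> (\<lambda>z. norm (u z))"
      by (intro continuous_intros holomorphic_on_imp_continuous_on u_hol)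
  qed (use u_inv in auto)
  have "u constant_on \<H>"
    by (rule maximum_modulus_principle[OF u_hol open_upper_half_plane connected_upper_half_plane
          open_upper_half_plane order_refl z0])
  then obtain c where c: "\<And>z. z \<in> \<H> \<Longrightarrow> u z = c" unfolding constant_on_def by blast
  have "u \<tau>3 = 0" unfolding u_def
    by (rule remove_sings_eqI) (use g_lim[OF t_pole3] in \<open>simp add: g_def\<close>)
  moreover have "u \<tau>1 = inverse (t \<tau>1 - v)"
  proof -
    have "g analytic_on {\<tau>1}" unfolding g_def using contra tau_in(1) t_not_pole(1)
      by (intro analytic_intros t_analytic) auto
    then show ?thesis unfolding u_def by (simp add: g_def)
  qed
  \<comment> \<open>The constant is 0, and an inverse is 0 only at 0.\<close>
  ultimately have "t \<tau>1 = v" using c tau_in by simp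
  then show False using contra tau_in(1) t_not_pole(1) by blast
qed

end

section \<open>Ramification and polynomial automorphic functions\<close>

lemma card_image_eq_if_same_fibres:
  assumes "\<And>x y. x \<in> S \<Longrightarrow> y \<in> S \<Longrightarrow> f x = f y \<longleftrightarrow> g x = g y"
  shows "card (f ` S) = card (g ` S)"
proof -
  define h where "h = (\<lambda>y. g (SOME x. x \<in> S \<and> f x = y))"
  have h: "h (f x) = g x" if "x \<in> S" for x
  proof -
    have "(SOME x'. x' \<in> S \<and> f x' = f x) \<in> S \<and> f (SOME x'. x' \<in> S \<and> f x' = f x) = f x"
      by (rule someI[of _ x]) (use that in simp)
    then show ?thesis unfolding h_def using assms that by blast
  qed
  have "bij_betw h (f ` S) (g ` S)"
    unfolding bij_betw_def inj_on_def using h assms by (auto simp: image_iff)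
  then show ?thesis by (rule bij_betw_same_card)
qed

context triangle_setting
begin

text \<open>The function is R (t) with R rational. A pole of R at a value other than 0 and 1 would
  be seen at a regular point, as \<open>t\<close> is surjective. A pole of R at 0 would give f a
  pole of order at least e1 at \<tau>1, so the weak condition that f t tends to 0 excludes it
  although it still permits f poles of lower order; the same holds at \<tau>2. The condition at
  \<tau>3 bounds the degree.\<close>

lemma automorphic_polynomial:
  assumes mero: "f meromorphic_on \<H>"
    and inv: "\<And>A z. A \<in> \<Gamma> \<Longrightarrow> z \<in> regular \<Longrightarrow> f (mobius A z) = f z"
    and reg: "\<And>z. z \<in> regular \<Longrightarrow> \<not> is_pole f z"
    and lim1: "((\<lambda>z. f z * t z) \<longlongrightarrow> 0) (at \<tau>1)"
    and lim2: "((\<lambda>z. f z * (t z - 1)) \<longlongrightarrow> 0) (at \<tau>2)"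
    and lim3: "((\<lambda>z. f z * t z powi (- m)) \<longlongrightarrow> 0) (at \<tau>3)"
  obtains P :: "complex poly" where "P = 0 \<or> int (degree P) < m"
    "\<forall>\<^sub>\<approx>z\<in>\<H>. f z = poly P (t z)"
proof -
  obtain p q :: "complex poly" where pq: "q \<noteq> 0"
    "\<forall>\<^sub>\<approx>z\<in>\<H>. f z = poly p (t z) / poly q (t z)"
    by (rule automorphic_rational[OF mero inv])
  define R where "R = (\<lambda>x. poly p x / poly q x)"
  have R_mero: "R meromorphic_on A" for A by (simp add: R_def meromorphic_poly_fraction)
  have fR: "\<forall>\<^sub>F x in at z. f x = R (t x)" if "z \<in> \<H>" for z
    using eventually_cosparse_imp_eventually_at[OF pq(2) that] by (simp add: R_def)
  have iso: "isolated_singularity_at R v" for v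
    using R_mero[of "{v}"] by (simp add: meromorphic_at_iff)
  have "\<not> is_pole R v" for v
  proof -
    have elliptic: "\<not> is_pole R v" if \<tau>: "\<tau> \<in> \<H>" "\<not> is_pole t \<tau>" "t \<tau> = v"
      and lim: "((\<lambda>z. f z * (t z - v)) \<longlongrightarrow> 0) (at \<tau>)" for \<tau>
    proof (rule no_pole_if_tendsto_mult[OF iso])
      have "\<forall>\<^sub>F x in at \<tau>. f x * (t x - v) = (t x - v) * R (t x)"
        using fR[OF \<tau>(1)] by eventually_elim simp
      with lim have lim': "((\<lambda>x. (t x - v) * R (t x)) \<longlongrightarrow> 0) (at \<tau>)" by (rule Lim_transform_eventually)
      show "((\<lambda>x. (x - v) * R x) \<longlongrightarrow> 0) (at v)"
        by (rule tendsto_if_tendsto_compose[where g = t and F = "at \<tau>"])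
          (use lim' t_filterlim_at[OF \<tau>(1,2)] \<tau>(3) in \<open>auto intro!: meromorphic_intros R_mero\<close>)
    qed
    consider "v = 0" | "v = 1" | "v \<noteq> 0" "v \<noteq> 1" by blast
    then show ?thesis
    proof cases
      case 1
      then show ?thesis using elliptic[of \<tau>1] tau_in(1) t_not_pole(1) t_tau(1) lim1 by simp
    next
      case 2
      then show ?thesis using elliptic[of \<tau>2] tau_in(2) t_not_pole(2) t_tau(2) lim2 by simp
    next
      case 3
      obtain z where z: "z \<in> \<H>" "\<not> is_pole t z" "t z = v" using t_surjective by blast
      then have "z \<in> regular" using 3 by (simp add: regular_def)
      show ?thesis
      proof
        assume "is_pole R v"
        then have "is_pole (\<lambda>x. R (t x)) z"
          by (rule is_pole_compose)
            (use t_tendsto[OF z(1,2)] eventually_t_neq[OF z(1), of v] z(3) in auto)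
        then have "is_pole f z" using is_pole_cong[OF fR[OF z(1)] refl] by blast
        then show False using reg \<open>z \<in> regular\<close> by blast
      qed
    qed
  qed
  then have "q dvd p" unfolding R_def by (rule poly_fraction_without_poles[OF pq(1)])
  then obtain P where P: "p = q * P" by (rule dvdE)
  have "finite {x. poly q x = 0}" using pq(1) by (rule poly_roots_finite)
  then have "\<forall>\<^sub>\<approx>z\<in>\<H>. \<forall>x\<in>{x. poly q x = 0}. t z \<noteq> x"
    by (rule eventually_ball_finite) (use t_nonconstant in blast)
  with pq(2) have fP: "\<forall>\<^sub>\<approx>z\<in>\<H>. f z = poly P (t z)"
    by eventually_elim (auto simp: P)
  have "((\<lambda>x. poly P x * x powi (- m)) \<longlongrightarrow> 0) at_infinity"
  proof (rule lim_zero_infinity)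
    have "\<forall>\<^sub>F z in at \<tau>3. f z * t z powi (- m) =
        poly P (1 / inverse (t z)) * (1 / inverse (t z)) powi (- m)"
      using eventually_cosparse_imp_eventually_at[OF fP tau_in(3)]
      by eventually_elim (simp add: inverse_eq_divide)
    with lim3 have lim: "((\<lambda>z. poly P (1 / inverse (t z)) * (1 / inverse (t z)) powi (- m)) \<longlongrightarrow> 0) (at \<tau>3)"
      by (rule Lim_transform_eventually)
    have "((\<lambda>x. inverse (t x)) \<longlongrightarrow> 0) (at \<tau>3)"
      using t_pole3 unfolding is_pole_def by (rule filterlim_compose[OF tendsto_inverse_0])
    then have flim: "filterlim (\<lambda>x. inverse (t x)) (at 0) (at \<tau>3)"
      using eventually_t_neq[OF tau_in(3), of 0] by (simp add: filterlim_at)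
    have P_mero: "(\<lambda>x. poly P (1 / x)) meromorphic_on {0}"
      unfolding poly_altdef by (intro meromorphic_intros)
    show "((\<lambda>x. poly P (1 / x) * (1 / x) powi (- m)) \<longlongrightarrow> 0) (at 0)"
      by (rule tendsto_if_tendsto_compose[OF _ flim at_neq_bot lim]) (intro meromorphic_intros P_mero)
  qed
  from degree_bound_at_infinity[OF this] fP show thesis by (rule that)
qed

text \<open>The fibre near z is counted twice. In a coordinate s with f = s^n the points with f =
  \<epsilon>^n correspond to the n roots of that equation. As f separates generic orbits, they are
  also the images of one of them, x0, under the stabiliser of z; two elements agree at x0 only if
  they agree up to sign, since they already agree at z. The lemma serves for t, 1 - t, 1 / t and t -
  t z.\<close>

lemma ramification:
  assumes z: "z \<in> \<H>"
    and f: "f analytic_on {z}" "f z = 0" "\<not> (\<forall>\<^sub>F x in at z. f x = 0)"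
    and inv: "\<And>A x. A \<in> \<Gamma> \<Longrightarrow> x \<in> \<H> \<Longrightarrow> f (mobius A x) = f x"
    and inj: "\<And>x y. x \<in> generic \<Longrightarrow> y \<in> generic \<Longrightarrow> f x = f y \<Longrightarrow> t x = t y"
    and fin: "finite {A \<in> \<Gamma>. mobius A z = z}"
    and card: "card ((\<lambda>A. {A, - A}) ` {A \<in> \<Gamma>. mobius A z = z}) = e"
  obtains s r where "r > 0" "ball z r \<subseteq> \<H>" "s holomorphic_on ball z r"
    "inj_on s (ball z r)" "s z = 0" "deriv s z \<noteq> 0" "\<forall>w\<in>ball z r. f w = s w ^ e"
proof -
  obtain n s r where loc: "n > 0" "r > 0" "ball z r \<subseteq> \<H>" "s holomorphic_on ball z r"
    "inj_on s (ball z r)" "s z = 0" "deriv s z \<noteq> 0" "\<And>w. w \<in> ball z r \<Longrightarrow> f w = s w ^ n"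
    using analytic_local_root[OF f open_upper_half_plane z] by metis
  define S where "S = {A \<in> \<Gamma>. mobius A z = z}"
  obtain \<rho> where \<rho>: "\<rho> > 0"
    "\<And>A x. A \<in> \<Gamma> \<Longrightarrow> x \<in> ball z \<rho> \<Longrightarrow> mobius A x \<in> ball z \<rho> \<Longrightarrow> mobius A z = z"
    using proper_separation[OF z z] by metis
  define r1 where "r1 = min r \<rho>"
  have r1: "r1 > 0" "ball z r1 \<subseteq> ball z r" "ball z r1 \<subseteq> ball z \<rho>" using loc(2) \<rho>(1) by (auto simp: r1_def)
  have "\<forall>\<^sub>F x in at z. mobius A x \<in> ball z r1" if "A \<in> S" for A
  proof -
    have A: "A \<in> \<Gamma>" "mobius A z = z" using that by (auto simp: S_def)
    have "(mobius A \<longlongrightarrow> z) (at z)" using isCont_mobius[OF A(1) z] by (simp add: isCont_def A(2))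
    then show ?thesis by (rule topological_tendstoD) (use r1(1) in auto)
  qed
  then have "\<forall>\<^sub>F x in at z. \<forall>A\<in>S. mobius A x \<in> ball z r1"
    using fin by (intro eventually_ball_finite) (auto simp: S_def)
  moreover have "\<forall>\<^sub>F x in at z. x \<in> ball z r1" by (rule eventually_at_in_open') (use r1(1) in auto)
  ultimately have "\<forall>\<^sub>F x in at z. x \<in> generic \<and> x \<in> ball z r1 \<and> (\<forall>A\<in>S. mobius A x \<in> ball z r1)"
    using generic_eventually[OF z] by eventually_elim blast
  then obtain r2 where r2: "r2 > 0"
    "\<And>x. x \<in> ball z r2 \<Longrightarrow> x \<noteq> z \<Longrightarrow> x \<in> generic \<and> x \<in> ball z r1 \<and> (\<forall>A\<in>S. mobius A x \<in> ball z r1)"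
    unfolding eventually_at by (auto simp: dist_commute)
  define r3 where "r3 = min r2 r1"
  have r3: "r3 > 0" "ball z r3 \<subseteq> ball z r" using r1 r2(1) by (auto simp: r3_def)
  have "open (s ` ball z r3)"
    by (rule open_mapping_thm3) (use loc(4,5) r3(2) holomorphic_on_subset inj_on_subset in auto)
  moreover have "0 \<in> s ` ball z r3" using r3(1) loc(6) by (metis centre_in_ball imageI)
  ultimately obtain \<eta> where \<eta>: "\<eta> > 0" "ball 0 \<eta> \<subseteq> s ` ball z r3" by (rule openE)
  \<comment> \<open>Small enough that all n-th roots of \<epsilon>^n lie in the disc covered by s,
    and not 0, so that their preimages are generic and different from z.\<close>
  define \<epsilon> where "\<epsilon> = complex_of_real (\<eta> / 2)"
  have \<epsilon>: "\<epsilon> \<noteq> 0" "norm \<epsilon> < \<eta>" using \<eta>(1) by (auto simp: \<epsilon>_def simp del: of_real_divide)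
  have pre: "\<exists>x. x \<in> ball z r3 \<and> s x = w \<and> x \<noteq> z \<and> x \<in> generic \<and> (\<forall>A\<in>S. mobius A x \<in> ball z r1)"
    if w: "w ^ n = \<epsilon> ^ n" for w
  proof -
    have "norm w ^ n = norm \<epsilon> ^ n" using w by (metis norm_power)
    then have "norm w = norm \<epsilon>" using loc(1) by (simp add: power_eq_iff_eq_base)
    then have "w \<in> ball 0 \<eta>" "w \<noteq> 0" using \<epsilon> by auto
    then obtain x where "x \<in> ball z r3" "s x = w" using \<eta>(2) by blast
    moreover have "x \<noteq> z" using \<open>w \<noteq> 0\<close> \<open>s x = w\<close> loc(6) by blast
    ultimately show ?thesis using r2(2)[of x] by (auto simp: r3_def)
  qed
  obtain x0 where x0: "x0 \<in> ball z r3" "s x0 = \<epsilon>" "x0 \<noteq> z" "x0 \<in> generic" "\<forall>A\<in>S. mobius A x0 \<in> ball z r1"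
    using pre[OF refl] by blast
  have x0H: "x0 \<in> \<H>" using x0(4) by (simp add: generic_def regular_def)
  have x0r: "x0 \<in> ball z r" "x0 \<in> ball z \<rho>" using x0(1) r3(2) r1(3) by (auto simp: r3_def)
  define G where "G = (\<lambda>A. s (mobius A x0))"
  have "G ` S = {w. w ^ n = \<epsilon> ^ n}"
  proof (rule equalityI; rule subsetI)
    fix w assume "w \<in> G ` S"
    then obtain A where A: "A \<in> S" "w = s (mobius A x0)" by (auto simp: G_def)
    have "mobius A x0 \<in> ball z r" using x0(5) A(1) r1(2) by blast
    then have "w ^ n = f (mobius A x0)" using loc(8) A(2) by simp
    also have "\<dots> = f x0" using inv[OF _ x0H] A(1) by (simp add: S_def)
    also have "\<dots> = \<epsilon> ^ n" using loc(8)[OF x0r(1)] x0(2) by simp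
    finally show "w \<in> {w. w ^ n = \<epsilon> ^ n}" by simp
  next
    fix w assume "w \<in> {w. w ^ n = \<epsilon> ^ n}"
    then have w: "w ^ n = \<epsilon> ^ n" by simp
    obtain x where x: "x \<in> ball z r3" "s x = w" "x \<in> generic" using pre[OF w] by blast
    have "f x = w ^ n" using loc(8)[of x] x r3(2) by blast
    also have "\<dots> = f x0" using loc(8)[OF x0r(1)] x0(2) w by simp
    finally have "t x0 = t x" using inj[OF x0(4) x(3)] by simp
    then obtain A where A: "A \<in> \<Gamma>" "x = mobius A x0"
      using generic_injective[OF x0(4) x(3)] by (auto simp: same_orbit_def)
    have "x \<in> ball z \<rho>" using x(1) r1(3) by (auto simp: r3_def)
    then have "mobius A z = z" using \<rho>(2)[OF A(1) x0r(2)] A(2) by simp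
    then show "w \<in> G ` S" using A x(2) by (auto simp: S_def G_def)
  qed
  then have "card (G ` S) = n" using card_nth_roots[of "\<epsilon> ^ n" n] \<epsilon>(1) loc(1) by simp
  moreover have "card ((\<lambda>A. {A, - A}) ` S) = card (G ` S)"
  proof (rule card_image_eq_if_same_fibres)
    fix A B assume AB: "A \<in> S" "B \<in> S"
    then have A: "A \<in> \<Gamma>" "mobius A z = z" and B: "B \<in> \<Gamma>" "mobius B z = z" by (auto simp: S_def)
    show "{A, - A} = {B, - B} \<longleftrightarrow> G A = G B"
    proof
      assume "{A, - A} = {B, - B}"
      then have "A = B \<or> A = - B" by (auto simp: doubleton_eq_iff)
      then show "G A = G B" by (auto simp: G_def mobius_uminus)
    next
      assume "G A = G B"
      then have eq: "mobius A x0 = mobius B x0"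
        using loc(5) x0(5) AB r1(2) unfolding G_def by (meson inj_onD subsetD)
      obtain C where C: "C \<in> \<Gamma>" "B ** C = mat 1" "C ** B = mat 1" by (rule inverse_exists[OF B(1)])
      have CA: "C ** A \<in> \<Gamma>" using C A mult_closed by blast
      have "mobius (C ** A) x0 = x0" "mobius (C ** A) z = z"
        using mobius_inverse_eq[OF C(1) B(1) C(3)] mobius_comp[OF C(1) A(1)] x0H z eq A(2) B(2) by metis+
      then have "C ** A = mat 1 \<or> C ** A = - mat 1"
        using mobius_fixes_two_points[OF det_eq_1[OF CA] x0H z x0(3)] by blast
      then have "B ** (C ** A) = B \<or> B ** (C ** A) = - B"
        by (auto simp: mat2_eq_iff mat2_mult_nth mat2_one_nth)
      then have "A = B \<or> A = - B" by (simp add: matrix_mul_assoc C)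
      then show "{A, - A} = {B, - B}" by auto
    qed
  qed
  ultimately have "n = e" using card by (simp add: S_def)
  with loc show thesis by (intro that[of r s]) auto
qed

lemma ramification_elliptic:
  assumes z: "elliptic_point \<Gamma> z e"
    and f: "f analytic_on {z}" "f z = 0" "\<not> (\<forall>\<^sub>F x in at z. f x = 0)"
    and inv: "\<And>A x. A \<in> \<Gamma> \<Longrightarrow> x \<in> \<H> \<Longrightarrow> f (mobius A x) = f x"
    and inj: "\<And>x y. x \<in> generic \<Longrightarrow> y \<in> generic \<Longrightarrow> f x = f y \<Longrightarrow> t x = t y"
  obtains s r where "r > 0" "ball z r \<subseteq> \<H>" "s holomorphic_on ball z r"
    "inj_on s (ball z r)" "s z = 0" "deriv s z \<noteq> 0" "\<forall>w\<in>ball z r. f w = s w ^ e"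
proof -
  have e: "z \<in> \<H>" "card ((\<lambda>A. {A, - A}) ` {A \<in> \<Gamma>. mobius A z = z}) = e"
    using z by (auto simp: elliptic_point_def)
  show thesis
    by (rule ramification[OF e(1) f inv inj finite_stabilizer[OF z] e(2)];
        (assumption | (rule that; assumption)))
qed

section \<open>Local coordinates at the elliptic points and unramifiedness elsewhere\<close>

lemma not_eventually_t_eq:
  assumes "z \<in> \<H>"
  shows "\<not> (\<forall>\<^sub>F x in at z. t x - v = 0)"
proof
  assume "\<forall>\<^sub>F x in at z. t x - v = 0"
  with eventually_t_neq[OF assms, of v] have "\<forall>\<^sub>F x in at z. False" by eventually_elim simp
  then show False by simp
qed

lemma elliptic_points: "elliptic_point \<Gamma> \<tau>1 e1" "elliptic_point \<Gamma> \<tau>2 e2" "elliptic_point \<Gamma> \<tau>3 e3"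
  using signature by (auto simp: signature_0_3_def)

text \<open>The bound d lets a user prescribe how small the disc is, for instance so that
  \<open>t\<close> has modulus below 1 on it.\<close>

definition chart :: "(complex \<Rightarrow> complex) \<Rightarrow> nat \<Rightarrow> complex \<Rightarrow> real \<Rightarrow> (complex \<Rightarrow> complex) \<Rightarrow> real \<Rightarrow> bool" where
  "chart f e z d s r \<longleftrightarrow> 0 < r \<and> r < d \<and> ball z r \<subseteq> \<H> \<and> s holomorphic_on ball z r \<and>
     inj_on s (ball z r) \<and> s z = 0 \<and> (\<forall>w\<in>ball z r. f w = s w ^ e) \<and>
     (\<forall>w\<in>ball z r. deriv s w \<noteq> 0) \<and> (\<forall>w\<in>ball z r - {z}. w \<in> regular \<and> s w \<noteq> 0)"

lemma chartD:
  assumes "chart f e z d s r"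
  shows "0 < r" "r < d" "ball z r \<subseteq> \<H>" "s holomorphic_on ball z r"
    "inj_on s (ball z r)" "s z = 0" "\<forall>w\<in>ball z r. f w = s w ^ e" "\<forall>w\<in>ball z r. deriv s w \<noteq> 0"
    "\<forall>w\<in>ball z r - {z}. w \<in> regular \<and> s w \<noteq> 0"
  using assms unfolding chart_def by blast+

lemma chart_exists:
  assumes z: "elliptic_point \<Gamma> z e" "z \<in> \<H>"
    and f: "f analytic_on {z}" "f z = 0" "\<not> (\<forall>\<^sub>F x in at z. f x = 0)"
    and inv: "\<And>A x. A \<in> \<Gamma> \<Longrightarrow> x \<in> \<H> \<Longrightarrow> f (mobius A x) = f x"
    and inj: "\<And>x y. x \<in> generic \<Longrightarrow> y \<in> generic \<Longrightarrow> f x = f y \<Longrightarrow> t x = t y"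
    and "d > 0"
  shows "\<exists>s r. chart f e z d s r"
proof -
  obtain s r where s: "r > 0" "ball z r \<subseteq> \<H>" "s holomorphic_on ball z r"
    "inj_on s (ball z r)" "s z = 0" "deriv s z \<noteq> 0" "\<forall>w\<in>ball z r. f w = s w ^ e"
    by (rule ramification_elliptic[OF z(1) f inv inj]; assumption)
  obtain r' where r': "r' > 0" "\<And>w. w \<noteq> z \<Longrightarrow> dist w z < r' \<Longrightarrow> w \<in> regular"
    using regular_eventually[OF z(2)] unfolding eventually_at by auto
  define r0 where "r0 = min (min r r') (d / 2)"
  have sub: "ball z r0 \<subseteq> ball z r" by (auto simp: r0_def)
  have "chart f e z d s r0"
    unfolding chart_def
  proof (intro conjI)
    show "0 < r0" "r0 < d" using s(1) r'(1) \<open>d > 0\<close> by (auto simp: r0_def)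
    show "ball z r0 \<subseteq> \<H>" using sub s(2) by blast
    show hol: "s holomorphic_on ball z r0" using s(3) sub by (rule holomorphic_on_subset)
    show inj: "inj_on s (ball z r0)" using s(4) sub by (rule inj_on_subset)
    show "\<forall>w\<in>ball z r0. deriv s w \<noteq> 0"
      using holomorphic_injective_imp_regular[OF hol open_ball inj] by blast
    show "\<forall>w\<in>ball z r0 - {z}. w \<in> regular \<and> s w \<noteq> 0"
    proof
      fix w assume w: "w \<in> ball z r0 - {z}"
      have "s w \<noteq> s z"
        using inj_onD[OF inj, of w z] w \<open>0 < r0\<close> by auto
      then show "w \<in> regular \<and> s w \<noteq> 0" using r'(2)[of w] w s(5) by (auto simp: r0_def dist_commute)
    qed
  qed (use s sub in auto)
  then show ?thesis by blast
qed

lemma chart_tau1: "d > 0 \<Longrightarrow> \<exists>s r. chart t e1 \<tau>1 d s r"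
  by (rule chart_exists[OF elliptic_points(1) tau_in(1) t_analytic[OF tau_in(1) t_not_pole(1)] t_tau(1)])
    (use not_eventually_t_eq[OF tau_in(1), of 0] t_invariant in auto)

lemma chart_tau2: "d > 0 \<Longrightarrow> \<exists>s r. chart (\<lambda>z. 1 - t z) e2 \<tau>2 d s r"
proof (rule chart_exists[OF elliptic_points(2) tau_in(2)])
  show "(\<lambda>z. 1 - t z) analytic_on {\<tau>2}"
    by (intro analytic_intros t_analytic[OF tau_in(2) t_not_pole(2)])
  show "\<not> (\<forall>\<^sub>F x in at \<tau>2. 1 - t x = 0)"
    using not_eventually_t_eq[OF tau_in(2), of 1] by (simp add: eq_commute[of "1::complex"])
qed (use t_invariant t_tau(2) in auto)

lemma chart_tau3: "d > 0 \<Longrightarrow> \<exists>s r. chart (\<lambda>z. inverse (t z)) e3 \<tau>3 d s r"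
  by (rule chart_exists[OF elliptic_points(3) tau_in(3) inverse_t_at_pole[OF tau_in(3) t_pole3]])
    (use t_invariant in auto)

text \<open>Ramification of order 1: the stabiliser of a regular point consists of a single class up
  to sign.\<close>

lemma deriv_t_nonzero:
  assumes z: "z \<in> regular"
  shows "deriv t z \<noteq> 0"
proof -
  note zH = regularD(1)[OF z]
  have "{A \<in> \<Gamma>. mobius A z = z} \<subseteq> {mat 1, - mat 1}" using regular_stabilizer_trivial[OF z] by auto
  then have fin: "finite {A \<in> \<Gamma>. mobius A z = z}" by (rule finite_subset) simp
  have cls: "{A, - A} = {mat 1, - mat 1}" if "A \<in> {A \<in> \<Gamma>. mobius A z = z}" for A
  proof -
    from that have "A = mat 1 \<or> A = - mat 1" using regular_stabilizer_trivial[OF z] by blast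
    then show ?thesis
    proof
      assume "A = - mat 1"
      then show ?thesis by (simp only: minus_minus insert_commute)
    qed (simp only:)
  qed
  have "mat 1 \<in> {A \<in> \<Gamma>. mobius A z = z}" using one_closed mobius_one by simp
  then have "(\<lambda>A. {mat 1, - mat 1}) ` {A \<in> \<Gamma>. mobius A z = z} = {{mat 1, - mat 1}}"
    by (rule image_constant)
  moreover have "(\<lambda>A. {A, - A}) ` {A \<in> \<Gamma>. mobius A z = z}
      = (\<lambda>A. {mat 1, - mat 1}) ` {A \<in> \<Gamma>. mobius A z = z}"
    by (intro image_cong refl cls)
  ultimately have "(\<lambda>A. {A, - A}) ` {A \<in> \<Gamma>. mobius A z = z} = {{mat 1, - mat 1}}"
    by (rule trans[rotated])
  then have card: "card ((\<lambda>A. {A, - A}) ` {A \<in> \<Gamma>. mobius A z = z}) = 1" by simp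
  have ana: "(\<lambda>x. t x - t z) analytic_on {z}" by (intro analytic_intros t_analytic regularD[OF z])
  have f0: "t z - t z = 0" by simp
  have inv: "t (mobius A x) - t z = t x - t z" if "A \<in> \<Gamma>" "x \<in> \<H>" for A x
    using that by (simp add: t_invariant)
  have inj: "t x = t y" if "x \<in> generic" "y \<in> generic" "t x - t z = t y - t z" for x y
    using that(3) by simp
  obtain s r where s: "r > 0" "ball z r \<subseteq> \<H>" "s holomorphic_on ball z r"
    "inj_on s (ball z r)" "s z = 0" "deriv s z \<noteq> 0" "\<forall>w\<in>ball z r. t w - t z = s w ^ 1"
    by (rule ramification[OF zH ana f0 not_eventually_t_eq[OF zH] inv inj fin card])
  have "((\<lambda>w. s w + t z) has_field_derivative deriv s z + 0) (at z)"
    by (intro DERIV_add DERIV_const holomorphic_derivI[OF s(3) open_ball]) (use s(1) in auto)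
  then have "(t has_field_derivative deriv s z + 0) (at z)"
  proof (rule has_field_derivative_transform_within_open[OF _ open_ball])
    show "z \<in> ball z r" using s(1) by simp
    show "s w + t z = t w" if "w \<in> ball z r" for w
      using bspec[OF s(7) that] by (simp add: diff_eq_eq)
  qed
  from DERIV_imp_deriv[OF this] show ?thesis using s(6) by simp
qed

end

section \<open>Local forms of the logarithmic derivative\<close>

text \<open>
  Half the logarithmic derivative of \<open>T' T\<^bsup>-\<gamma>\<^esup> (1 - T)\<^bsup>-\<beta>\<^esup>\<close>.
\<close>

definition half_logderiv :: "(complex \<Rightarrow> complex) \<Rightarrow> complex \<Rightarrow> complex \<Rightarrow> complex \<Rightarrow> complex" where
  "half_logderiv T \<gamma> \<beta> x =
     (deriv (deriv T) x / deriv T x - \<gamma> * deriv T x / T x + \<beta> * deriv T x / (1 - T x)) / 2"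

text \<open>Its value in terms of the root \<open>s\<close> when \<open>T = s\<^sup>e\<close> and \<open>\<gamma> = 1 - 1 / e\<close>.\<close>

definition half_logderiv_root :: "(complex \<Rightarrow> complex) \<Rightarrow> nat \<Rightarrow> complex \<Rightarrow> complex \<Rightarrow> complex" where
  "half_logderiv_root s e \<beta> x =
     (deriv (deriv s) x / deriv s x + \<beta> * (of_nat e * s x ^ (e - 1) * deriv s x) / (1 - s x ^ e)) / 2"

lemma deriv_root_power:
  assumes s: "s holomorphic_on B" "open B" "x \<in> B" and T: "\<And>x. x \<in> B \<Longrightarrow> T x = s x ^ e"
  shows "(T has_field_derivative of_nat e * s x ^ (e - 1) * deriv s x) (at x)"
proof -
  have "((\<lambda>x. s x ^ e) has_field_derivative of_nat e * s x ^ (e - 1) * deriv s x) (at x)"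
    by (rule derivative_eq_intros holomorphic_derivI[OF s] refl | simp)+
  then show ?thesis
    by (rule has_field_derivative_transform_within_open[OF _ s(2,3)]) (simp add: T)
qed

lemma deriv2_root_power:
  assumes s: "s holomorphic_on B" "open B" "x \<in> B" and T: "\<And>x. x \<in> B \<Longrightarrow> T x = s x ^ e"
    and e: "e > 0" and nz: "s x \<noteq> 0"
  shows "deriv (deriv T) x = of_nat e * s x ^ (e - 1) * ((of_nat e - 1) * (deriv s x)\<^sup>2 / s x + deriv (deriv s) x)"
proof -
  have ds: "deriv s holomorphic_on B" by (rule holomorphic_deriv[OF s(1,2)])
  have p: "of_nat (e - 1) * s x ^ (e - 1 - 1) = (of_nat e - 1) * s x ^ (e - 1) / s x"
    using e nz by (cases e; cases "e - 1") (auto simp: field_simps)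
  have "((\<lambda>x. of_nat e * s x ^ (e - 1) * deriv s x) has_field_derivative
     of_nat e * (of_nat (e - 1) * s x ^ (e - 1 - 1) * deriv s x) * deriv s x
       + deriv (deriv s) x * (of_nat e * s x ^ (e - 1))) (at x)"
    by (rule derivative_eq_intros holomorphic_derivI[OF s] holomorphic_derivI[OF ds s(2,3)] refl | simp)+
  then have "((deriv T) has_field_derivative
     of_nat e * (of_nat (e - 1) * s x ^ (e - 1 - 1) * deriv s x) * deriv s x
       + deriv (deriv s) x * (of_nat e * s x ^ (e - 1))) (at x)"
    by (rule has_field_derivative_transform_within_open[OF _ s(2,3)])
      (simp add: DERIV_imp_deriv[OF deriv_root_power[OF s(1,2) _ T]])
  from DERIV_imp_deriv[OF this] show ?thesis
    unfolding p by (simp add: algebra_simps power2_eq_square)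
qed

text \<open>The exponent 1 - 1/e is chosen for this cancellation: both T''/T' and \<gamma> T'/T
  contain the singular term (e - 1) s'/s, and what remains is holomorphic at a simple zero of
  s.\<close>

lemma half_logderiv_power:
  assumes s: "s holomorphic_on B" "open B" "x \<in> B" and T: "\<And>x. x \<in> B \<Longrightarrow> T x = s x ^ e"
    and e: "e > 0" and nz: "s x \<noteq> 0" "deriv s x \<noteq> 0" "T x \<noteq> 1" and \<gamma>: "\<gamma> = 1 - 1 / of_nat e"
  shows "half_logderiv T \<gamma> \<beta> x = half_logderiv_root s e \<beta> x"
proof -
  have d: "deriv T x = of_nat e * s x ^ (e - 1) * deriv s x"
    by (rule DERIV_imp_deriv[OF deriv_root_power[OF s T]])
  have d2: "deriv (deriv T) x = of_nat e * s x ^ (e - 1) * ((of_nat e - 1) * (deriv s x)\<^sup>2 / s x + deriv (deriv s) x)"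
    by (rule deriv2_root_power[OF s T e nz(1)])
  have e0: "of_nat e \<noteq> (0::complex)" using e by simp
  have p: "s x ^ e = s x * s x ^ (e - 1)" using e by (cases e) auto
  have "deriv (deriv T) x / deriv T x = (of_nat e - 1) * deriv s x / s x + deriv (deriv s) x / deriv s x"
  proof -
    have "E * q * ((E - 1) * u\<^sup>2 / w + v) / (E * q * u) = (E - 1) * u / w + v / u"
      if "E \<noteq> 0" "q \<noteq> 0" "u \<noteq> 0" "w \<noteq> 0" for E q u v w :: complex
      using that by (simp add: field_simps power2_eq_square)
    from this[OF e0 _ nz(2,1), of "s x ^ (e - 1)" "deriv (deriv s) x"] nz(1)
    have "of_nat e * s x ^ (e - 1) * ((of_nat e - 1) * (deriv s x)\<^sup>2 / s x + deriv (deriv s) x)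
        / (of_nat e * s x ^ (e - 1) * deriv s x)
      = (of_nat e - 1) * deriv s x / s x + deriv (deriv s) x / deriv s x" by simp
    then show ?thesis by (simp only: d d2)
  qed
  moreover have "\<gamma> * deriv T x / T x = (of_nat e - 1) * deriv s x / s x"
    unfolding d T[OF s(3)] p \<gamma> using e0 nz by (simp add: field_simps)
  ultimately show ?thesis
    unfolding half_logderiv_def half_logderiv_root_def d T[OF s(3)] by simp
qed

lemma deriv_inverse_root_power:
  assumes s: "s holomorphic_on B" "open B" "x \<in> B" and T: "\<And>x. x \<in> B \<Longrightarrow> T x = inverse (s x ^ e)"
    and e: "e > 0" and nz: "s x \<noteq> 0"
  shows "(T has_field_derivative - (of_nat e * deriv s x / s x ^ Suc e)) (at x)"
proof -
  have p: "s x ^ e = s x * s x ^ (e - 1)" using e by (cases e) auto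
  have "((\<lambda>x. inverse (s x ^ e)) has_field_derivative
      - (of_nat e * s x ^ (e - 1) * deriv s x * inverse ((s x ^ e) ^ Suc (Suc 0)))) (at x)"
    by (rule DERIV_inverse_fun[OF deriv_root_power[OF s, of "\<lambda>x. s x ^ e" e, OF refl]]) (use nz in simp)
  also have "- (of_nat e * s x ^ (e - 1) * deriv s x * inverse ((s x ^ e) ^ Suc (Suc 0)))
      = - (of_nat e * deriv s x / s x ^ Suc e)"
    using nz unfolding power_Suc p by (simp add: field_simps)
  finally show ?thesis
    by (rule has_field_derivative_transform_within_open[OF _ s(2,3)]) (simp add: T)
qed

text \<open>At a pole of T the singular terms do not cancel. T''/T' contributes -(e + 1) s'/s, and
  the other two terms contribute \<gamma> e s'/s and \<beta> e s'/s. For the exponents used here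
  half their sum is e3 a s'/s, with the parameter a of the hypergeometric function.\<close>

lemma half_logderiv_inverse_power:
  assumes s: "s holomorphic_on B" "open B" "x \<in> B" and T: "\<And>x. x \<in> B \<Longrightarrow> T x = inverse (s x ^ e)"
    and e: "e > 0" and nz: "s x \<noteq> 0" "deriv s x \<noteq> 0" "T x \<noteq> 1"
  shows "half_logderiv T \<gamma> \<beta> x =
     of_nat e * (\<gamma> + \<beta> - 1 - 1 / of_nat e) / 2 * (deriv s x / s x) + half_logderiv_root s e \<beta> x"
proof -
  have e0: "of_nat e \<noteq> (0::complex)" using e by simp
  have d: "deriv T x = - (of_nat e * deriv s x / s x ^ Suc e)"
    by (rule DERIV_imp_deriv[OF deriv_inverse_root_power[OF s T e nz(1)]])
  have ds: "deriv s holomorphic_on B" by (rule holomorphic_deriv[OF s(1,2)])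
  have D: "((\<lambda>x. - (of_nat e * deriv s x / s x ^ Suc e)) has_field_derivative
     - ((of_nat e * deriv (deriv s) x * s x ^ Suc e
         - (of_nat e * deriv s x) * (of_nat (Suc e) * s x ^ e * deriv s x))
          / (s x ^ Suc e * s x ^ Suc e))) (at x)"
    by (intro DERIV_minus DERIV_divide DERIV_cmult holomorphic_derivI[OF ds s(2,3)])
      (use deriv_root_power[OF s refl, of "Suc e"] nz in simp_all)
  \<comment> \<open>The formula for T' is available only off the zeros of s, so it has to be
    differentiated on a smaller open set.\<close>
  have "\<exists>B'. open B' \<and> x \<in> B' \<and> B' \<subseteq> B \<and> (\<forall>y\<in>B'. s y \<noteq> 0)"
  proof -
    have "continuous_on B s" using s(1) by (rule holomorphic_on_imp_continuous_on)
    then have "open {y \<in> B. s y \<noteq> 0}"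
      using continuous_open_preimage[OF _ s(2), of s "- {0}"] by (simp add: vimage_def Int_def open_Compl)
    then show ?thesis using s(3) nz(1) by (intro exI[of _ "{y \<in> B. s y \<noteq> 0}"]) auto
  qed
  then obtain B' where B': "open B'" "x \<in> B'" "\<And>y. y \<in> B' \<Longrightarrow> y \<in> B \<and> s y \<noteq> 0" by blast
  have ev: "- (of_nat e * deriv s y / s y ^ Suc e) = deriv T y" if "y \<in> B'" for y
    using DERIV_imp_deriv[OF deriv_inverse_root_power[OF s(1,2) _ T e, of y]] B'(3)[OF that] by simp
  have "(deriv T has_field_derivative
     - ((of_nat e * deriv (deriv s) x * s x ^ Suc e
         - (of_nat e * deriv s x) * (of_nat (Suc e) * s x ^ e * deriv s x))
          / (s x ^ Suc e * s x ^ Suc e))) (at x)"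
    by (rule has_field_derivative_transform_within_open[OF D B'(1,2) ev])
  note d2' = DERIV_imp_deriv[OF this]
  have d2: "deriv (deriv T) x = of_nat e * ((of_nat e + 1) * (deriv s x)\<^sup>2 - deriv (deriv s) x * s x)
       / (s x ^ Suc e * s x)"
  proof -
    have "- ((E * v * (w * P) - E * u * ((1 + E) * P * u)) / (w * P * (w * P)))
        = E * ((E + 1) * u\<^sup>2 - v * w) / (w * P * w)"
      if "w \<noteq> 0" "P \<noteq> 0" for E v w P u :: complex
      using that by (simp add: divide_simps) (simp add: algebra_simps power2_eq_square)
    from this[OF nz(1), of "s x ^ e" "of_nat e" "deriv (deriv s) x" "deriv s x"] nz(1)
    show ?thesis by (simp add: d2')
  qed
  have 1: "deriv (deriv T) x / deriv T x = - (of_nat e + 1) * deriv s x / s x + deriv (deriv s) x / deriv s x"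
    unfolding d2 d using e0 nz by (simp add: field_simps power2_eq_square)
  have 2: "\<gamma> * deriv T x / T x = - \<gamma> * of_nat e * deriv s x / s x"
    unfolding d T[OF s(3)] using e0 nz by (simp add: field_simps)
  have p: "s x ^ e = s x * s x ^ (e - 1)" using e by (cases e) auto
  have ne: "1 - s x ^ e \<noteq> 0" using nz(3) unfolding T[OF s(3)] by auto
  have ne': "1 - inverse (s x ^ e) \<noteq> 0" using nz(3) unfolding T[OF s(3)] by auto
  have 3: "\<beta> * deriv T x / (1 - T x) = \<beta> * of_nat e * deriv s x / s x
      + \<beta> * (of_nat e * s x ^ (e - 1) * deriv s x) / (1 - s x ^ e)"
  proof -
    have "deriv T x / (1 - T x) = of_nat e * deriv s x / (s x * (1 - s x ^ e))"
    proof -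
      have "s x ^ Suc e * (1 - inverse (s x ^ e)) = - (s x * (1 - s x ^ e))"
        using nz(1) by (simp add: algebra_simps)
      then have "- (of_nat e * deriv s x / s x ^ Suc e) / (1 - inverse (s x ^ e))
          = - (of_nat e * deriv s x) / (- (s x * (1 - s x ^ e)))"
        by (simp only: minus_divide_left divide_divide_eq_left)
      then show ?thesis unfolding d T[OF s(3)] by simp
    qed
    also have "\<dots> = of_nat e * deriv s x / s x + (of_nat e * s x ^ (e - 1) * deriv s x) / (1 - s x ^ e)"
      using nz(1) ne unfolding p by (simp add: divide_simps) (simp add: algebra_simps)
    finally have "\<beta> * (deriv T x / (1 - T x)) = \<beta> * (of_nat e * deriv s x / s x
        + (of_nat e * s x ^ (e - 1) * deriv s x) / (1 - s x ^ e))" by (rule arg_cong)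
    then show ?thesis by (simp only: distrib_left times_divide_eq_right mult.assoc)
  qed
  show ?thesis
    unfolding half_logderiv_def half_logderiv_root_def 1 2 3
    using e0 nz(1) by (simp add: field_simps)
qed

lemma half_logderiv_root_holomorphic:
  assumes "s holomorphic_on B" "open B" "\<And>x. x \<in> B \<Longrightarrow> deriv s x \<noteq> 0" "\<And>x. x \<in> B \<Longrightarrow> s x ^ e \<noteq> 1"
  shows "half_logderiv_root s e \<beta> holomorphic_on B"
  unfolding half_logderiv_root_def[abs_def]
  by (intro holomorphic_intros assms(1,2)) (use assms(3,4) in auto)

section \<open>The invariant of weight zero\<close>

context triangle_setting
begin

definition c1 :: complex where "c1 = 1 - 1 / of_nat e1"
definition c2 :: complex where "c2 = 1 - 1 / of_nat e2"

abbreviation hld :: "complex \<Rightarrow> complex" where "hld \<equiv> half_logderiv t c1 c2"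

lemma hld_holomorphic: "hld holomorphic_on regular"
  unfolding half_logderiv_def[abs_def]
  by (intro holomorphic_intros t_holomorphic_regular open_regular)
    (use deriv_t_nonzero regularD in auto)

section \<open>Transformation of the logarithmic derivative and the weight zero invariant\<close>

lemma deriv2_t_mobius:
  assumes A: "A \<in> \<Gamma>" and z: "z \<in> regular"
  shows "deriv (deriv t) (mobius A z) = autom_factor A z ^ 4 * deriv (deriv t) z
     + 2 * autom_factor A z ^ 3 * of_real (A$2$1) * deriv t z"
proof -
  define j where "j = autom_factor A z"
  have j: "j \<noteq> 0" unfolding j_def by (rule autom_factor_neq_0[OF A regularD(1)[OF z]])
  have dt: "(deriv t has_field_derivative deriv (deriv t) x) (at x)" if "x \<in> regular" for x
    using holomorphic_derivI[OF holomorphic_deriv[OF t_holomorphic_regular open_regular] open_regular that] .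
  have "((\<lambda>x. deriv t (mobius A x)) has_field_derivative deriv (deriv t) (mobius A z) * (1 / j\<^sup>2)) (at z)"
    unfolding j_def
    by (rule DERIV_chain2[OF dt[OF regular_mobius[OF A z]]
        has_field_derivative_mobius[OF det_eq_1[OF A] regularD(1)[OF z]]])
  moreover have "((\<lambda>x. (autom_factor A x)\<^sup>2 * deriv t x) has_field_derivative
     2 * j * of_real (A$2$1) * deriv t z + deriv (deriv t) z * j\<^sup>2) (at z)"
    unfolding j_def
    by (rule derivative_eq_intros has_field_derivative_autom_factor dt[OF z] refl | simp)+
  then have "((\<lambda>x. deriv t (mobius A x)) has_field_derivative
     2 * j * of_real (A$2$1) * deriv t z + deriv (deriv t) z * j\<^sup>2) (at z)"
    by (rule has_field_derivative_transform_within_open[OF _ open_regular z])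
      (simp add: deriv_t_mobius[OF A])
  ultimately have "deriv (deriv t) (mobius A z) * (1 / j\<^sup>2)
     = 2 * j * of_real (A$2$1) * deriv t z + deriv (deriv t) z * j\<^sup>2" by (rule DERIV_unique)
  then have "deriv (deriv t) (mobius A z)
     = (2 * j * of_real (A$2$1) * deriv t z + deriv (deriv t) z * j\<^sup>2) * j\<^sup>2"
    using j by (simp add: field_simps)
  also have "\<dots> = j ^ 4 * deriv (deriv t) z + 2 * j ^ 3 * of_real (A$2$1) * deriv t z"
    by (simp add: algebra_simps power2_eq_square power3_eq_cube power4_eq_xxxx)
  finally show ?thesis by (simp add: j_def)
qed

text \<open>Half the logarithmic derivative of something of weight 2: differentiating the squared
  automorphy factor produces the additive term. In the square of \<open>hld\<close> minus its
  derivative these additive terms cancel.\<close>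

lemma hld_mobius:
  assumes A: "A \<in> \<Gamma>" and z: "z \<in> regular"
  shows "hld (mobius A z) = (autom_factor A z)\<^sup>2 * hld z + of_real (A$2$1) * autom_factor A z"
proof -
  define j where "j = autom_factor A z"
  have j: "j \<noteq> 0" unfolding j_def by (rule autom_factor_neq_0[OF A regularD(1)[OF z]])
  have d: "deriv t z \<noteq> 0" by (rule deriv_t_nonzero[OF z])
  have "(j ^ 4 * D2 + 2 * j ^ 3 * \<gamma> * D) / (j\<^sup>2 * D) = j\<^sup>2 * (D2 / D) + 2 * j * \<gamma>" if "D \<noteq> 0" for D D2 \<gamma>
    using j that by (simp add: divide_simps) (simp add: algebra_simps power2_eq_square power3_eq_cube power4_eq_xxxx)
  note eq = this[OF d, of "deriv (deriv t) z" "of_real (A$2$1)"]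
  have "(j\<^sup>2 * X + 2 * j * \<gamma> - c1 * (j\<^sup>2 * D) / T + c2 * (j\<^sup>2 * D) / V) / 2
      = j\<^sup>2 * ((X - c1 * D / T + c2 * D / V) / 2) + \<gamma> * j" for X \<gamma> D T V
    by (simp add: algebra_simps add_divide_distrib diff_divide_distrib)
  then show ?thesis
    unfolding half_logderiv_def deriv2_t_mobius[OF A z] deriv_t_mobius[OF A z]
      t_invariant[OF A regularD(1)[OF z]] j_def[symmetric] eq .
qed

lemma deriv_hld_mobius:
  assumes A: "A \<in> \<Gamma>" and z: "z \<in> regular"
  shows "deriv hld (mobius A z) = autom_factor A z ^ 4 * deriv hld z
     + 2 * autom_factor A z ^ 3 * of_real (A$2$1) * hld z + (of_real (A$2$1) * autom_factor A z)\<^sup>2"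
proof -
  define j where "j = autom_factor A z"
  have j: "j \<noteq> 0" unfolding j_def by (rule autom_factor_neq_0[OF A regularD(1)[OF z]])
  have dh: "(hld has_field_derivative deriv hld x) (at x)" if "x \<in> regular" for x
    using holomorphic_derivI[OF hld_holomorphic open_regular that] .
  have "((\<lambda>x. hld (mobius A x)) has_field_derivative deriv hld (mobius A z) * (1 / j\<^sup>2)) (at z)"
    unfolding j_def
    by (rule DERIV_chain2[OF dh[OF regular_mobius[OF A z]]
        has_field_derivative_mobius[OF det_eq_1[OF A] regularD(1)[OF z]]])
  moreover have "((\<lambda>x. (autom_factor A x)\<^sup>2 * hld x + of_real (A$2$1) * autom_factor A x) has_field_derivative
     2 * j * of_real (A$2$1) * hld z + deriv hld z * j\<^sup>2 + of_real (A$2$1) * of_real (A$2$1)) (at z)"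
    unfolding j_def
    by (rule derivative_eq_intros has_field_derivative_autom_factor dh[OF z] refl | simp)+
  then have "((\<lambda>x. hld (mobius A x)) has_field_derivative
     2 * j * of_real (A$2$1) * hld z + deriv hld z * j\<^sup>2 + of_real (A$2$1) * of_real (A$2$1)) (at z)"
    by (rule has_field_derivative_transform_within_open[OF _ open_regular z])
      (simp add: hld_mobius[OF A])
  ultimately have "deriv hld (mobius A z) * (1 / j\<^sup>2)
     = 2 * j * of_real (A$2$1) * hld z + deriv hld z * j\<^sup>2 + of_real (A$2$1) * of_real (A$2$1)"
    by (rule DERIV_unique)
  then have "deriv hld (mobius A z)
     = (2 * j * of_real (A$2$1) * hld z + deriv hld z * j\<^sup>2 + of_real (A$2$1) * of_real (A$2$1)) * j\<^sup>2"
    using j by (simp add: field_simps)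
  also have "\<dots> = j ^ 4 * deriv hld z + 2 * j ^ 3 * of_real (A$2$1) * hld z + (of_real (A$2$1) * j)\<^sup>2"
    by (simp add: algebra_simps power2_eq_square power3_eq_cube power4_eq_xxxx)
  finally show ?thesis by (simp add: j_def)
qed

text \<open>If both exponents were 0, the first factor would be minus one half of the Schwarzian
  derivative of \<open>t\<close>. Division by the square of t' brings its weight 4 down to 0, and t
  (1 - t) compensates singularities at \<tau>1 and \<tau>2.\<close>

definition schwarz :: "complex \<Rightarrow> complex" where
  "schwarz z = ((hld z)\<^sup>2 - deriv hld z) * (t z * (1 - t z)) / (deriv t z)\<^sup>2"

lemma schwarz_meromorphic: "schwarz meromorphic_on \<H>"
  unfolding schwarz_def[abs_def] half_logderiv_def[abs_def]
  by (intro meromorphic_intros t_meromorphic)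

lemma schwarz_mobius:
  assumes A: "A \<in> \<Gamma>" and z: "z \<in> regular"
  shows "schwarz (mobius A z) = schwarz z"
proof -
  define j where "j = autom_factor A z"
  have j: "j \<noteq> 0" unfolding j_def by (rule autom_factor_neq_0[OF A regularD(1)[OF z]])
  have "(hld (mobius A z))\<^sup>2 - deriv hld (mobius A z) = j ^ 4 * ((hld z)\<^sup>2 - deriv hld z)"
    unfolding hld_mobius[OF A z] deriv_hld_mobius[OF A z] j_def[symmetric]
    by (simp add: algebra_simps power2_eq_square power3_eq_cube power4_eq_xxxx)
  moreover have "(deriv t (mobius A z))\<^sup>2 = j ^ 4 * (deriv t z)\<^sup>2"
    by (simp add: deriv_t_mobius[OF A z] j_def power_mult_distrib)
  ultimately show ?thesis
    unfolding schwarz_def t_invariant[OF A regularD(1)[OF z]] using j by simp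
qed

lemma schwarz_holomorphic: "schwarz holomorphic_on regular"
  unfolding schwarz_def[abs_def]
  by (intro holomorphic_intros hld_holomorphic t_holomorphic_regular open_regular)
    (use deriv_t_nonzero in auto)

text \<open>By \<open>half_logderiv_power\<close> h extends holomorphically to z. In the coordinate
  s the product S T is then a holomorphic function times s^2, because T^2 / T'^2 equals s^2 / (e
  s')^2. Used for T = t and for T = 1 - t.\<close>

lemma schwarz_root:
  assumes s: "s holomorphic_on ball z r" and r: "r > 0" "s z = 0"
    and T: "\<And>x. x \<in> ball z r \<Longrightarrow> T x = s x ^ e" and e: "e > 0"
    and ds: "\<And>x. x \<in> ball z r \<Longrightarrow> deriv s x \<noteq> 0"
    and nz: "\<And>x. x \<in> ball z r - {z} \<Longrightarrow> s x \<noteq> 0" "\<And>x. x \<in> ball z r - {z} \<Longrightarrow> T x \<noteq> 1"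
    and \<gamma>: "\<gamma> = 1 - 1 / of_nat e"
    and h: "\<And>x. x \<in> ball z r - {z} \<Longrightarrow> h x = half_logderiv T \<gamma> \<beta> x"
    and S: "\<And>x. x \<in> ball z r - {z} \<Longrightarrow>
       S x = ((h x)\<^sup>2 - deriv h x) * (T x * (1 - T x)) / (deriv T x)\<^sup>2"
  shows "((\<lambda>x. S x * T x) \<longlongrightarrow> 0) (at z)"
proof -
  define \<Lambda> where "\<Lambda> = half_logderiv_root s e \<beta>"
  have ne1: "s x ^ e \<noteq> 1" if "x \<in> ball z r" for x
    using nz(2)[of x] T[of x] that r(2) by (cases "x = z") (auto simp: zero_power[OF e])
  have \<Lambda>: "\<Lambda> holomorphic_on ball z r"
    unfolding \<Lambda>_def by (rule half_logderiv_root_holomorphic[OF s open_ball ds ne1])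
  define Q where "Q = (\<lambda>x. ((\<Lambda> x)\<^sup>2 - deriv \<Lambda> x) * (1 - s x ^ e) * (s x)\<^sup>2 / (of_nat e * deriv s x)\<^sup>2)"
  have "Q holomorphic_on ball z r"
    unfolding Q_def by (intro holomorphic_intros \<Lambda> s open_ball) (use ds e in auto)
  then have "(Q \<longlongrightarrow> Q z) (at z)" using r(1) by (rule tendsto_if_holomorphic)
  moreover have "Q z = 0" using r(2) by (simp add: Q_def)
  ultimately have "(Q \<longlongrightarrow> 0) (at z)" by simp
  moreover have "\<forall>\<^sub>F x in at z. Q x = S x * T x"
  proof (rule eventually_punctured_ball[OF r(1)])
    fix x assume x: "x \<in> ball z r - {z}"
    then have xb: "x \<in> ball z r" by simp
    have hl: "h y = \<Lambda> y" if "y \<in> ball z r - {z}" for y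
      unfolding \<Lambda>_def h[OF that]
      by (rule half_logderiv_power[OF s open_ball _ T e _ _ _ \<gamma>]) (use that nz ds in auto)
    have "\<forall>\<^sub>F y in nhds x. y \<in> ball z r - {z}" using x by (intro eventually_nhds_in_open) auto
    then have "\<forall>\<^sub>F y in nhds x. h y = \<Lambda> y" by eventually_elim (rule hl)
    then have dh: "deriv h x = deriv \<Lambda> x" by (rule deriv_cong_ev) simp
    have dT: "deriv T x = of_nat e * s x ^ (e - 1) * deriv s x"
      by (rule DERIV_imp_deriv[OF deriv_root_power[OF s open_ball xb T]])
    have p: "s x ^ e = s x * s x ^ (e - 1)" using e by (cases e) auto
    have "M * (w * q * N) / (E * q * u)\<^sup>2 * (w * q) = M * N * w\<^sup>2 / (E * u)\<^sup>2"
      if "q \<noteq> 0" "E \<noteq> 0" "u \<noteq> 0" for M N w q E u :: complex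
      using that by (simp add: field_simps power2_eq_square)
    from this[of "s x ^ (e - 1)" "of_nat e" "deriv s x" "(\<Lambda> x)\<^sup>2 - deriv \<Lambda> x" "s x" "1 - s x ^ e"]
    show "Q x = S x * T x"
      unfolding S[OF x] Q_def hl[OF x] dh dT T[OF xb] using nz(1)[OF x] ds[OF xb] e by (simp add: p)
  qed
  ultimately show ?thesis by (rule Lim_transform_eventually)
qed

text \<open>Here h is e a s'/s plus a holomorphic function. The double pole of h^2 - h' has
  coefficient ((e a)^2 + e a) s'^2, the second summand coming from the derivative of 1/s, while T (1
  - T) / T'^2 behaves like - s^2 / (e s')^2. With e = e3 the factor a + 1/e is the parameter
  b.\<close>

lemma schwarz_pole:
  assumes s: "s holomorphic_on ball z r" and r: "r > 0" "s z = 0"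
    and T: "\<And>x. x \<in> ball z r \<Longrightarrow> T x = inverse (s x ^ e)" and e: "e > 0"
    and ds: "\<And>x. x \<in> ball z r \<Longrightarrow> deriv s x \<noteq> 0"
    and nz: "\<And>x. x \<in> ball z r - {z} \<Longrightarrow> s x \<noteq> 0" "\<And>x. x \<in> ball z r - {z} \<Longrightarrow> T x \<noteq> 1"
    and h: "\<And>x. x \<in> ball z r - {z} \<Longrightarrow> h x = half_logderiv T \<gamma> \<beta> x"
    and S: "\<And>x. x \<in> ball z r - {z} \<Longrightarrow>
       S x = ((h x)\<^sup>2 - deriv h x) * (T x * (1 - T x)) / (deriv T x)\<^sup>2"
    and a: "a = (\<gamma> + \<beta> - 1 - 1 / of_nat e) / 2"
  shows "(S \<longlongrightarrow> - (a * (a + 1 / of_nat e))) (at z)"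
proof -
  define \<Lambda> where "\<Lambda> = half_logderiv_root s e \<beta>"
  have ne1: "s x ^ e \<noteq> 1" if "x \<in> ball z r" for x
    using nz(2)[of x] T[of x] that r(2) by (cases "x = z") (auto simp: zero_power[OF e])
  have \<Lambda>: "\<Lambda> holomorphic_on ball z r"
    unfolding \<Lambda>_def by (rule half_logderiv_root_holomorphic[OF s open_ball ds ne1])
  define E where "E = complex_of_nat e"
  have E: "E \<noteq> 0" using e by (simp add: E_def)
  define Q where "Q = (\<lambda>x. ((E\<^sup>2 * a\<^sup>2 + E * a) * (deriv s x)\<^sup>2
      + s x * (2 * E * a * deriv s x * \<Lambda> x - E * a * deriv (deriv s) x)
      + (s x)\<^sup>2 * ((\<Lambda> x)\<^sup>2 - deriv \<Lambda> x)) * (s x ^ e - 1) / (E * deriv s x)\<^sup>2)"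
  have "Q holomorphic_on ball z r"
    unfolding Q_def by (intro holomorphic_intros \<Lambda> s open_ball) (use ds E in auto)
  then have "(Q \<longlongrightarrow> Q z) (at z)" using r(1) by (rule tendsto_if_holomorphic)
  moreover have "Q z = - (a * (a + 1 / E))"
    using r E ds[of z] by (simp add: Q_def field_simps power2_eq_square zero_power[OF e])
  ultimately have "(Q \<longlongrightarrow> - (a * (a + 1 / of_nat e))) (at z)" by (simp add: E_def)
  moreover have "\<forall>\<^sub>F x in at z. Q x = S x"
  proof (rule eventually_punctured_ball[OF r(1)])
    fix x assume x: "x \<in> ball z r - {z}"
    then have xb: "x \<in> ball z r" by simp
    have hl: "h y = E * a * (deriv s y / s y) + \<Lambda> y" if "y \<in> ball z r - {z}" for y
    proof -
      have "half_logderiv T \<gamma> \<beta> y =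
         of_nat e * (\<gamma> + \<beta> - 1 - 1 / of_nat e) / 2 * (deriv s y / s y) + half_logderiv_root s e \<beta> y"
        by (rule half_logderiv_inverse_power[OF s open_ball _ T e]) (use that nz ds in auto)
      then show ?thesis unfolding h[OF that] \<Lambda>_def a E_def by simp
    qed
    have "\<forall>\<^sub>F y in nhds x. y \<in> ball z r - {z}" using x by (intro eventually_nhds_in_open) auto
    then have "\<forall>\<^sub>F y in nhds x. h y = E * a * (deriv s y / s y) + \<Lambda> y" by eventually_elim (rule hl)
    then have "deriv h x = deriv (\<lambda>y. E * a * (deriv s y / s y) + \<Lambda> y) x" by (rule deriv_cong_ev) simp
    also have "\<dots> = E * a * ((deriv (deriv s) x * s x - deriv s x * deriv s x) / (s x * s x)) + deriv \<Lambda> x"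
      by (intro DERIV_imp_deriv DERIV_add DERIV_cmult DERIV_divide holomorphic_derivI[OF \<Lambda> open_ball xb]
          holomorphic_derivI[OF s open_ball xb]
          holomorphic_derivI[OF holomorphic_deriv[OF s open_ball] open_ball xb])
        (use nz(1)[OF x] in simp)
    finally have dh: "deriv h x = E * a * ((deriv (deriv s) x * s x - deriv s x * deriv s x) / (s x * s x)) + deriv \<Lambda> x" .
    have dT: "deriv T x = - (E * deriv s x / s x ^ Suc e)"
      unfolding E_def by (rule DERIV_imp_deriv[OF deriv_inverse_root_power[OF s open_ball xb T e nz(1)[OF x]]])
    have alg: "((E * a * (u / w) + l)\<^sup>2 - (E * a * ((v * w - u * u) / (w * w)) + l'))
         * (inverse q * (1 - inverse q)) / (- (E * u / (w * q)))\<^sup>2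
       = ((E\<^sup>2 * a\<^sup>2 + E * a) * u\<^sup>2 + w * (2 * E * a * u * l - E * a * v) + w\<^sup>2 * (l\<^sup>2 - l')) * (q - 1) / (E * u)\<^sup>2"
      if "q \<noteq> 0" "u \<noteq> 0" "w \<noteq> 0" for u v w l l' q
    proof -
      have 1: "(E * a * (u / w) + l)\<^sup>2 - (E * a * ((v * w - u * u) / (w * w)) + l')
        = ((E\<^sup>2 * a\<^sup>2 + E * a) * u\<^sup>2 + w * (2 * E * a * u * l - E * a * v) + w\<^sup>2 * (l\<^sup>2 - l')) / w\<^sup>2"
        using that by (simp add: divide_simps) (simp add: algebra_simps power2_eq_square)
      have 2: "(inverse q * (1 - inverse q)) / (- (E * u / (w * q)))\<^sup>2 = w\<^sup>2 * (q - 1) / (E * u)\<^sup>2"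
        using that E by (simp add: divide_simps) (simp add: algebra_simps power2_eq_square)
      have "X / w\<^sup>2 * Y / Z = X * (q - 1) / (E * u)\<^sup>2" if "Y / Z = w\<^sup>2 * (q - 1) / (E * u)\<^sup>2" for X Y Z
      proof -
        have "X / w\<^sup>2 * Y / Z = X / w\<^sup>2 * (Y / Z)" by simp
        also have "\<dots> = X * (q - 1) / (E * u)\<^sup>2" unfolding that using \<open>w \<noteq> 0\<close> by simp
        finally show ?thesis .
      qed
      from this[OF 2] show ?thesis unfolding 1 .
    qed
    show "Q x = S x"
      unfolding S[OF x] Q_def hl[OF x] dh dT T[OF xb] power_Suc
      by (rule alg[symmetric]) (use nz(1)[OF x] ds[OF xb] in auto)
  qed
  ultimately show ?thesis by (rule Lim_transform_eventually)
qed

lemma schwarz_constant: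
  assumes a: "a = (1 - 1 / real e1 - 1 / real e2 - 1 / real e3) / 2" and z: "z \<in> regular"
  shows "schwarz z = - of_real (a * (a + 1 / real e3))"
proof -
  have e: "e1 > 0" "e2 > 0" "e3 > 0" using order_ge_2 by auto
  have lim1: "((\<lambda>x. schwarz x * t x) \<longlongrightarrow> 0) (at \<tau>1)"
  proof -
    obtain s r where "chart t e1 \<tau>1 1 s r"
      using chart_tau1[OF zero_less_one] by blast
    note s = chartD[OF this]
    show ?thesis
      by (rule schwarz_root[OF s(4,1,6) bspec[OF s(7)] e(1) bspec[OF s(8)] _ _ _ _ schwarz_def])
        (use s(9) regularD in \<open>auto simp only: c1_def\<close>)
  qed
  have lim2: "((\<lambda>x. schwarz x * (t x - 1)) \<longlongrightarrow> 0) (at \<tau>2)"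
  proof -
    obtain s r where "chart (\<lambda>z. 1 - t z) e2 \<tau>2 1 s r"
      using chart_tau2[OF zero_less_one] by blast
    note s = chartD[OF this]
    have d1: "deriv (\<lambda>x. 1 - t x) x = - deriv t x" if "x \<in> regular" for x
      using DERIV_diff[OF DERIV_const t_has_derivative[OF that]] DERIV_imp_deriv by fastforce
    have d2: "deriv (deriv (\<lambda>x. 1 - t x)) x = - deriv (deriv t) x" if x: "x \<in> regular" for x
    proof -
      have "\<forall>\<^sub>F y in nhds x. y \<in> regular" using open_regular x by (rule eventually_nhds_in_open)
      then have "\<forall>\<^sub>F y in nhds x. deriv (\<lambda>x. 1 - t x) y = - deriv t y" by eventually_elim (rule d1)
      then have "deriv (deriv (\<lambda>x. 1 - t x)) x = deriv (\<lambda>y. - deriv t y) x" by (rule deriv_cong_ev) simp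
      also have "\<dots> = - deriv (deriv t) x"
        by (intro DERIV_imp_deriv DERIV_minus holomorphic_derivI[OF _ open_regular x]
            holomorphic_deriv t_holomorphic_regular open_regular)
      finally show ?thesis .
    qed
    \<comment> \<open>Replacing t by 1 - t exchanges the two exponents and changes only the sign of
      Y, which its logarithmic derivative does not see.\<close>
    have hl: "hld x = half_logderiv (\<lambda>x. 1 - t x) c2 c1 x" if "x \<in> regular" for x
      unfolding half_logderiv_def d1[OF that] d2[OF that] by simp
    have "((\<lambda>x. schwarz x * (1 - t x)) \<longlongrightarrow> 0) (at \<tau>2)"
    proof (rule schwarz_root[OF s(4,1,6) bspec[OF s(7)] e(2) bspec[OF s(8)]])
      show "s x \<noteq> 0" "1 - t x \<noteq> 1" "hld x = half_logderiv (\<lambda>x. 1 - t x) c2 c1 x"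
        if "x \<in> ball \<tau>2 r - {\<tau>2}" for x
        using bspec[OF s(9) that] regularD(3) hl by auto
      show "schwarz x = ((hld x)\<^sup>2 - deriv hld x) * ((1 - t x) * (1 - (1 - t x))) / (deriv (\<lambda>x. 1 - t x) x)\<^sup>2"
        if "x \<in> ball \<tau>2 r - {\<tau>2}" for x
        using bspec[OF s(9) that] d1 by (simp add: schwarz_def mult.commute)
    qed (simp_all add: c2_def)
    from tendsto_minus[OF this] show ?thesis by (simp add: algebra_simps)
  qed
  have lim3: "(schwarz \<longlongrightarrow> - of_real (a * (a + 1 / real e3))) (at \<tau>3)"
  proof -
    obtain s r where "chart (\<lambda>z. inverse (t z)) e3 \<tau>3 1 s r"
      using chart_tau3[OF zero_less_one] by blast
    note s = chartD[OF this]
    have T: "t w = inverse (s w ^ e3)" if "w \<in> ball \<tau>3 r" for w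
      using s(7) that by (metis inverse_inverse_eq)
    have a': "of_real a = (c1 + c2 - 1 - 1 / of_nat e3) / (2 :: complex)"
      by (simp add: a c1_def c2_def)
    have "(schwarz \<longlongrightarrow> - (of_real a * (of_real a + 1 / of_nat e3))) (at \<tau>3)"
      by (rule schwarz_pole[OF s(4,1,6) T e(3) _ _ _ _ _ a', of hld])
        (use s regularD in \<open>auto simp: schwarz_def\<close>)
    then show ?thesis by simp
  qed
  have "((\<lambda>x. inverse (t x)) \<longlongrightarrow> 0) (at \<tau>3)"
    using t_pole3 unfolding is_pole_def by (rule filterlim_compose[OF tendsto_inverse_0])
  \<comment> \<open>A finite limit at the pole of \<open>t\<close> gives the growth condition with m
    = 1, hence a polynomial of degree 0.\<close>
  from tendsto_mult[OF lim3 this] have lim3': "((\<lambda>x. schwarz x * t x powi (- 1)) \<longlongrightarrow> 0) (at \<tau>3)"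
    by (simp add: power_int_minus)
  have np: "\<not> is_pole schwarz x" if "x \<in> regular" for x
    using not_is_pole_holomorphic[OF open_regular that schwarz_holomorphic] .
  obtain P where P: "P = 0 \<or> int (degree P) < 1" "\<forall>\<^sub>\<approx>z\<in>\<H>. schwarz z = poly P (t z)"
    by (rule automorphic_polynomial[OF schwarz_meromorphic schwarz_mobius np lim1 lim2 lim3'])
  then obtain k where "P = [:k:]" using degree_eq_zeroE[of P] by fastforce
  then have ev: "\<forall>\<^sub>\<approx>z\<in>\<H>. schwarz z = k" using P(2) by simp
  have "(schwarz \<longlongrightarrow> k) (at x)" if "x \<in> \<H>" for x
    using eventually_cosparse_imp_eventually_at[OF ev that] by (rule tendsto_eventually)
  note lims = this
  have "k = - of_real (a * (a + 1 / real e3))" by (rule LIM_unique[OF lims[OF tau_in(3)] lim3])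
  moreover have "isCont schwarz z"
    using schwarz_holomorphic open_regular z
    by (meson continuous_on_eq_continuous_at holomorphic_on_imp_continuous_on)
  then have "schwarz z = k" using LIM_unique[OF lims[OF regularD(1)[OF z]]] by (simp add: isCont_def)
  ultimately show ?thesis by simp
qed

end

section \<open>The hypergeometric equation\<close>

lemma one_minus_not_nonpos:
  fixes x :: complex
  assumes "norm x < 1"
  shows "1 - x \<notin> \<real>\<^sub>\<le>\<^sub>0"
proof
  assume "1 - x \<in> \<real>\<^sub>\<le>\<^sub>0"
  then have "Re (1 - x) \<le> 0" by (simp add: complex_nonpos_Reals_iff)
  then have "1 \<le> Re x" by simp
  also have "\<dots> \<le> norm x" by (rule complex_Re_le_cmod)
  finally show False using assms by simp
qed

text \<open>The letters stand for w = s, q = s^(e - 1), u = s', v = s'', l = y'/y, and p1, p2 for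
  the derivatives of \<psi> where y = \<psi> (s). From (l^2 - l') y = 2 l y' - y'' and the formula
  for l the second derivative v drops out, leaving an equation in s alone.\<close>

lemma hypergeometric_ode_algebra:
  fixes w q u v l l' p1 p2 y \<beta> E ab A :: complex
  assumes nz: "w \<noteq> 0" "q \<noteq> 0" "u \<noteq> 0" "1 - w * q \<noteq> 0"
    and l: "l = (v / u + \<beta> * (E * q * u) / (1 - w * q)) / 2"
    and y1: "l * y = p1 * u" and y2: "l' * y + l * (l * y) = p2 * u\<^sup>2 + p1 * v"
    and S: "(l\<^sup>2 - l') * (w * q * (1 - w * q)) = - ab * (E * q * u)\<^sup>2"
    and A: "A = \<beta> * E"
  shows "w\<^sup>2 * p2 = w * q * (w\<^sup>2 * p2 + A * (w * p1) + ab * E\<^sup>2 * y)"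
proof -
  have lu: "2 * l * u * (1 - w * q) = v * (1 - w * q) + \<beta> * (E * q * u) * u"
    unfolding l using nz by (simp add: field_simps)
  have "(l\<^sup>2 - l') * y = 2 * l * (l * y) - (l' * y + l * (l * y))" by (simp add: algebra_simps power2_eq_square)
  also have "\<dots> = 2 * l * (p1 * u) - (p2 * u\<^sup>2 + p1 * v)" unfolding y1 y2[unfolded y1] by (simp only: y2[unfolded y1] y1)
  finally have "(l\<^sup>2 - l') * y * (1 - w * q) = (2 * l * (p1 * u) - (p2 * u\<^sup>2 + p1 * v)) * (1 - w * q)"
    by (rule arg_cong)
  also have "\<dots> = p1 * (2 * l * u * (1 - w * q)) - (p2 * u\<^sup>2 + p1 * v) * (1 - w * q)"
    by (simp add: algebra_simps)
  also have "\<dots> = p1 * \<beta> * E * q * u\<^sup>2 - p2 * u\<^sup>2 * (1 - w * q)"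
    unfolding lu by (simp add: algebra_simps power2_eq_square)
  finally have "(l\<^sup>2 - l') * (w * q * (1 - w * q)) * y = w * q * (p1 * \<beta> * E * q * u\<^sup>2 - p2 * u\<^sup>2 * (1 - w * q))"
    by (simp add: mult_ac)
  then have "- ab * (E * q * u)\<^sup>2 * y = w * q * (p1 * \<beta> * E * q * u\<^sup>2 - p2 * u\<^sup>2 * (1 - w * q))"
    unfolding S .
  then have "(q * u\<^sup>2) * (- ab * E\<^sup>2 * q * y) = (q * u\<^sup>2) * (w * (p1 * \<beta> * E * q - p2 * (1 - w * q)))"
    by (simp add: algebra_simps power2_eq_square)
  moreover have "q * u\<^sup>2 \<noteq> 0" using nz by simp
  ultimately have eq: "- ab * E\<^sup>2 * q * y = w * (p1 * \<beta> * E * q - p2 * (1 - w * q))"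
    by (rule mult_left_cancel[THEN iffD1, rotated])
  have "w\<^sup>2 * p2 - w * q * (w\<^sup>2 * p2 + \<beta> * E * (w * p1) + ab * E\<^sup>2 * y)
      = - w * (w * (p1 * \<beta> * E * q - p2 * (1 - w * q)) - (- ab * E\<^sup>2 * q * y))"
    by (simp add: algebra_simps power2_eq_square)
  then show ?thesis unfolding A eq by simp
qed

context triangle_setting
begin

text \<open>
  With \<open>y\<^sup>2 = s' (1 - t)\<^bsup>-(1 - 1/e2)\<^esup>\<close>, which is \<open>t' t\<^bsup>-(1 - 1/e1)\<^esup> (1 - t)\<^bsup>-(1 - 1/e2)\<^esup>\<close> up to a
  constant, the equation \<open>schwarz = - a b\<close> becomes the hypergeometric equation for \<open>y\<close>
  as a function of \<open>s = t\<^bsup>1/e1\<^esup>\<close>.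
\<close>

lemma hypergeometric_expansion:
  assumes a: "a = (1 - 1 / real e1 - 1 / real e2 - 1 / real e3) / 2" and b: "b = a + 1 / real e3"
  obtains r s y A C where "0 < r" "ball \<tau>1 r \<subseteq> \<H>" "s holomorphic_on ball \<tau>1 r"
    "s \<tau>1 = 0" "\<forall>x\<in>ball \<tau>1 r. t x = s x ^ e1" "\<forall>x\<in>ball \<tau>1 r. deriv s x \<noteq> 0"
    "\<forall>x\<in>ball \<tau>1 r - {\<tau>1}. x \<in> regular \<and> s x \<noteq> 0" "\<forall>x\<in>ball \<tau>1 r. norm (t x) < 1"
    "y holomorphic_on ball \<tau>1 r" "\<forall>x\<in>ball \<tau>1 r. (y x)\<^sup>2 = deriv s x * exp (- c2 * Ln (1 - t x))"
    "A \<noteq> 0" "\<forall>x\<in>ball \<tau>1 r. y x = A * (hyp2F1 a b (1 - 1 / real e1) (t x)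
       + C * s x * hyp2F1 (a + 1 / real e1) (b + 1 / real e1) (1 + 1 / real e1) (t x))"
proof -
  have e: "e1 > 0" "e1 \<ge> 2" using order_ge_2 by auto
  have "\<forall>\<^sub>F x in at \<tau>1. norm (t x) < 1"
    using order_tendstoD(2)[OF tendsto_norm[OF t_lim1], of 1] by simp
  \<comment> \<open>Modulus below 1 keeps 1 - t in the domain of the principal logarithm.\<close>
  then obtain d where d: "d > 0" "\<And>x. x \<noteq> \<tau>1 \<Longrightarrow> dist x \<tau>1 < d \<Longrightarrow> norm (t x) < 1"
    unfolding eventually_at by auto
  obtain s r where "chart t e1 \<tau>1 d s r"
    using chart_tau1[OF d(1)] by blast
  note s = chartD[OF this]
  have t1: "norm (t x) < 1" if "x \<in> ball \<tau>1 r" for x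
    using d(2)[of x] that s(2) t_tau(1) by (cases "x = \<tau>1") (auto simp: dist_commute)
  have ds: "deriv s holomorphic_on ball \<tau>1 r" by (rule holomorphic_deriv[OF s(4) open_ball])
  have "\<tau>1 \<in> ball \<tau>1 r" using s(1) by simp
  then obtain h where h: "h holomorphic_on ball \<tau>1 r" "\<And>x. x \<in> ball \<tau>1 r \<Longrightarrow> exp (h x) = deriv s x"
    using holomorphic_logarithm_exists[OF convex_ball open_ball ds bspec[OF s(8)]] by blast
  have T: "t x = s x ^ e1" if "x \<in> ball \<tau>1 r" for x using s(7) that by blast
  have t_hol: "t holomorphic_on ball \<tau>1 r"
  proof -
    have "t holomorphic_on ball \<tau>1 r \<longleftrightarrow> (\<lambda>x. s x ^ e1) holomorphic_on ball \<tau>1 r"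
      by (intro holomorphic_cong refl T)
    then show ?thesis using holomorphic_on_power[OF s(4)] by blast
  qed
  \<comment> \<open>A holomorphic square root, obtained by halving a logarithm h of s' and the
    principal logarithm of 1 - t; being an exponential, it has no zeros.\<close>
  define y where "y = (\<lambda>x. exp (h x / 2 - c2 / 2 * Ln (1 - t x)))"
  have y_hol: "y holomorphic_on ball \<tau>1 r"
    unfolding y_def by (intro holomorphic_intros h(1) t_hol) (use t1 one_minus_not_nonpos in auto)
  have y2: "(y x)\<^sup>2 = deriv s x * exp (- c2 * Ln (1 - t x))" if "x \<in> ball \<tau>1 r" for x
  proof -
    have "(y x)\<^sup>2 = exp (h x + - c2 * Ln (1 - t x))"
      unfolding y_def by (simp flip: exp_of_nat_mult add: algebra_simps exp_double[symmetric])
    then show ?thesis by (simp only: exp_add h(2)[OF that])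
  qed
  define \<Lambda> where "\<Lambda> = half_logderiv_root s e1 c2"
  have ne1: "s x ^ e1 \<noteq> 1" if "x \<in> ball \<tau>1 r" for x
    using t1[OF that] T[OF that] by auto
  have \<Lambda>_hol: "\<Lambda> holomorphic_on ball \<tau>1 r"
    unfolding \<Lambda>_def by (rule half_logderiv_root_holomorphic[OF s(4) open_ball bspec[OF s(8)] ne1])
  have y_deriv: "(y has_field_derivative \<Lambda> x * y x) (at x)" if x: "x \<in> ball \<tau>1 r" for x
  proof -
    have dh: "(h has_field_derivative deriv h x) (at x)" by (rule holomorphic_derivI[OF h(1) open_ball x])
    have "((\<lambda>x. exp (h x)) has_field_derivative exp (h x) * deriv h x) (at x)"
      by (rule derivative_eq_intros dh refl | simp)+
    then have "(deriv s has_field_derivative exp (h x) * deriv h x) (at x)"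
      by (rule has_field_derivative_transform_within_open[OF _ open_ball x]) (simp add: h(2))
    then have "deriv (deriv s) x = exp (h x) * deriv h x" by (rule DERIV_imp_deriv)
    then have dh': "deriv h x = deriv (deriv s) x / deriv s x"
      using h(2)[OF x] bspec[OF s(8) x] by simp
    have dt: "(t has_field_derivative of_nat e1 * s x ^ (e1 - 1) * deriv s x) (at x)"
      by (rule deriv_root_power[OF s(4) open_ball x T])
    have "((\<lambda>x. exp (h x / 2 - c2 / 2 * Ln (1 - t x))) has_field_derivative
        exp (h x / 2 - c2 / 2 * Ln (1 - t x)) *
        (deriv h x / 2 - c2 / 2 * (inverse (1 - t x) * (0 - of_nat e1 * s x ^ (e1 - 1) * deriv s x)))) (at x)"
      by (intro DERIV_chain2[OF DERIV_exp] DERIV_diff DERIV_cdivide DERIV_cmult dh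
          DERIV_chain2[OF has_field_derivative_Ln] DERIV_const dt one_minus_not_nonpos t1 x)
    also have "deriv h x / 2 - c2 / 2 * (inverse (1 - t x) * (0 - of_nat e1 * s x ^ (e1 - 1) * deriv s x)) = \<Lambda> x"
          proof -
      have "X / 2 - c2 / 2 * (inverse V * (0 - N)) = (X + c2 * N / V) / 2" for X V N
        by (simp add: inverse_eq_divide add_divide_distrib)
      then show ?thesis unfolding \<Lambda>_def half_logderiv_root_def dh' T[OF x] .
    qed
    finally show ?thesis unfolding y_def by (simp add: mult.commute)
  qed
  have hl: "hld x = \<Lambda> x" if x: "x \<in> ball \<tau>1 r - {\<tau>1}" for x
    unfolding \<Lambda>_def
    by (rule half_logderiv_power[OF s(4) open_ball _ T e(1)])
      (use x s(8,9) regularD in \<open>auto simp: c1_def\<close>)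
  have S: "((\<Lambda> x)\<^sup>2 - deriv \<Lambda> x) * (t x * (1 - t x)) = - of_real (a * b) * (deriv t x)\<^sup>2"
    if x: "x \<in> ball \<tau>1 r - {\<tau>1}" for x
  proof -
    have xr: "x \<in> regular" using x s(9) by blast
    have "\<forall>\<^sub>F y in nhds x. y \<in> ball \<tau>1 r - {\<tau>1}" using x by (intro eventually_nhds_in_open) auto
    then have "\<forall>\<^sub>F y in nhds x. hld y = \<Lambda> y" by eventually_elim (rule hl)
    then have "deriv hld x = deriv \<Lambda> x" by (rule deriv_cong_ev) simp
    with schwarz_constant[OF a xr] have
      "((\<Lambda> x)\<^sup>2 - deriv \<Lambda> x) * (t x * (1 - t x)) / (deriv t x)\<^sup>2 = - of_real (a * b)"
      unfolding schwarz_def hl[OF x] b by simp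
    then show ?thesis using deriv_t_nonzero[OF xr] by (simp add: divide_eq_eq)
  qed

  \<comment> \<open>The inverse of the coordinate s, through which y becomes a function of
    s.\<close>
  obtain \<zeta> where \<zeta>: "\<zeta> holomorphic_on s ` ball \<tau>1 r" "\<And>x. x \<in> ball \<tau>1 r \<Longrightarrow> \<zeta> (s x) = x"
    using holomorphic_has_inverse[OF s(4) open_ball s(5)] by metis
  have "open (s ` ball \<tau>1 r)" by (rule open_mapping_thm3[OF s(4) open_ball s(5)])
  moreover have "0 \<in> s ` ball \<tau>1 r" using s(1,6) by (metis centre_in_ball imageI)
  ultimately obtain R where R: "R > 0" "ball 0 R \<subseteq> s ` ball \<tau>1 r" by (rule openE)
  define \<psi> where "\<psi> = (\<lambda>\<sigma>. y (\<zeta> \<sigma>))"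
  have \<psi>_hol: "\<psi> holomorphic_on ball 0 R"
    unfolding \<psi>_def
    by (rule holomorphic_on_compose_gen[unfolded o_def, OF holomorphic_on_subset[OF \<zeta>(1) R(2)] y_hol])
      (use R(2) \<zeta>(2) in force)
  have d\<psi>: "deriv \<psi> holomorphic_on ball 0 R" by (rule holomorphic_deriv[OF \<psi>_hol open_ball])
  define V where "V = {x \<in> ball \<tau>1 r. s x \<in> ball 0 R}"
  have "open V"
    using continuous_open_preimage[OF holomorphic_on_imp_continuous_on[OF s(4)] open_ball open_ball, of 0 R]
    by (simp add: V_def vimage_def Int_def)
  have y\<psi>: "y x = \<psi> (s x)" if "x \<in> V" for x using that \<zeta>(2) by (simp add: \<psi>_def V_def)
  have E1: "\<Lambda> x * y x = deriv \<psi> (s x) * deriv s x" if x: "x \<in> V" for x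
  proof -
    have xb: "x \<in> ball \<tau>1 r" "s x \<in> ball 0 R" using x by (auto simp: V_def)
    have "((\<lambda>x. \<psi> (s x)) has_field_derivative deriv \<psi> (s x) * deriv s x) (at x)"
      by (rule DERIV_chain2[OF holomorphic_derivI[OF \<psi>_hol open_ball xb(2)] holomorphic_derivI[OF s(4) open_ball xb(1)]])
    then have "(y has_field_derivative deriv \<psi> (s x) * deriv s x) (at x)"
      by (rule has_field_derivative_transform_within_open[OF _ \<open>open V\<close> x]) (simp add: y\<psi>)
    then show ?thesis using y_deriv[OF xb(1)] DERIV_unique by blast
  qed
  have E2: "deriv \<Lambda> x * y x + \<Lambda> x * (\<Lambda> x * y x) = deriv (deriv \<psi>) (s x) * (deriv s x)\<^sup>2 + deriv \<psi> (s x) * deriv (deriv s) x"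
    if x: "x \<in> V" for x
  proof -
    have xb: "x \<in> ball \<tau>1 r" "s x \<in> ball 0 R" using x by (auto simp: V_def)
    have "((\<lambda>x. \<Lambda> x * y x) has_field_derivative deriv \<Lambda> x * y x + \<Lambda> x * y x * \<Lambda> x) (at x)"
      by (rule DERIV_mult[OF holomorphic_derivI[OF \<Lambda>_hol open_ball xb(1)] y_deriv[OF xb(1)]])
    moreover have "((\<lambda>x. deriv \<psi> (s x) * deriv s x) has_field_derivative
       deriv (deriv \<psi>) (s x) * deriv s x * deriv s x + deriv (deriv s) x * deriv \<psi> (s x)) (at x)"
      by (rule DERIV_mult[OF DERIV_chain2[OF holomorphic_derivI[OF d\<psi> open_ball xb(2)]
              holomorphic_derivI[OF s(4) open_ball xb(1)]] holomorphic_derivI[OF ds open_ball xb(1)]])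
    then have "((\<lambda>x. \<Lambda> x * y x) has_field_derivative
       deriv (deriv \<psi>) (s x) * deriv s x * deriv s x + deriv (deriv s) x * deriv \<psi> (s x)) (at x)"
      by (rule has_field_derivative_transform_within_open[OF _ \<open>open V\<close> x]) (simp add: E1)
    ultimately have "deriv \<Lambda> x * y x + \<Lambda> x * y x * \<Lambda> x
      = deriv (deriv \<psi>) (s x) * deriv s x * deriv s x + deriv (deriv s) x * deriv \<psi> (s x)"
      by (rule DERIV_unique)
    then show ?thesis by (simp add: algebra_simps power2_eq_square)
  qed
  have ode: "\<sigma>\<^sup>2 * deriv (deriv \<psi>) \<sigma> = \<sigma> ^ e1 * (\<sigma>\<^sup>2 * deriv (deriv \<psi>) \<sigma>
       + of_real (1 + (a + b) * real e1) * (\<sigma> * deriv \<psi> \<sigma>) + of_real (a * b * (real e1)\<^sup>2) * \<psi> \<sigma>)"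
    if \<sigma>: "\<sigma> \<in> ball 0 R" for \<sigma>
  proof (cases "\<sigma> = 0")
    case True
    then show ?thesis using e by (simp add: zero_power)
  next
    case False
    obtain x where x: "x \<in> ball \<tau>1 r" "s x = \<sigma>" using R(2) \<sigma> by blast
    then have xV: "x \<in> V" using \<sigma> by (simp add: V_def)
    have xn: "x \<in> ball \<tau>1 r - {\<tau>1}" using x False s(6) by auto
    have p: "\<sigma> ^ e1 = \<sigma> * \<sigma> ^ (e1 - 1)" using e by (cases e1) auto
    \<comment> \<open>Since b = a + 1/e3, the sum a + b equals 1 - 1/e1 - 1/e2.\<close>
    have A: "complex_of_real (1 + (a + b) * real e1) = c2 * of_nat e1"
    proof -
      have "1 + (a + b) * real e1 = (1 - 1 / real e2) * real e1"
        using e by (simp add: a b field_simps)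
      then show ?thesis by (simp add: c2_def)
    qed
    have "\<sigma>\<^sup>2 * deriv (deriv \<psi>) \<sigma> = \<sigma> * \<sigma> ^ (e1 - 1) * (\<sigma>\<^sup>2 * deriv (deriv \<psi>) \<sigma>
       + of_real (1 + (a + b) * real e1) * (\<sigma> * deriv \<psi> \<sigma>) + of_real (a * b) * (of_nat e1)\<^sup>2 * y x)"
    proof (rule hypergeometric_ode_algebra[OF False _ _ _ _ _ _ _ A])
      show "\<sigma> ^ (e1 - 1) \<noteq> 0" using False by simp
      show "deriv s x \<noteq> 0" using s(8) x(1) by blast
      show "1 - \<sigma> * \<sigma> ^ (e1 - 1) \<noteq> 0" using ne1[OF x(1)] x(2) p by simp
      show "\<Lambda> x = (deriv (deriv s) x / deriv s x
          + c2 * (of_nat e1 * \<sigma> ^ (e1 - 1) * deriv s x) / (1 - \<sigma> * \<sigma> ^ (e1 - 1))) / 2"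
        unfolding \<Lambda>_def half_logderiv_root_def x(2) p ..
      show "\<Lambda> x * y x = deriv \<psi> \<sigma> * deriv s x" using E1[OF xV] x(2) by simp
      show "deriv \<Lambda> x * y x + \<Lambda> x * (\<Lambda> x * y x) = deriv (deriv \<psi>) \<sigma> * (deriv s x)\<^sup>2 + deriv \<psi> \<sigma> * deriv (deriv s) x"
        using E2[OF xV] x(2) by simp
      show "((\<Lambda> x)\<^sup>2 - deriv \<Lambda> x) * (\<sigma> * \<sigma> ^ (e1 - 1) * (1 - \<sigma> * \<sigma> ^ (e1 - 1)))
          = - of_real (a * b) * (of_nat e1 * \<sigma> ^ (e1 - 1) * deriv s x)\<^sup>2"
      proof -
        have "deriv t x = of_nat e1 * \<sigma> ^ (e1 - 1) * deriv s x"
          using DERIV_imp_deriv[OF deriv_root_power[OF s(4) open_ball x(1) T]] x(2) by simp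
        moreover have "t x = \<sigma> * \<sigma> ^ (e1 - 1)" using T[OF x(1)] x(2) p by simp
        ultimately show ?thesis using S[OF xn] by simp
      qed
    qed
    then show ?thesis unfolding p using y\<psi>[OF xV] x(2) by simp
  qed
  \<comment> \<open>The value of y at \<tau>1, hence not 0. Dividing by it gives the first local
    solution the coefficient 1 and makes C the ratio of the two Taylor coefficients that determine
    \<psi>.\<close>
  define A where "A = \<psi> 0"
  define C where "C = deriv \<psi> 0 / A"
  have "\<tau>1 \<in> V" using s(1,6) R(1) by (simp add: V_def)
  then have "A = y \<tau>1" using y\<psi>[of \<tau>1] s(6) by (simp add: A_def)
  then have A0: "A \<noteq> 0" by (simp add: y_def)
  obtain r' where r': "r' > 0" "ball \<tau>1 r' \<subseteq> V" using openE[OF \<open>open V\<close> \<open>\<tau>1 \<in> V\<close>] by blast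
  have sub: "ball \<tau>1 r' \<subseteq> ball \<tau>1 r" using r'(2) by (auto simp: V_def)
  show thesis
  proof (rule that[of r' s y A C])
    show "\<forall>x\<in>ball \<tau>1 r'. y x = A * (hyp2F1 a b (1 - 1 / real e1) (t x)
       + C * s x * hyp2F1 (a + 1 / real e1) (b + 1 / real e1) (1 + 1 / real e1) (t x))"
    proof
      fix x assume "x \<in> ball \<tau>1 r'"
      then have x: "x \<in> V" "x \<in> ball \<tau>1 r" "s x \<in> ball 0 R" using r'(2) by (auto simp: V_def)
      have "A * C = deriv \<psi> 0" using A0 by (simp add: C_def)
      then show "y x = A * (hyp2F1 a b (1 - 1 / real e1) (t x)
       + C * s x * hyp2F1 (a + 1 / real e1) (b + 1 / real e1) (1 + 1 / real e1) (t x))"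
        using hypergeometric_ode_solution[OF e(2) \<psi>_hol x(3) ode]
        unfolding y\<psi>[OF x(1)] T[OF x(2)] A_def[symmetric] by (simp add: distrib_left mult.assoc[symmetric])
    qed
    show "\<forall>x\<in>ball \<tau>1 r' - {\<tau>1}. x \<in> regular \<and> s x \<noteq> 0" using s(9) sub by blast
    show "s holomorphic_on ball \<tau>1 r'" "y holomorphic_on ball \<tau>1 r'"
      using s(4) y_hol sub holomorphic_on_subset by blast+
    show "ball \<tau>1 r' \<subseteq> \<H>" using s(3) sub by blast
    show "\<forall>x\<in>ball \<tau>1 r'. deriv s x \<noteq> 0" using s(8) sub by blast
    show "\<forall>x\<in>ball \<tau>1 r'. t x = s x ^ e1" using s(7) sub by blast
    show "\<forall>x\<in>ball \<tau>1 r'. norm (t x) < 1" using t1 sub by blast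
    show "\<forall>x\<in>ball \<tau>1 r'. (y x)\<^sup>2 = deriv s x * exp (- c2 * Ln (1 - t x))" using y2 sub by blast
  qed (use r' s(6) A0 in auto)
qed

end

section \<open>Orders at the elliptic points\<close>

text \<open>Order E of b in a coordinate s in which T is s^e, with a zero-free factor \<kappa>. The
  equations are required off z only, because \<open>base\<close> may take a default value at
  z.\<close>

definition local_form :: "complex \<Rightarrow> (complex \<Rightarrow> complex) \<Rightarrow> (complex \<Rightarrow> complex) \<Rightarrow> nat \<Rightarrow> int \<Rightarrow> bool" where
  "local_form z b T e E \<longleftrightarrow> (\<exists>r s \<kappa>. 0 < r \<and> s holomorphic_on ball z r \<and> s z = 0 \<and>
     \<kappa> holomorphic_on ball z r \<and> (\<forall>x\<in>ball z r. \<kappa> x \<noteq> 0) \<and>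
     (\<forall>x\<in>ball z r - {z}. s x \<noteq> 0 \<and> T x = s x ^ e \<and> b x = s x powi E * \<kappa> x))"

lemma local_form_tendsto:
  assumes "local_form z b T e E" "E + int e * j \<ge> 0"
  shows "\<exists>l. ((\<lambda>x. b x * T x powi j) \<longlongrightarrow> l) (at z)"
proof -
  obtain r s \<kappa> where l: "0 < r" "s holomorphic_on ball z r" "s z = 0" "\<kappa> holomorphic_on ball z r"
     "\<forall>x\<in>ball z r - {z}. s x \<noteq> 0 \<and> T x = s x ^ e \<and> b x = s x powi E * \<kappa> x"
    using assms(1) unfolding local_form_def by blast
  define n where "n = nat (E + int e * j)"
  have n: "int n = E + int e * j" using assms(2) by (simp add: n_def)
  have "((\<lambda>x. s x ^ n * \<kappa> x) \<longlongrightarrow> s z ^ n * \<kappa> z) (at z)"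
    by (intro tendsto_intros tendsto_if_holomorphic[OF l(2,1)] tendsto_if_holomorphic[OF l(4,1)])
  moreover have "\<forall>\<^sub>F x in at z. s x ^ n * \<kappa> x = b x * T x powi j"
  proof (rule eventually_punctured_ball[OF l(1)])
    fix x assume "x \<in> ball z r - {z}"
    with l(5) have x: "s x \<noteq> 0" "T x = s x ^ e" "b x = s x powi E * \<kappa> x" by blast+
    have "s x ^ n = s x powi (E + int e * j)" unfolding n[symmetric] by simp
    also have "\<dots> = s x powi E * (s x ^ e) powi j"
      using x(1) by (simp add: power_int_add power_int_mult)
    finally show "s x ^ n * \<kappa> x = b x * T x powi j" by (simp add: x)
  qed
  ultimately have "((\<lambda>x. b x * T x powi j) \<longlongrightarrow> s z ^ n * \<kappa> z) (at z)"
    by (rule Lim_transform_eventually)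
  then show ?thesis by blast
qed

text \<open>The factor T^j / b has order e j - E in s, which is positive, and f stays
  bounded.\<close>

lemma local_form_quotient_tendsto:
  assumes "local_form z b T e E" "int e * j > E" "isCont f z"
  shows "((\<lambda>x. f x / b x * T x powi j) \<longlongrightarrow> 0) (at z)"
proof -
  obtain r s \<kappa> where l: "0 < r" "s holomorphic_on ball z r" "s z = 0" "\<kappa> holomorphic_on ball z r"
     "\<forall>x\<in>ball z r. \<kappa> x \<noteq> 0"
     "\<forall>x\<in>ball z r - {z}. s x \<noteq> 0 \<and> T x = s x ^ e \<and> b x = s x powi E * \<kappa> x"
    using assms(1) unfolding local_form_def by blast
  define n where "n = nat (int e * j - E)"
  have n: "int n = int e * j - E" "n > 0" using assms(2) by (simp_all add: n_def)
  have "(f \<longlongrightarrow> f z) (at z)" using assms(3) by (simp add: isCont_def)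
  moreover have "\<kappa> z \<noteq> 0" using l(1,5) by simp
  ultimately have "((\<lambda>x. f x / \<kappa> x * s x ^ n) \<longlongrightarrow> f z / \<kappa> z * s z ^ n) (at z)"
    by (intro tendsto_intros tendsto_if_holomorphic[OF l(2,1)] tendsto_if_holomorphic[OF l(4,1)])
  then have "((\<lambda>x. f x / \<kappa> x * s x ^ n) \<longlongrightarrow> 0) (at z)" using n(2) l(3) by (simp add: zero_power)
  moreover have "\<forall>\<^sub>F x in at z. f x / \<kappa> x * s x ^ n = f x / b x * T x powi j"
  proof (rule eventually_punctured_ball[OF l(1)])
    fix x assume "x \<in> ball z r - {z}"
    with l(5,6) have x: "s x \<noteq> 0" "T x = s x ^ e" "b x = s x powi E * \<kappa> x" "\<kappa> x \<noteq> 0" by blast+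
    have "s x ^ n = s x powi (int e * j - E)" unfolding n(1)[symmetric] by simp
    also have "\<dots> = (s x ^ e) powi j / s x powi E"
      using x(1) by (simp add: power_int_diff power_int_mult)
    finally show "f x / \<kappa> x * s x ^ n = f x / b x * T x powi j" by (simp add: x)
  qed
  ultimately show ?thesis by (rule Lim_transform_eventually)
qed

definition fl :: "nat \<Rightarrow> nat \<Rightarrow> int" where
  "fl m e = \<lfloor>real m * (1 - 1 / real e)\<rfloor>"

text \<open>At a zero of t or 1 - t of order e, the power t'^m has order (e - 1) m. The first bound
  says that removing e times the floor leaves a nonnegative order, the second that the remainder is
  below e.\<close>

lemma fl_bounds:
  assumes "e > 0"
  shows "int e * fl m e \<le> (int e - 1) * int m" "(int e - 1) * int m < int e * (fl m e + 1)"
proof -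
  have eq: "real e * (real m * (1 - 1 / real e)) = (real e - 1) * real m"
    using assms by (simp add: field_simps)
  have "of_int (fl m e) \<le> real m * (1 - 1 / real e)" unfolding fl_def by linarith
  then have "real e * of_int (fl m e) \<le> real e * (real m * (1 - 1 / real e))" by (rule mult_left_mono) simp
  then have "real_of_int (int e * fl m e) \<le> real_of_int ((int e - 1) * int m)" unfolding eq by simp
  then show "int e * fl m e \<le> (int e - 1) * int m" by (simp only: of_int_le_iff)
  have "real m * (1 - 1 / real e) < of_int (fl m e) + 1" unfolding fl_def by linarith
  then have "real e * (real m * (1 - 1 / real e)) < real e * (of_int (fl m e) + 1)"
    using assms by (intro mult_strict_left_mono) auto
  then have "real_of_int ((int e - 1) * int m) < real_of_int (int e * (fl m e + 1))" unfolding eq by simp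
  then show "(int e - 1) * int m < int e * (fl m e + 1)" by (simp only: of_int_less_iff)
qed

lemma power_int_root_power:
  fixes s u :: complex
  assumes "s \<noteq> 0" "e > 0"
  shows "(of_nat e * s ^ (e - 1) * u) ^ m * (s ^ e) powi (- f)
     = s powi ((int e - 1) * int m - int e * f) * (of_nat e * u) ^ m"
proof -
  have "s powi ((int e - 1) * int m - int e * f) = s powi (int ((e - 1) * m)) * s powi (int e * (- f))"
    using assms by (subst power_int_add[symmetric]) (auto simp: of_nat_diff)
  also have "s powi (int ((e - 1) * m)) = (s ^ (e - 1)) ^ m" by (simp only: power_int_of_nat power_mult)
  also have "s powi (int e * (- f)) = (s ^ e) powi (- f)" by (simp only: power_int_mult power_int_of_nat)
  finally show ?thesis by (simp add: power_mult_distrib)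
qed

section \<open>Orders of the common factor of all forms of a given weight\<close>

context triangle_setting
begin

definition base :: "nat \<Rightarrow> complex \<Rightarrow> complex" where
  "base m z = deriv t z ^ m * t z powi (- fl m e1) * (1 - t z) powi (- fl m e2)"

lemma base_nonzero: "z \<in> regular \<Longrightarrow> base m z \<noteq> 0"
  using deriv_t_nonzero regularD by (auto simp: base_def)

lemma base_holomorphic: "base m holomorphic_on regular"
  unfolding base_def[abs_def]
  by (intro holomorphic_intros t_holomorphic_regular open_regular disjI2 ballI) (use regularD in auto)

lemma base_meromorphic: "base m meromorphic_on \<H>"
  unfolding base_def[abs_def] by (intro meromorphic_intros t_meromorphic)

lemma base_mobius:
  "A \<in> \<Gamma> \<Longrightarrow> z \<in> regular \<Longrightarrow> base m (mobius A z) = autom_factor A z ^ (2 * m) * base m z"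
  by (simp add: base_def deriv_t_mobius t_invariant regularD(1) power_mult_distrib power_mult)

lemma base_local_form_tau1:
  "local_form \<tau>1 (base m) t e1 ((int e1 - 1) * int m - int e1 * fl m e1)"
proof -
  have e: "e1 > 0" using order_ge_2 by simp
  obtain s r where "chart t e1 \<tau>1 1 s r"
    using chart_tau1[OF zero_less_one] by blast
  note s = chartD[OF this]
  have T: "t x = s x ^ e1" if "x \<in> ball \<tau>1 r" for x using s(7) that by blast
  have ne1: "1 - s x ^ e1 \<noteq> 0" if "x \<in> ball \<tau>1 r" for x
  proof (cases "x = \<tau>1")
    case False
    then have "x \<in> regular" using s(9) that by blast
    then show ?thesis using regularD(4) T[OF that] by auto
  qed (use s(6) e in \<open>simp add: zero_power\<close>)
  define \<kappa> where "\<kappa> = (\<lambda>x. (of_nat e1 * deriv s x) ^ m * (1 - s x ^ e1) powi (- fl m e2))"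
  have "\<kappa> holomorphic_on ball \<tau>1 r"
    unfolding \<kappa>_def by (intro holomorphic_intros s open_ball disjI2 ballI) (use ne1 in auto)
  moreover have "\<kappa> x \<noteq> 0" if "x \<in> ball \<tau>1 r" for x
    using ne1[OF that] s(8) that e by (simp add: \<kappa>_def)
  moreover have "base m x = s x powi ((int e1 - 1) * int m - int e1 * fl m e1) * \<kappa> x"
    if x: "x \<in> ball \<tau>1 r - {\<tau>1}" for x
  proof -
    have xb: "x \<in> ball \<tau>1 r" and nz: "s x \<noteq> 0" using x s(9) by auto
    have "deriv t x = of_nat e1 * s x ^ (e1 - 1) * deriv s x"
      by (rule DERIV_imp_deriv[OF deriv_root_power[OF s(4) open_ball xb T]])
    then show ?thesis
      unfolding base_def \<kappa>_def T[OF xb] mult.assoc[symmetric] power_int_root_power[OF nz e, symmetric]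
      by simp
  qed
  ultimately show ?thesis unfolding local_form_def
    using s by (intro exI[of _ r] exI[of _ s] exI[of _ \<kappa>]) (auto simp: T)
qed

lemma base_local_form_tau2:
  "local_form \<tau>2 (base m) (\<lambda>x. 1 - t x) e2 ((int e2 - 1) * int m - int e2 * fl m e2)"
proof -
  have e: "e2 > 0" using order_ge_2 by simp
  obtain s r where "chart (\<lambda>z. 1 - t z) e2 \<tau>2 1 s r"
    using chart_tau2[OF zero_less_one] by blast
  note s = chartD[OF this]
  have T: "1 - t x = s x ^ e2" if "x \<in> ball \<tau>2 r" for x using s(7) that by blast
  have T': "t x = 1 - s x ^ e2" if "x \<in> ball \<tau>2 r" for x using T[OF that] by (simp add: algebra_simps)
  have ne1: "1 - s x ^ e2 \<noteq> 0" if "x \<in> ball \<tau>2 r" for x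
  proof (cases "x = \<tau>2")
    case False
    then have "x \<in> regular" using s(9) that by blast
    then show ?thesis using regularD(3) T'[OF that] by auto
  qed (use s(6) e in \<open>simp add: zero_power\<close>)
  define \<kappa> where "\<kappa> = (\<lambda>x. (of_nat e2 * - deriv s x) ^ m * (1 - s x ^ e2) powi (- fl m e1))"
  have "\<kappa> holomorphic_on ball \<tau>2 r"
    unfolding \<kappa>_def by (intro holomorphic_intros s open_ball disjI2 ballI) (use ne1 in auto)
  moreover have "\<kappa> x \<noteq> 0" if "x \<in> ball \<tau>2 r" for x
    using ne1[OF that] s(8) that e by (simp add: \<kappa>_def)
  moreover have "base m x = s x powi ((int e2 - 1) * int m - int e2 * fl m e2) * \<kappa> x"
    if x: "x \<in> ball \<tau>2 r - {\<tau>2}" for x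
  proof -
    have xb: "x \<in> ball \<tau>2 r" and nz: "s x \<noteq> 0" using x s(9) by auto
    have "((\<lambda>x. 1 - s x ^ e2) has_field_derivative 0 - of_nat e2 * s x ^ (e2 - 1) * deriv s x) (at x)"
      by (intro DERIV_diff DERIV_const deriv_root_power[OF s(4) open_ball xb refl])
    then have "(t has_field_derivative 0 - of_nat e2 * s x ^ (e2 - 1) * deriv s x) (at x)"
      by (rule has_field_derivative_transform_within_open[OF _ open_ball xb]) (simp add: T')
    then have "deriv t x = of_nat e2 * s x ^ (e2 - 1) * - deriv s x" using DERIV_imp_deriv by fastforce
    then show ?thesis
      unfolding base_def \<kappa>_def T[OF xb] mult.assoc[symmetric] power_int_root_power[OF nz e, symmetric]
      unfolding T'[OF xb] by (simp add: mult_ac)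
  qed
  ultimately show ?thesis unfolding local_form_def
    using s by (intro exI[of _ r] exI[of _ s] exI[of _ \<kappa>]) (auto simp: T)
qed

text \<open>In the coordinate s at the pole of \<open>t\<close>, the derivative t' has order -(e3 +
  1), and the inverses of t and of 1 - t both have order e3.\<close>

lemma base_local_form_tau3:
  "local_form \<tau>3 (base m) (\<lambda>x. inverse (t x)) e3
     (int e3 * fl m e1 + int e3 * fl m e2 - (int e3 + 1) * int m)"
proof -
  have e: "e3 > 0" using order_ge_2 by simp
  obtain s r where "chart (\<lambda>z. inverse (t z)) e3 \<tau>3 1 s r"
    using chart_tau3[OF zero_less_one] by blast
  note s = chartD[OF this]
  have T: "inverse (t x) = s x ^ e3" if "x \<in> ball \<tau>3 r" for x using s(7) that by blast
  have T': "t x = inverse (s x ^ e3)" if "x \<in> ball \<tau>3 r" for x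
    unfolding T[OF that, symmetric] by simp
  have ne1: "s x ^ e3 - 1 \<noteq> 0" if "x \<in> ball \<tau>3 r" for x
  proof (cases "x = \<tau>3")
    case False
    then have "x \<in> regular" using s(9) that by blast
    then show ?thesis using regularD(4) T'[OF that] by auto
  qed (use s(6) e in \<open>simp add: zero_power\<close>)
  define \<kappa> where "\<kappa> = (\<lambda>x. (- (of_nat e3 * deriv s x)) ^ m * (s x ^ e3 - 1) powi (- fl m e2))"
  have "\<kappa> holomorphic_on ball \<tau>3 r"
    unfolding \<kappa>_def by (intro holomorphic_intros s open_ball disjI2 ballI) (use ne1 in auto)
  moreover have "\<kappa> x \<noteq> 0" if "x \<in> ball \<tau>3 r" for x
    using ne1[OF that] s(8) that e by (simp add: \<kappa>_def)
  moreover have "base m x = s x powi (int e3 * fl m e1 + int e3 * fl m e2 - (int e3 + 1) * int m) * \<kappa> x"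
    if x: "x \<in> ball \<tau>3 r - {\<tau>3}" for x
  proof -
    have xb: "x \<in> ball \<tau>3 r" and nz: "s x \<noteq> 0" using x s(9) by auto
    have "deriv t x = - (of_nat e3 * deriv s x / s x ^ Suc e3)"
      by (rule DERIV_imp_deriv[OF deriv_inverse_root_power[OF s(4) open_ball xb T' e nz]])
    then have 1: "deriv t x ^ m = (- (of_nat e3 * deriv s x)) ^ m * s x powi (- ((int e3 + 1) * int m))"
    proof -
      have "(int e3 + 1) * int m = int (Suc e3 * m)" by (simp add: algebra_simps)
      then have "s x powi (- ((int e3 + 1) * int m)) = inverse ((s x ^ Suc e3) ^ m)"
        by (simp only: power_int_minus power_int_of_nat power_mult)
      moreover have "deriv t x = - (of_nat e3 * deriv s x) * inverse (s x ^ Suc e3)"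
        using \<open>deriv t x = _\<close> by (simp add: divide_inverse del: power_Suc)
      ultimately show ?thesis by (simp only: power_mult_distrib power_inverse)
    qed
    have 2: "t x powi (- fl m e1) = s x powi (int e3 * fl m e1)"
      unfolding T'[OF xb] by (simp add: power_int_mult power_int_minus power_int_inverse)
    have 3: "(1 - t x) powi (- fl m e2) = (s x ^ e3 - 1) powi (- fl m e2) * s x powi (int e3 * fl m e2)"
    proof -
      have "1 - t x = (s x ^ e3 - 1) * inverse (s x ^ e3)"
        unfolding T'[OF xb] using nz by (simp add: algebra_simps)
      then show ?thesis
        by (simp add: power_int_mult_distrib power_int_mult power_int_minus power_int_inverse)
    qed
    have "s x powi (int e3 * fl m e1 + int e3 * fl m e2 - (int e3 + 1) * int m)
        = s x powi (- ((int e3 + 1) * int m)) * s x powi (int e3 * fl m e1) * s x powi (int e3 * fl m e2)"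
      using nz by (simp flip: power_int_add add: algebra_simps)
    then show ?thesis unfolding base_def 1 2 3 \<kappa>_def by (simp add: mult_ac)
  qed
  ultimately show ?thesis unfolding local_form_def
    using s by (intro exI[of _ r] exI[of _ s] exI[of _ \<kappa>]) (auto simp: T)
qed

end

section \<open>The basis\<close>

lemma sum_apply: "(\<Sum>j\<in>S. h j) z = (\<Sum>j\<in>S. h j z)"
  for h :: "'i \<Rightarrow> 'a \<Rightarrow> 'b::comm_monoid_add"
  by (induction S rule: infinite_finite_induct) auto

context triangle_setting
begin

text \<open>The product formulas involve negative powers of t and 1 - t, which take default values
  at elliptic points. \<open>remove_sings\<close> replaces these by limits; the value 0 elsewhere is
  the convention of \<open>automorphic_forms\<close>.\<close>

definition extend :: "(complex \<Rightarrow> complex) \<Rightarrow> complex \<Rightarrow> complex" where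
  "extend g z = (if z \<in> \<H> then remove_sings g z else 0)"

text \<open>The transformation law carries a finite limit at \<tau>1, \<tau>2 or \<tau>3 to its
  whole orbit, and these orbits contain all points that are not regular. Holomorphy follows by
  removing singularities, the functional equation by passing to limits.\<close>

lemma extend_in_forms:
  assumes mero: "g meromorphic_on \<H>"
    and hol: "g holomorphic_on regular"
    and eq: "\<And>A z. A \<in> \<Gamma> \<Longrightarrow> z \<in> regular \<Longrightarrow> g (mobius A z) = autom_factor A z ^ k * g z"
    and lim: "\<And>\<tau>. \<tau> \<in> {\<tau>1, \<tau>2, \<tau>3} \<Longrightarrow> \<exists>l. (g \<longlongrightarrow> l) (at \<tau>)"
  shows "extend g \<in> automorphic_forms \<Gamma> k"
proof -
  have lim_mobius: "(g \<longlongrightarrow> autom_factor A z ^ k * l) (at (mobius A z))"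
    if A: "A \<in> \<Gamma>" and z: "z \<in> \<H>" and l: "(g \<longlongrightarrow> l) (at z)" for A z l
  proof -
    have "isCont (autom_factor A) z"
      using has_field_derivative_autom_factor DERIV_isCont by blast
    then have "((\<lambda>x. autom_factor A x ^ k * g x) \<longlongrightarrow> autom_factor A z ^ k * l) (at z)"
      unfolding isCont_def by (intro tendsto_intros l)
    moreover have "\<forall>\<^sub>F x in at z. autom_factor A x ^ k * g x = g (mobius A x)"
      using regular_eventually[OF z] by eventually_elim (simp add: eq[OF A])
    ultimately have "((\<lambda>x. g (mobius A x)) \<longlongrightarrow> autom_factor A z ^ k * l) (at z)"
      by (rule Lim_transform_eventually)
    then show ?thesis
      unfolding filtermap_mobius[OF A z, symmetric] by (simp add: filterlim_def filtermap_filtermap)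
  qed
  have ex: "\<exists>l. (g \<longlongrightarrow> l) (at z)" if z: "z \<in> \<H>" for z
  proof -
    have orb: "\<exists>l. (g \<longlongrightarrow> l) (at z)" if \<tau>: "\<tau> \<in> {\<tau>1, \<tau>2, \<tau>3}" "same_orbit \<Gamma> \<tau> z" for \<tau>
    proof -
      obtain A where "A \<in> \<Gamma>" "z = mobius A \<tau>" using \<tau>(2) by (auto simp: same_orbit_def)
      moreover have "\<tau> \<in> \<H>" using \<tau>(1) tau_in by blast
      ultimately show ?thesis using lim[OF \<tau>(1)] lim_mobius by blast
    qed
    show ?thesis
    proof (cases "z \<in> regular")
      case True
      then have "isCont g z" by (rule isCont_if_holomorphic[OF hol open_regular])
      then show ?thesis by (auto simp: isCont_def)
    next
      case False
      then show ?thesis using regular_or_elliptic[OF z] orb by blast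
    qed
  qed
  have ana: "remove_sings g analytic_on {z}" if z: "z \<in> \<H>" for z
  proof -
    obtain l where "(g \<longlongrightarrow> l) (at z)" using ex[OF z] by blast
    then show ?thesis using mero z by (intro remove_sings_analytic_at) (auto simp: meromorphic_on_altdef)
  qed
  then have "remove_sings g analytic_on \<H>" by (subst analytic_on_analytic_at) blast
  then have "remove_sings g holomorphic_on \<H>" by (rule analytic_imp_holomorphic)
  then have "extend g holomorphic_on \<H>"
    by (rule holomorphic_transform) (simp add: extend_def)
  moreover have "extend g (mobius A z) = autom_factor A z ^ k * extend g z"
    if A: "A \<in> \<Gamma>" and z: "z \<in> \<H>" for A z
  proof -
    obtain l where l: "(g \<longlongrightarrow> l) (at z)" using ex[OF z] by blast
    have "remove_sings g (mobius A z) = autom_factor A z ^ k * l"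
      by (rule remove_sings_eqI[OF lim_mobius[OF A z l]])
    moreover have "remove_sings g z = l" using l by (rule remove_sings_eqI)
    ultimately show ?thesis using z mobius_closed[OF A z] by (simp add: extend_def)
  qed
  ultimately show ?thesis by (auto simp: automorphic_forms_def extend_def)
qed

lemma extend_regular:
  assumes "g holomorphic_on regular" "z \<in> regular"
  shows "extend g z = g z"
proof -
  have "g analytic_on {z}"
    using assms open_regular by (meson analytic_on_open analytic_on_subset empty_subsetI insert_subset)
  then show ?thesis using regularD(1)[OF assms(2)] by (simp add: extend_def)
qed

lemma poly_t_vanishes:
  assumes "\<And>z. z \<in> regular \<Longrightarrow> poly P (t z) = 0"
  shows "P = 0"
proof (rule ccontr)
  assume "P \<noteq> 0"
  then have "finite {x. poly P x = 0}" by (rule poly_roots_finite)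
  then have "\<forall>\<^sub>F z in at \<tau>1. \<forall>x\<in>{x. poly P x = 0}. t z \<noteq> x"
    by (rule eventually_ball_finite) (use eventually_t_neq[OF tau_in(1)] in blast)
  with regular_eventually[OF tau_in(1)] have "\<forall>\<^sub>F z in at \<tau>1. False"
    by eventually_elim (use assms in blast)
  then show False by simp
qed

text \<open>The exponent bound of the theorem for weight 2 m. It is an integer because it may be
  negative, and the index set is then empty.\<close>

definition index_bound :: "nat \<Rightarrow> int" where
  "index_bound m = fl m e1 + fl m e2 + fl m e3 - int (2 * m)"

definition form :: "nat \<Rightarrow> complex \<Rightarrow> nat \<Rightarrow> complex \<Rightarrow> complex" where
  "form m K j = extend (\<lambda>z. K * base m z * t z ^ j)"

lemma form_regular: "z \<in> regular \<Longrightarrow> form m K j z = K * base m z * t z ^ j"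
  unfolding form_def
  by (intro extend_regular holomorphic_intros base_holomorphic t_holomorphic_regular)

lemma form_in_forms:
  assumes j: "int j \<le> index_bound m"
  shows "form m K j \<in> automorphic_forms \<Gamma> (2 * m)"
  unfolding form_def
proof (rule extend_in_forms)
  have e: "e1 > 0" "e2 > 0" "e3 > 0" using order_ge_2 by auto
  have base_lim: "\<exists>l. ((\<lambda>z. K * base m z * t z ^ j) \<longlongrightarrow> l) (at \<tau>)"
    if "\<exists>l. ((\<lambda>z. base m z * t z ^ j) \<longlongrightarrow> l) (at \<tau>)" for \<tau>
    using that tendsto_mult_left[of "\<lambda>z. base m z * t z ^ j" _ "at \<tau>" K] by (auto simp: mult.assoc)
  fix \<tau> assume "\<tau> \<in> {\<tau>1, \<tau>2, \<tau>3}"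
  then consider "\<tau> = \<tau>1" | "\<tau> = \<tau>2" | "\<tau> = \<tau>3" by blast
  then show "\<exists>l. ((\<lambda>z. K * base m z * t z ^ j) \<longlongrightarrow> l) (at \<tau>)"
  proof cases
    case 1
    have "(int e1 - 1) * int m - int e1 * fl m e1 + int e1 * int j \<ge> 0" using fl_bounds(1)[OF e(1), of m] by simp
    from local_form_tendsto[OF base_local_form_tau1 this] show ?thesis
      unfolding 1 by (intro base_lim) simp
  next
    case 2
    have "(int e2 - 1) * int m - int e2 * fl m e2 + int e2 * 0 \<ge> 0" using fl_bounds(1)[OF e(2), of m] by simp
    from local_form_tendsto[OF base_local_form_tau2 this] obtain l where "(base m \<longlongrightarrow> l) (at \<tau>2)" by auto
    then have "((\<lambda>z. base m z * t z ^ j) \<longlongrightarrow> l * 1 ^ j) (at \<tau>2)" by (intro tendsto_intros t_lim2)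
    then show ?thesis unfolding 2 by (intro base_lim) blast
  next
    case 3
    \<comment> \<open>For j equal to the bound, the order at \<tau>3 is (e3 - 1) m minus e3 times
      the third floor, which \<open>fl_bounds\<close> shows to be nonnegative; smaller j only raise
      the order.\<close>
    have "int e3 * int j \<le> int e3 * index_bound m" using j by (intro mult_left_mono) auto
    then have "int e3 * fl m e1 + int e3 * fl m e2 - (int e3 + 1) * int m + int e3 * (- int j) \<ge> 0"
      using fl_bounds(1)[OF e(3), of m] by (simp add: index_bound_def algebra_simps)
    from local_form_tendsto[OF base_local_form_tau3 this] show ?thesis
      unfolding 3 by (intro base_lim) (simp add: power_int_minus power_inverse)
  qed
qed (auto simp: base_mobius t_invariant regularD(1) intro!: meromorphic_intros base_meromorphic t_meromorphic
      holomorphic_intros base_holomorphic t_holomorphic_regular)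

lemma forms_subspace: "cfun.subspace (automorphic_forms \<Gamma> k)"
  unfolding cfun.subspace_def automorphic_forms_def cscale_def
  by (auto simp: algebra_simps zero_fun_def plus_fun_def intro!: holomorphic_intros)

text \<open>The quotient of f by \<open>base\<close> has weight 0. Since the floors in
  \<open>base\<close> are as large as possible, \<open>base\<close> vanishes at \<tau>1 and \<tau>2
  to order less than e1 and e2, which is exactly what \<open>automorphic_polynomial\<close> needs to
  give a polynomial in \<open>t\<close>.\<close>

lemma form_in_span:
  assumes f: "f \<in> automorphic_forms \<Gamma> (2 * m)" and K: "K \<noteq> 0"
  shows "f \<in> cfun.span (form m K ` {j. int j \<le> index_bound m})"
proof -
  have e: "e1 > 0" "e2 > 0" "e3 > 0" using order_ge_2 by auto
  have f_hol: "f holomorphic_on \<H>"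
    and f_eq: "\<And>A z. A \<in> \<Gamma> \<Longrightarrow> z \<in> \<H> \<Longrightarrow> f (mobius A z) = autom_factor A z ^ (2 * m) * f z"
    and f_0: "\<And>z. z \<notin> \<H> \<Longrightarrow> f z = 0"
    using f by (auto simp: automorphic_forms_def)
  have f_cont: "isCont f z" if "z \<in> \<H>" for z
    by (rule isCont_if_holomorphic[OF f_hol open_upper_half_plane that])
  define F where "F = (\<lambda>z. f z / base m z)"
  have "f analytic_on \<H>" using f_hol open_upper_half_plane by (simp add: analytic_on_open)
  then have F_mero: "F meromorphic_on \<H>"
    unfolding F_def by (intro meromorphic_intros base_meromorphic analytic_on_imp_meromorphic_on)
  have F_inv: "F (mobius A z) = F z" if A: "A \<in> \<Gamma>" and z: "z \<in> regular" for A z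
    using f_eq[OF A regularD(1)[OF z]] base_mobius[OF A z] autom_factor_neq_0[OF A regularD(1)[OF z]]
    by (simp add: F_def)
  have "F holomorphic_on regular"
    unfolding F_def using f_hol base_nonzero regularD(1)
    by (intro holomorphic_intros base_holomorphic) (auto intro: holomorphic_on_subset)
  then have F_np: "\<not> is_pole F z" if "z \<in> regular" for z
    using not_is_pole_holomorphic[OF open_regular that] by blast
  have "int e1 * 1 > (int e1 - 1) * int m - int e1 * fl m e1"
    using fl_bounds(2)[OF e(1), of m] by (simp add: algebra_simps)
  from local_form_quotient_tendsto[OF base_local_form_tau1 this f_cont[OF tau_in(1)]]
  have lim1: "((\<lambda>z. F z * t z) \<longlongrightarrow> 0) (at \<tau>1)" by (simp add: F_def)
  have "int e2 * 1 > (int e2 - 1) * int m - int e2 * fl m e2"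
    using fl_bounds(2)[OF e(2), of m] by (simp add: algebra_simps)
  from local_form_quotient_tendsto[OF base_local_form_tau2 this f_cont[OF tau_in(2)]]
  have "((\<lambda>z. F z * (1 - t z)) \<longlongrightarrow> 0) (at \<tau>2)" by (simp add: F_def)
  from tendsto_minus[OF this] have lim2: "((\<lambda>z. F z * (t z - 1)) \<longlongrightarrow> 0) (at \<tau>2)"
    by (simp add: algebra_simps)
  \<comment> \<open>The next exponent after the bound makes the order at \<tau>3 strictly positive;
    the resulting strict degree bound is the required one.\<close>
  have "int e3 * (index_bound m + 1) > int e3 * fl m e1 + int e3 * fl m e2 - (int e3 + 1) * int m"
    using fl_bounds(2)[OF e(3), of m] by (simp add: index_bound_def algebra_simps)
  from local_form_quotient_tendsto[OF base_local_form_tau3 this f_cont[OF tau_in(3)]]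
  have lim3: "((\<lambda>z. F z * t z powi (- (index_bound m + 1))) \<longlongrightarrow> 0) (at \<tau>3)"
    unfolding F_def power_int_minus power_int_inverse .
  obtain P where P: "P = 0 \<or> int (degree P) < index_bound m + 1"
    "\<forall>\<^sub>\<approx>z\<in>\<H>. F z = poly P (t z)"
    by (rule automorphic_polynomial[OF F_mero F_inv F_np lim1 lim2 lim3])
  \<comment> \<open>The zero polynomial has degree 0 by convention, so without this case index 0
    would occur even if the bound is negative.\<close>
  define J where "J = (if P = 0 then {} else {..degree P})"
  have J: "J \<subseteq> {j. int j \<le> index_bound m}" using P(1) by (auto simp: J_def)
  define g where "g = (\<Sum>j\<in>J. cscale (coeff P j / K) (form m K j))"
  have "g \<in> cfun.span (form m K ` {j. int j \<le> index_bound m})"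
    unfolding g_def using J by (intro cfun.span_sum cfun.span_scale cfun.span_base) blast
  moreover have "f = g"
  proof
    fix z
    \<comment> \<open>As a form, g is continuous on the upper half plane, which extends the equality
      from regular points to all points.\<close>
    have g_form: "g \<in> automorphic_forms \<Gamma> (2 * m)"
      unfolding g_def using J
      by (intro cfun.subspace_sum[OF forms_subspace] cfun.subspace_scale[OF forms_subspace] form_in_forms) blast
    show "f z = g z"
    proof (cases "z \<in> \<H>")
      case True
      have "g holomorphic_on \<H>" using g_form by (simp add: automorphic_forms_def)
      then have "isCont g z" by (rule isCont_if_holomorphic[OF _ open_upper_half_plane True])
      then have "(g \<longlongrightarrow> g z) (at z)" by (simp add: isCont_def)
      moreover have "\<forall>\<^sub>F x in at z. g x = f x"
        using regular_eventually[OF True] eventually_cosparse_imp_eventually_at[OF P(2) True, of UNIV]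
      proof eventually_elim
        case (elim x)
        have "g x = (\<Sum>j\<in>J. coeff P j / K * (K * base m x * t x ^ j))"
          unfolding g_def sum_apply by (simp add: cscale_def form_regular[OF elim(1)])
        also have "\<dots> = base m x * (\<Sum>j\<in>J. coeff P j * t x ^ j)"
          using K by (simp add: sum_distrib_left mult_ac)
        also have "(\<Sum>j\<in>J. coeff P j * t x ^ j) = poly P (t x)"
          by (auto simp: J_def poly_altdef)
        also have "base m x * poly P (t x) = f x"
          using elim base_nonzero[OF elim(1)] by (simp add: F_def field_simps)
        finally show ?case .
      qed
      ultimately have "(f \<longlongrightarrow> g z) (at z)" by (rule Lim_transform_eventually)
      moreover have "(f \<longlongrightarrow> f z) (at z)" using f_cont[OF True] by (simp add: isCont_def)
      ultimately show ?thesis using LIM_unique by blast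
    next
      case False
      then show ?thesis using f_0 g_form by (simp add: automorphic_forms_def)
    qed
  qed
  ultimately show ?thesis by simp
qed

text \<open>After division by \<open>base\<close> a linear relation becomes a polynomial vanishing
  at all values of \<open>t\<close> on regular points, of which there are infinitely many.\<close>

lemma form_combination_zero:
  assumes "finite I" "K \<noteq> 0" "(\<Sum>j\<in>I. cscale (u j) (form m K j)) = 0" "i \<in> I"
  shows "u i = 0"
proof -
  define P where "P = (\<Sum>j\<in>I. monom (u j) j)"
  have "poly P (t z) = 0" if z: "z \<in> regular" for z
  proof -
    have "0 = (\<Sum>j\<in>I. cscale (u j) (form m K j)) z" unfolding assms(3) by simp
    also have "\<dots> = (\<Sum>j\<in>I. u j * (K * base m z * t z ^ j))"
      unfolding sum_apply by (simp add: cscale_def form_regular[OF z])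
    also have "\<dots> = K * base m z * poly P (t z)"
      by (simp add: P_def poly_sum poly_monom sum_distrib_left mult_ac)
    finally show ?thesis using assms(2) base_nonzero[OF z] by simp
  qed
  then have "P = 0" by (rule poly_t_vanishes)
  then have "coeff P i = 0" by simp
  then show ?thesis using assms(1,4) by (simp add: P_def coeff_sum)
qed

lemma form_basis:
  assumes K: "K \<noteq> 0"
  shows "basis_family {j. int j \<le> index_bound m} (form m K) (automorphic_forms \<Gamma> (2 * m))"
proof -
  let ?J = "{j. int j \<le> index_bound m}"
  have inj: "inj (form m K)"
  proof (rule injI, rule ccontr)
    fix i j assume eq: "form m K i = form m K j" and ij: "i \<noteq> j"
    have "(\<Sum>l\<in>{i, j}. cscale (if l = i then 1 else - 1) (form m K l)) = 0"
      using ij eq by (simp add: fun_eq_iff cscale_def)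
    from form_combination_zero[OF _ K this, of i] show False by simp
  qed
  have "cfun.independent (form m K ` ?J)"
    unfolding cfun.independent_explicit_module
  proof (intro allI impI)
    fix T u v assume T: "finite T" "T \<subseteq> form m K ` ?J" "(\<Sum>v\<in>T. cscale (u v) v) = 0" "v \<in> T"
    obtain I where I: "I \<subseteq> ?J" "finite I" "T = form m K ` I"
      using finite_subset_image[OF T(1,2)] by blast
    obtain i where i: "i \<in> I" "v = form m K i" using T(4) I(3) by blast
    have "(\<Sum>j\<in>I. cscale (u (form m K j)) (form m K j)) = 0"
      using T(3) unfolding I(3) by (subst (asm) sum.reindex) (use inj in \<open>auto simp: inj_on_def inj_def\<close>)
    from form_combination_zero[OF I(2) K this i(1)] show "u v = 0" using i(2) by simp
  qed
  moreover have "cfun.span (form m K ` ?J) = automorphic_forms \<Gamma> (2 * m)"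
  proof
    show "cfun.span (form m K ` ?J) \<subseteq> automorphic_forms \<Gamma> (2 * m)"
      using form_in_forms by (intro cfun.span_minimal forms_subspace) auto
  qed (use form_in_span[OF _ K] in blast)
  moreover have "inj_on (form m K) ?J" using inj by (rule inj_on_subset) simp
  ultimately show ?thesis by (simp add: basis_family_def)
qed

end

section \<open>Identification of the basis with hypergeometric expressions near the first elliptic
  point\<close>

theorem theorem9:
  fixes \<Gamma> :: "(real^2^2) set" and e1 e2 e3 k :: nat
    and \<tau>1 \<tau>2 \<tau>3 :: complex and t :: "complex \<Rightarrow> complex"
    and a b c a' b' c' :: real
  assumes "shimura_group \<Gamma>"
    and "signature_0_3 \<Gamma> \<tau>1 \<tau>2 \<tau>3 e1 e2 e3"
    and "hauptmodul \<Gamma> t"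
    and "t \<midarrow>\<tau>1\<rightarrow> 0" and "t \<midarrow>\<tau>2\<rightarrow> 1" and "is_pole t \<tau>3"
    and "a = (1 - 1 / real e1 - 1 / real e2 - 1 / real e3) / 2"
    and "b = a + 1 / real e3"
    and "c = 1 - 1 / real e1"
    and "a' = a + 1 / real e1"
    and "b' = b + 1 / real e1"
    and "c' = c + 2 / real e1"
    and "even k" and "k \<ge> 4"
  shows "\<exists>C::complex. \<exists>U s g.
     open U \<and> \<tau>1 \<in> U \<and> U \<subseteq> upper_half_plane \<and>
     s holomorphic_on U \<and> (\<forall>\<tau>\<in>U. s \<tau> ^ e1 = t \<tau> \<and> norm (t \<tau>) < 1) \<and>
     (let J = {j::nat. int j \<le> \<lfloor>real k * (1 - 1 / real e1) / 2\<rfloor>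
                             + \<lfloor>real k * (1 - 1 / real e2) / 2\<rfloor>
                             + \<lfloor>real k * (1 - 1 / real e3) / 2\<rfloor> - int k}
      in (\<forall>j\<in>J. g j \<in> automorphic_forms \<Gamma> k \<and>
            (\<forall>\<tau>\<in>U. g j \<tau> =
               branch_power e1 (s \<tau>) (frac (real k * (1 - 1 / real e1) / 2)) *
               (1 - t \<tau>) powr of_real (frac (real k * (1 - 1 / real e2) / 2)) *
               t \<tau> ^ j *
               (hyp2F1 a b c (t \<tau>) +
                C * branch_power e1 (s \<tau>) (1 / real e1) * hyp2F1 a' b' c' (t \<tau>)) ^ k)) \<and>
         basis_family J g (automorphic_forms \<Gamma> k))"
proof -
  have "subgroup \<Gamma> SL2R" using assms(1) by (simp add: shimura_group_def)
  then interpret triangle_setting \<Gamma> t \<tau>1 \<tau>2 \<tau>3 e1 e2 e3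
    using assms(2-6) by (intro triangle_setting.intro SL2R_subgroup.intro triangle_setting_axioms.intro)
  have e: "e1 > 0" "e2 > 0" "e3 > 0" using order_ge_2 by auto
  obtain m where k: "k = 2 * m" using \<open>even k\<close> by blast
  define J where "J = {j::nat. int j \<le> \<lfloor>real k * (1 - 1 / real e1) / 2\<rfloor>
                             + \<lfloor>real k * (1 - 1 / real e2) / 2\<rfloor>
                             + \<lfloor>real k * (1 - 1 / real e3) / 2\<rfloor> - int k}"
  have half: "real k * x / 2 = real m * x" for x by (simp add: k)
  have J: "J = {j. int j \<le> index_bound m}"
    unfolding J_def index_bound_def fl_def half by (simp only: k)
  obtain r s y A C where loc: "0 < r" "ball \<tau>1 r \<subseteq> upper_half_plane" "s holomorphic_on ball \<tau>1 r"
    "s \<tau>1 = 0" "\<forall>x\<in>ball \<tau>1 r. t x = s x ^ e1" "\<forall>x\<in>ball \<tau>1 r. deriv s x \<noteq> 0"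
    "\<forall>x\<in>ball \<tau>1 r - {\<tau>1}. x \<in> regular \<and> s x \<noteq> 0" "\<forall>x\<in>ball \<tau>1 r. norm (t x) < 1"
    "y holomorphic_on ball \<tau>1 r" "\<forall>x\<in>ball \<tau>1 r. (y x)\<^sup>2 = deriv s x * exp (- c2 * Ln (1 - t x))"
    "A \<noteq> 0" "\<forall>x\<in>ball \<tau>1 r. y x = A * (hyp2F1 a b (1 - 1 / real e1) (t x)
       + C * s x * hyp2F1 (a + 1 / real e1) (b + 1 / real e1) (1 + 1 / real e1) (t x))"
    by (rule hypergeometric_expansion[OF assms(7,8)])
  \<comment> \<open>Cancels e1^m, which comes from t' = e1 s^(e1 - 1) s', and the power of A that
    separates y from the normalised hypergeometric sum.\<close>
  define K where "K = 1 / (of_nat e1 ^ m * A ^ (2 * m))"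
  have K: "K \<noteq> 0" using e(1) loc(11) by (simp add: K_def)
  \<comment> \<open>The exponent of s in the formula. It is the remainder of (e1 - 1) m modulo e1,
    which is the order of \<open>base m\<close> at \<tau>1.\<close>
  define N where "N = nat \<lfloor>real e1 * frac (real k * (1 - 1 / real e1) / 2)\<rfloor>"
  define q where "q = frac (real k * (1 - 1 / real e2) / 2)"
  have N: "int N = (int e1 - 1) * int m - int e1 * fl m e1"
  proof -
    have "real e1 * frac (real k * (1 - 1 / real e1) / 2)
        = real_of_int ((int e1 - 1) * int m - int e1 * fl m e1)"
      using e(1) unfolding half frac_def fl_def by (simp add: field_simps)
    then have "\<lfloor>real e1 * frac (real k * (1 - 1 / real e1) / 2)\<rfloor>
        = (int e1 - 1) * int m - int e1 * fl m e1" by (simp only: floor_of_int)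
    then show ?thesis using fl_bounds(1)[OF e(1), of m] by (simp add: N_def)
  qed
  have q: "of_real q = of_nat m * c2 - of_int (fl m e2)"
    unfolding q_def half frac_def fl_def c2_def by simp
  have t_hol: "t holomorphic_on ball \<tau>1 r"
  proof -
    have "t holomorphic_on ball \<tau>1 r \<longleftrightarrow> (\<lambda>x. s x ^ e1) holomorphic_on ball \<tau>1 r"
      by (intro holomorphic_cong refl) (use loc(5) in blast)
    then show ?thesis using holomorphic_on_power[OF loc(3)] by blast
  qed
  \<comment> \<open>The prescribed expression with y / A in place of the hypergeometric sum. It is
    holomorphic at \<tau>1 as well, where the product formula for \<open>base\<close> may break
    down.\<close>
  define \<rho> where "\<rho> = (\<lambda>j x. s x ^ N * exp (of_real q * Ln (1 - t x)) * t x ^ j * (y x / A) ^ k)"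
  have \<rho>_hol: "\<rho> j holomorphic_on ball \<tau>1 r" for j
    unfolding \<rho>_def using loc(8,11) one_minus_not_nonpos
    by (intro holomorphic_intros loc(3,9) t_hol) auto
  have loc_eq: "K * base m x * t x ^ j = \<rho> j x" if x: "x \<in> ball \<tau>1 r - {\<tau>1}" for x j
  proof -
    have xb: "x \<in> ball \<tau>1 r" and s0: "s x \<noteq> 0" and xr: "x \<in> regular" using x loc(7) by auto
    have T: "t x = s x ^ e1" if "x \<in> ball \<tau>1 r" for x using loc(5) that by blast
    have dt: "deriv t x = of_nat e1 * s x ^ (e1 - 1) * deriv s x"
      by (rule DERIV_imp_deriv[OF deriv_root_power[OF loc(3) open_ball xb T]])
    have "1 - t x \<noteq> 0" using regularD(4)[OF xr] by simp
    then have pw: "(1 - t x) powi (- fl m e2) = exp (of_int (- fl m e2) * Ln (1 - t x))"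
      using exp_power_int[of "Ln (1 - t x)" "- fl m e2"] by simp
    have "y x ^ k = ((y x)\<^sup>2) ^ m" by (simp add: k power_mult)
    also have "\<dots> = deriv s x ^ m * exp (of_nat m * (- c2 * Ln (1 - t x)))"
      by (simp only: bspec[OF loc(10) xb] power_mult_distrib exp_of_nat_mult)
    finally have yk: "y x ^ k = deriv s x ^ m * exp (of_nat m * (- c2 * Ln (1 - t x)))" .
    have "deriv t x ^ m * t x powi (- fl m e1) = s x powi int N * (of_nat e1 * deriv s x) ^ m"
      unfolding dt T[OF xb] N by (rule power_int_root_power[OF s0 e(1)])
    then have "K * base m x * t x ^ j
        = s x ^ N * (1 - t x) powi (- fl m e2) * t x ^ j * (deriv s x ^ m / A ^ k)"
      using e(1) by (simp add: base_def K_def k power_mult_distrib)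
    also have "deriv s x ^ m / A ^ k = (y x / A) ^ k * exp (of_nat m * c2 * Ln (1 - t x))"
      unfolding power_divide yk by (simp flip: exp_add)
    also have "s x ^ N * (1 - t x) powi (- fl m e2) * t x ^ j
          * ((y x / A) ^ k * exp (of_nat m * c2 * Ln (1 - t x)))
        = s x ^ N * (exp (of_int (- fl m e2) * Ln (1 - t x)) * exp (of_nat m * c2 * Ln (1 - t x)))
          * t x ^ j * (y x / A) ^ k"
      unfolding pw by (simp add: mult_ac)
    also have "exp (of_int (- fl m e2) * Ln (1 - t x)) * exp (of_nat m * c2 * Ln (1 - t x))
        = exp (of_real q * Ln (1 - t x))"
      unfolding q exp_add[symmetric] by (simp add: algebra_simps)
    finally show ?thesis by (simp add: \<rho>_def)
  qed
  \<comment> \<open>The two functions agree off \<tau>1; at \<tau>1 the form is by definition the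
    limit, which is the value of the analytic function \<rho>.\<close>
  have form_eq: "form m K j x = \<rho> j x" if x: "x \<in> ball \<tau>1 r" for x j
  proof -
    have "\<rho> j analytic_on {x}"
      using \<rho>_hol x by (meson analytic_on_open analytic_on_subset empty_subsetI insert_subset open_ball)
    then have "remove_sings (\<rho> j) x = \<rho> j x" by simp
    moreover have "remove_sings (\<lambda>z. K * base m z * t z ^ j) x = remove_sings (\<rho> j) x"
    proof (rule remove_sings_cong)
      have "\<forall>\<^sub>F z in at x. z \<in> ball \<tau>1 r - {\<tau>1}"
        using eventually_at_in_open'[OF open_ball x] eventually_neq_at_within[of \<tau>1 x]
        by eventually_elim simp
      then show "\<forall>\<^sub>F z in at x. K * base m z * t z ^ j = \<rho> j z" by eventually_elim (rule loc_eq)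
    qed simp
    ultimately show ?thesis using x loc(2) by (auto simp: form_def extend_def)
  qed
  have root: "branch_power e1 z (1 / real e1) = z" for z
    using e(1) by (simp add: branch_power_def)
  have params: "c = 1 - 1 / real e1" "a' = a + 1 / real e1" "b' = b + 1 / real e1" "c' = 1 + 1 / real e1"
    using assms(9-12) by auto
  have formula: "form m K j x = branch_power e1 (s x) (frac (real k * (1 - 1 / real e1) / 2)) *
      (1 - t x) powr of_real (frac (real k * (1 - 1 / real e2) / 2)) * t x ^ j *
      (hyp2F1 a b c (t x) + C * branch_power e1 (s x) (1 / real e1) * hyp2F1 a' b' c' (t x)) ^ k"
    if x: "x \<in> ball \<tau>1 r" for x j
  proof -
    have "1 - t x \<noteq> 0" using bspec[OF loc(8) x] by auto
    moreover have "y x / A = hyp2F1 a b c (t x) + C * s x * hyp2F1 a' b' c' (t x)"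
      using bspec[OF loc(12) x] loc(11) unfolding params by simp
    ultimately show ?thesis
      unfolding form_eq[OF x] \<rho>_def root by (simp add: branch_power_def N_def q_def powr_def)
  qed
  show ?thesis
    unfolding J_def[symmetric] Let_def
    by (rule exI[of _ C], rule exI[of _ "ball \<tau>1 r"], rule exI[of _ s], rule exI[of _ "form m K"])
      (use loc formula form_basis[OF K, of m] form_in_forms in \<open>auto simp: J k\<close>)
qed

end
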